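(* Suppose that the Taylor complex $\tilde K$ of $\mathcal A$ is a resolution of $S/I$. Then the complex $\tilde M$ is a minimal resolution of $S/I$.
   Context: Let $k$ be a field, $S=k[x_1,\dots,x_n]$, and let $\mathcal A=\{Q_1,\dots,Q_m\}\subset S$ be a finite set of homogeneous polynomials, linearly ordered by index, minimally generating an ideal $I$. Least common multiples are normalized to be products of fixed representatives of the irreducible factors of the $Q_i$. For $\sigma\subset\mathcal A$ let $Q_\sigma$ be the least common multiple of the elements of $\sigma$, $Q_\emptyset=1$. Let $D=\{Q_\sigma:\sigma\subset\mathcal A\}$, a lattice under divisibility. $K$ is the complex in which $K_p$ is the $k$-space with basis $\{\sigma\subset\mathcal A:|\sigma|=p\}$, with $d(\tau)=\sum_{Q_i\in\tau}(-1)^{\epsilon(\tau,i)}\tau\setminus\{Q_i\}$, $\epsilon(\tau,i)=|\{Q_j\in\tau:j<i\}|$. The Taylor complex $\tilde K$ consists of the free $S$-modules $\tilde K_p=K_p\otimes_k S$ with $\tilde d(\tau)=\sum_{Q_i\in\tau}(-1)^{\epsilon(\tau,i)}\frac{Q_\tau}{Q_{\tau\setminus\{Q_i\}}}\,\tau\setminus\{Q_i\}$; $H_0(\tilde K)=S/I$. For $Q\in D$ let $\mathcal B(Q)=\{\sigma\subset\mathcal A:Q_\sigma=Q\}$ and let $K(Q)\subset K$ be the graded subspace spanned by $\mathcal B(Q)$, so $K=\bigoplus_{Q\in D}K(Q)$ as graded spaces; let $\pi_Q:K\to K(Q)$ be the projection. $K(Q)$ is a complex with differential $d(Q)=\pi_Q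 d|_{K(Q)}$. Let $Z(Q)_p,B(Q)_p\subset K(Q)_p$ be its cycles and boundaries of degree $p$. Fix (a noncanonical choice) decompositions $K(Q)_p=B(Q)_p\oplus H'(Q)_p\oplus B'(Q)_{p-1}$ with $B(Q)_p\oplus H'(Q)_p=Z(Q)_p$; thus $B'(Q)_{p-1}\subset K(Q)_p$ and $d(Q)$ restricts to an isomorphism $B'(Q)_{p-1}\to B(Q)_{p-1}$, while $H'(Q)_p$ maps isomorphically to $H_p(K(Q))$. Put $H'=\bigoplus_Q H'(Q)$, $B'=\bigoplus_Q B'(Q)$. For each $a\in H'_p=\bigoplus_Q H'(Q)_p$ there is a unique $f(a)\in\bigoplus_P B'(P)_{p-1}$ with $d(a+f(a))\in H'\oplus B'$; this defines a linear map $f:H'\to B'$. Put $M=\{a+f(a):a\in H'\}$, a graded linear subspace of $K$ which is a subcomplex of $K$. $\tilde M$ is the graded free $S$-submodule of $\tilde K$ generated by $M$, regarded as a subcomplex of $\tilde K$. *)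

theory Defs
  imports
    Complex_Main
    "HOL-Library.Poly_Mapping"
    "HOL-Library.Multiset"
    "HOL-Computational_Algebra.Factorial_Ring"
begin

section \<open>The polynomial ring\<close>

text \<open>
  \<open>k[x\<^sub>1,\<dots>,x\<^sub>n]\<close> with variables indexed by the finite type \<open>'n\<close>, as finitely supported functions
  from exponent vectors to coefficients.  The multiplication on \<^typ>\<open>'a \<Rightarrow>\<^sub>0 'b\<close> is convolution.
\<close>

type_synonym ('n, 'k) mpoly = "('n \<Rightarrow>\<^sub>0 nat) \<Rightarrow>\<^sub>0 'k"

definition mvar :: "'n \<Rightarrow> ('n, 'k::field) mpoly" where
  "mvar x = Poly_Mapping.single (Poly_Mapping.single x 1) 1"

definition mconst :: "'k::field \<Rightarrow> ('n, 'k) mpoly" where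
  "mconst c = Poly_Mapping.single 0 c"

definition monom_degree :: "('n \<Rightarrow>\<^sub>0 nat) \<Rightarrow> nat" where
  "monom_degree t = (\<Sum>x\<in>Poly_Mapping.keys t. Poly_Mapping.lookup t x)"

definition homogeneous_of_degree :: "nat \<Rightarrow> ('n, 'k::field) mpoly \<Rightarrow> bool" where
  "homogeneous_of_degree e p \<longleftrightarrow> (\<forall>t\<in>Poly_Mapping.keys p. monom_degree t = e)"

definition homogeneous :: "('n, 'k::field) mpoly \<Rightarrow> bool" where
  "homogeneous p \<longleftrightarrow> (\<exists>e. homogeneous_of_degree e p)"

definition ideal_generated :: "'a::comm_ring_1 set \<Rightarrow> 'a set" where
  "ideal_generated A = module.span (*) A"

definition irrelevant_ideal :: "('n, 'k::field) mpoly set" where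
  "irrelevant_ideal = ideal_generated (range mvar)"

definition minimally_generates :: "nat \<Rightarrow> (nat \<Rightarrow> 'a::comm_ring_1) \<Rightarrow> 'a set \<Rightarrow> bool" where
  "minimally_generates m Q I \<longleftrightarrow>
     I = ideal_generated (Q ` {..<m}) \<and>
     (\<forall>i<m. Q i \<notin> ideal_generated (Q ` ({..<m} - {i})))"


section \<open>Normalized least common multiples\<close>

definition is_lcm :: "'a::comm_semiring_1 set \<Rightarrow> 'a \<Rightarrow> bool" where
  "is_lcm A l \<longleftrightarrow> (\<forall>a\<in>A. a dvd l) \<and> (\<forall>c. (\<forall>a\<in>A. a dvd c) \<longrightarrow> l dvd c)"

text \<open>One representative from each class of associated irreducible factors of the \<open>Q i\<close>.\<close>

definition irreducible_representatives ::
  "nat \<Rightarrow> (nat \<Rightarrow> 'a::comm_semiring_1) \<Rightarrow> 'a set \<Rightarrow> bool" where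
  "irreducible_representatives m Q R \<longleftrightarrow>
     (\<forall>r\<in>R. irreducible r \<and> (\<exists>i<m. r dvd Q i)) \<and>
     (\<forall>p. irreducible p \<and> (\<exists>i<m. p dvd Q i) \<longrightarrow> (\<exists>!r. r \<in> R \<and> p dvd r \<and> r dvd p))"

text \<open>
  The lcm of \<open>A\<close> that is a product (with repetitions) of elements of \<open>R\<close>; for \<open>A = {}\<close> this is \<open>1\<close>.
\<close>

definition normalized_lcm :: "'a::comm_semiring_1 set \<Rightarrow> 'a set \<Rightarrow> 'a \<Rightarrow> bool" where
  "normalized_lcm R A l \<longleftrightarrow> is_lcm A l \<and> (\<exists>N. set_mset N \<subseteq> R \<and> l = prod_mset N)"

text \<open>
  A subset \<open>\<sigma>\<close> of \<open>{Q 0, \<dots>, Q (m - 1)}\<close> is represented by its set of indices, and \<open>L \<sigma>\<close> is the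
  polynomial \<open>Q\<^sub>\<sigma>\<close>.
\<close>

definition lcm_lattice :: "nat \<Rightarrow> (nat set \<Rightarrow> 'a) \<Rightarrow> 'a set" where
  "lcm_lattice m L = L ` Pow {..<m}"

definition exact_quotient :: "'a::comm_semiring_1 \<Rightarrow> 'a \<Rightarrow> 'a" where
  "exact_quotient a b = (THE c. a = b * c)"


section \<open>Free modules on sets of indices\<close>

text \<open>
  \<^typ>\<open>nat set \<Rightarrow>\<^sub>0 'a\<close> is the free \<open>'a\<close>-module on all sets of indices.  It is used both over the
  field and over the polynomial ring.
\<close>

definition smul :: "'a::comm_ring_1 \<Rightarrow> (nat set \<Rightarrow>\<^sub>0 'a) \<Rightarrow> (nat set \<Rightarrow>\<^sub>0 'a)" where
  "smul c z = Poly_Mapping.map ((*) c) z"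

lemma lookup_smul: "Poly_Mapping.lookup (smul c z) \<sigma> = c * Poly_Mapping.lookup z \<sigma>"
  by (simp add: smul_def Poly_Mapping.map.rep_eq when_def)

lemma module_smul: "module smul"
  by standard (rule poly_mapping_eqI; simp add: lookup_smul lookup_add algebra_simps)+

lemma module_times: "module ((*) :: 'a::comm_ring_1 \<Rightarrow> 'a \<Rightarrow> 'a)"
  by standard (simp_all add: algebra_simps)

definition index_chains :: "nat \<Rightarrow> nat \<Rightarrow> (nat set \<Rightarrow>\<^sub>0 'a::zero) set" where
  "index_chains m p = {z. Poly_Mapping.keys z \<subseteq> {\<sigma>. \<sigma> \<subseteq> {..<m} \<and> card \<sigma> = p}}"

definition eps :: "nat set \<Rightarrow> nat \<Rightarrow> nat" where
  "eps \<tau> i = card {j \<in> \<tau>. j < i}"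

definition bd :: "(nat set \<Rightarrow>\<^sub>0 'k::field) \<Rightarrow> (nat set \<Rightarrow>\<^sub>0 'k)" where
  "bd z = (\<Sum>\<tau>\<in>Poly_Mapping.keys z. \<Sum>i\<in>\<tau>.
     Poly_Mapping.single (\<tau> - {i}) ((-1) ^ eps \<tau> i * Poly_Mapping.lookup z \<tau>))"

definition taylor_bd ::
  "(nat set \<Rightarrow> ('n, 'k::field) mpoly) \<Rightarrow> (nat set \<Rightarrow>\<^sub>0 ('n, 'k) mpoly) \<Rightarrow> (nat set \<Rightarrow>\<^sub>0 ('n, 'k) mpoly)" where
  "taylor_bd L z = (\<Sum>\<tau>\<in>Poly_Mapping.keys z. \<Sum>i\<in>\<tau>.
     Poly_Mapping.single (\<tau> - {i})
       ((-1) ^ eps \<tau> i * exact_quotient (L \<tau>) (L (\<tau> - {i})) * Poly_Mapping.lookup z \<tau>))"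

text \<open>
  The internal grading of the Taylor complex: the basis element \<open>\<sigma>\<close> has degree \<open>deg Q\<^sub>\<sigma>\<close>, so an
  element is homogeneous of degree \<open>e\<close> iff all products \<open>Q\<^sub>\<sigma> z\<^sub>\<sigma>\<close> are.
\<close>

definition taylor_homogeneous ::
  "(nat set \<Rightarrow> ('n, 'k::field) mpoly) \<Rightarrow> nat \<Rightarrow> (nat set \<Rightarrow>\<^sub>0 ('n, 'k) mpoly) \<Rightarrow> bool" where
  "taylor_homogeneous L e z \<longleftrightarrow>
     (\<forall>\<sigma>\<in>Poly_Mapping.keys z. homogeneous_of_degree e (L \<sigma> * Poly_Mapping.lookup z \<sigma>))"

definition augmentation :: "(nat set \<Rightarrow>\<^sub>0 'a::zero) \<Rightarrow> 'a" where
  "augmentation z = Poly_Mapping.lookup z {}"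


section \<open>Graded free resolutions and minimality\<close>

text \<open>
  In the following, \<open>deg e z\<close> means that \<open>z\<close> is homogeneous of (internal) degree \<open>e\<close>, and \<open>C p\<close> is
  the submodule of homological degree \<open>p\<close> of the complex \<open>C\<close>.
\<close>

definition graded_free ::
  "(nat \<Rightarrow> (nat set \<Rightarrow>\<^sub>0 'a::comm_ring_1) \<Rightarrow> bool) \<Rightarrow> (nat set \<Rightarrow>\<^sub>0 'a) set \<Rightarrow> bool" where
  "graded_free deg N \<longleftrightarrow>
     (\<exists>E. finite E \<and> \<not> module.dependent smul E \<and> module.span smul E = N \<and> (\<forall>b\<in>E. \<exists>e. deg e b))"

text \<open>
  The last two conjuncts say that \<open>\<epsilon>\<close> induces an isomorphism \<open>C 0 / \<delta> (C 1) \<cong> S / I\<close>.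
\<close>

definition graded_free_resolution ::
  "(nat \<Rightarrow> (nat set \<Rightarrow>\<^sub>0 ('n, 'k::field) mpoly) \<Rightarrow> bool) \<Rightarrow> (nat \<Rightarrow> (nat set \<Rightarrow>\<^sub>0 ('n, 'k) mpoly) set) \<Rightarrow>
   ((nat set \<Rightarrow>\<^sub>0 ('n, 'k) mpoly) \<Rightarrow> (nat set \<Rightarrow>\<^sub>0 ('n, 'k) mpoly)) \<Rightarrow>
   ((nat set \<Rightarrow>\<^sub>0 ('n, 'k) mpoly) \<Rightarrow> ('n, 'k) mpoly) \<Rightarrow> ('n, 'k) mpoly set \<Rightarrow> bool" where
  "graded_free_resolution deg C \<delta> \<epsilon> I \<longleftrightarrow>
     (\<forall>p. graded_free deg (C p)) \<and>
     module_hom smul smul \<delta> \<and> module_hom smul (*) \<epsilon> \<and>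
     (\<forall>p. \<delta> ` C (Suc p) \<subseteq> C p) \<and>
     (\<forall>p e z. z \<in> C (Suc p) \<and> deg e z \<longrightarrow> deg e (\<delta> z)) \<and>
     (\<forall>e z. z \<in> C 0 \<and> deg e z \<longrightarrow> homogeneous_of_degree e (\<epsilon> z)) \<and>
     (\<forall>p. {z \<in> C (Suc p). \<delta> z = 0} = \<delta> ` C (Suc (Suc p))) \<and>
     {z \<in> C 0. \<epsilon> z \<in> I} = \<delta> ` C 1 \<and>
     (\<forall>s. \<exists>z\<in>C 0. s - \<epsilon> z \<in> I)"

definition minimal_graded_free_resolution ::
  "(nat \<Rightarrow> (nat set \<Rightarrow>\<^sub>0 ('n, 'k::field) mpoly) \<Rightarrow> bool) \<Rightarrow> (nat \<Rightarrow> (nat set \<Rightarrow>\<^sub>0 ('n, 'k) mpoly) set) \<Rightarrow>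
   ((nat set \<Rightarrow>\<^sub>0 ('n, 'k) mpoly) \<Rightarrow> (nat set \<Rightarrow>\<^sub>0 ('n, 'k) mpoly)) \<Rightarrow>
   ((nat set \<Rightarrow>\<^sub>0 ('n, 'k) mpoly) \<Rightarrow> ('n, 'k) mpoly) \<Rightarrow> ('n, 'k) mpoly set \<Rightarrow> bool" where
  "minimal_graded_free_resolution deg C \<delta> \<epsilon> I \<longleftrightarrow>
     graded_free_resolution deg C \<delta> \<epsilon> I \<and>
     (\<forall>p. \<delta> ` C (Suc p) \<subseteq> module.span smul {smul s z |s z. s \<in> irrelevant_ideal \<and> z \<in> C p})"


section \<open>The strands K(Q) and their decompositions\<close>

definition strand :: "nat \<Rightarrow> (nat set \<Rightarrow> 'q) \<Rightarrow> 'q \<Rightarrow> nat \<Rightarrow> (nat set \<Rightarrow>\<^sub>0 'k::field) set" where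
  "strand m L q p = {z \<in> index_chains m p. \<forall>\<sigma>\<in>Poly_Mapping.keys z. L \<sigma> = q}"

definition strand_proj :: "(nat set \<Rightarrow> 'q) \<Rightarrow> 'q \<Rightarrow> (nat set \<Rightarrow>\<^sub>0 'k::field) \<Rightarrow> (nat set \<Rightarrow>\<^sub>0 'k)" where
  "strand_proj L q z = Poly_Mapping.mapp (\<lambda>\<sigma> c. if L \<sigma> = q then c else 0) z"

definition strand_bd :: "(nat set \<Rightarrow> 'q) \<Rightarrow> 'q \<Rightarrow> (nat set \<Rightarrow>\<^sub>0 'k::field) \<Rightarrow> (nat set \<Rightarrow>\<^sub>0 'k)" where
  "strand_bd L q z = strand_proj L q (bd z)"

text \<open>The strand is zero in degree \<open>-1\<close>, so in degree \<open>0\<close> every element is a cycle.\<close>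

definition strand_cycles :: "nat \<Rightarrow> (nat set \<Rightarrow> 'q) \<Rightarrow> 'q \<Rightarrow> nat \<Rightarrow> (nat set \<Rightarrow>\<^sub>0 'k::field) set" where
  "strand_cycles m L q p = {z \<in> strand m L q p. strand_bd L q z = 0}"

definition strand_boundaries :: "nat \<Rightarrow> (nat set \<Rightarrow> 'q) \<Rightarrow> 'q \<Rightarrow> nat \<Rightarrow> (nat set \<Rightarrow>\<^sub>0 'k::field) set" where
  "strand_boundaries m L q p = strand_bd L q ` strand m L q (Suc p)"

definition internal_direct_sum :: "'a::ab_group_add set \<Rightarrow> 'a set \<Rightarrow> 'a set \<Rightarrow> bool" where
  "internal_direct_sum U V W \<longleftrightarrow> U = {v + w |v w. v \<in> V \<and> w \<in> W} \<and> V \<inter> W = {0}"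

text \<open>
  \<open>Hc q p\<close> is \<open>H'(q)\<^sub>p\<close>.  \<open>Bc\<close> is indexed by the degree in which it lives, so \<open>Bc q p \<subseteq> K(q)\<^sub>p\<close> is
  what is usually written \<open>B'(q)\<^bsub>p-1\<^esub>\<close>.  The two conditions together say that
  \<open>K(q)\<^sub>p = B(q)\<^sub>p \<oplus> H'(q)\<^sub>p \<oplus> B'(q)\<^bsub>p-1\<^esub>\<close> with \<open>B(q)\<^sub>p \<oplus> H'(q)\<^sub>p = Z(q)\<^sub>p\<close>.
\<close>

definition strand_decompositions ::
  "nat \<Rightarrow> (nat set \<Rightarrow> 'q) \<Rightarrow> ('q \<Rightarrow> nat \<Rightarrow> (nat set \<Rightarrow>\<^sub>0 'k::field) set) \<Rightarrow>
   ('q \<Rightarrow> nat \<Rightarrow> (nat set \<Rightarrow>\<^sub>0 'k) set) \<Rightarrow> bool" where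
  "strand_decompositions m L Hc Bc \<longleftrightarrow>
     (\<forall>q\<in>lcm_lattice m L. \<forall>p.
        module.subspace smul (Hc q p) \<and> module.subspace smul (Bc q p) \<and>
        internal_direct_sum (strand_cycles m L q p) (strand_boundaries m L q p) (Hc q p) \<and>
        internal_direct_sum (strand m L q p) (strand_cycles m L q p) (Bc q p))"


section \<open>The complexes M and M tilde\<close>

text \<open>\<open>\<Oplus>\<^sub>q V(q)\<^sub>p\<close> as a subspace of \<open>K\<^sub>p\<close>; the sum is direct for \<open>V(q)\<^sub>p \<subseteq> K(q)\<^sub>p\<close>.\<close>

definition total_part ::
  "nat \<Rightarrow> (nat set \<Rightarrow> 'q) \<Rightarrow> ('q \<Rightarrow> nat \<Rightarrow> (nat set \<Rightarrow>\<^sub>0 'k::field) set) \<Rightarrow> nat \<Rightarrow> (nat set \<Rightarrow>\<^sub>0 'k) set" where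
  "total_part m L V p = module.span smul (\<Union>q\<in>lcm_lattice m L. V q p)"

definition correction ::
  "nat \<Rightarrow> (nat set \<Rightarrow> 'q) \<Rightarrow> ('q \<Rightarrow> nat \<Rightarrow> (nat set \<Rightarrow>\<^sub>0 'k::field) set) \<Rightarrow>
   ('q \<Rightarrow> nat \<Rightarrow> (nat set \<Rightarrow>\<^sub>0 'k) set) \<Rightarrow> nat \<Rightarrow> (nat set \<Rightarrow>\<^sub>0 'k) \<Rightarrow> (nat set \<Rightarrow>\<^sub>0 'k)" where
  "correction m L Hc Bc p a =
     (THE b. b \<in> total_part m L Bc p \<and>
             bd (a + b) \<in> module.span smul (\<Union>p'. total_part m L Hc p' \<union> total_part m L Bc p'))"

definition M_complex ::
  "nat \<Rightarrow> (nat set \<Rightarrow> 'q) \<Rightarrow> ('q \<Rightarrow> nat \<Rightarrow> (nat set \<Rightarrow>\<^sub>0 'k::field) set) \<Rightarrow>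
   ('q \<Rightarrow> nat \<Rightarrow> (nat set \<Rightarrow>\<^sub>0 'k) set) \<Rightarrow> nat \<Rightarrow> (nat set \<Rightarrow>\<^sub>0 'k) set" where
  "M_complex m L Hc Bc p = {a + correction m L Hc Bc p a |a. a \<in> total_part m L Hc p}"

text \<open>
  An element of \<open>K\<close> supported on sets \<open>\<sigma>\<close> with \<open>Q\<^sub>\<sigma>\<close> dividing \<open>q\<close> corresponds to the element of
  multidegree \<open>q\<close> of the Taylor complex obtained by replacing \<open>\<sigma>\<close> by \<open>(q / Q\<^sub>\<sigma>) \<sigma>\<close>.  This
  correspondence commutes with the differentials, whereas \<open>\<sigma> \<mapsto> 1 \<cdot> \<sigma>\<close> does not; it is the sense in
  which the graded subspace \<open>M\<close> of \<open>K\<close> generates a subcomplex of the Taylor complex.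
\<close>

definition homogenize ::
  "(nat set \<Rightarrow> ('n, 'k::field) mpoly) \<Rightarrow> ('n, 'k) mpoly \<Rightarrow> (nat set \<Rightarrow>\<^sub>0 'k) \<Rightarrow> (nat set \<Rightarrow>\<^sub>0 ('n, 'k) mpoly)" where
  "homogenize L q z = Poly_Mapping.mapp (\<lambda>\<sigma> c. mconst c * exact_quotient q (L \<sigma>)) z"

definition M_tilde ::
  "nat \<Rightarrow> (nat set \<Rightarrow> ('n, 'k::field) mpoly) \<Rightarrow>
   (('n, 'k) mpoly \<Rightarrow> nat \<Rightarrow> (nat set \<Rightarrow>\<^sub>0 'k) set) \<Rightarrow>
   (('n, 'k) mpoly \<Rightarrow> nat \<Rightarrow> (nat set \<Rightarrow>\<^sub>0 'k) set) \<Rightarrow> nat \<Rightarrow> (nat set \<Rightarrow>\<^sub>0 ('n, 'k) mpoly) set" where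
  "M_tilde m L Hc Bc p =
     module.span smul
       {homogenize L q z |q z. q \<in> lcm_lattice m L \<and> z \<in> M_complex m L Hc Bc p \<and>
                               (\<forall>\<sigma>\<in>Poly_Mapping.keys z. L \<sigma> dvd q)}"

end

(*
  Algebraic Morse theory.  With W = H' + B', the differential of K maps B' isomorphically onto a
  complement of W, because the B-component of d on B' is triangular for divisibility with the
  isomorphisms B' --> B on the diagonal.  Hence there is a map h : K --> B' that vanishes on W,
  inverts d on d(B'), and respects the filtration of K by divisibility.  Then P = 1 - d h - h d is
  a chain projection, and its image {z in W. d z in W} is M.  Since P is filtered it extends to an
  S-linear chain projection of the Taylor complex onto M tilde; exactness passes to such a retract.
  The leading terms of P a, for a in bases of the spaces H'(q), give a homogeneous S-basis.
  Minimality holds because d a lies in strictly lower strands for a in H'(q), so that only the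
  quotients q / r with r properly dividing q occur as coefficients.  That these quotients are not
  units rests on the normalization of the lcms together with unique factorization in k[x_1..x_n],
  proved by Gauss's lemma, adding one variable at a time.
*)
theory Submission
  imports Defs "HOL-Computational_Algebra.Polynomial"
begin

section \<open>Splitting a polynomial along a weight\<close>

text \<open>Three obstacles shape the proof. Strands group sets by equality of their lcms, so two
  associated but distinct lcms would give unit entries in the differential; normalization excludes
  this because irreducibles are prime. That fact is proved inside one fixed polynomial ring, with
  subrings for the smaller sets of variables, since an induction cannot change the type of the
  variables. Second, divisibility is a partial order on the finite set of lcms, not a linear one, so
  triangular arguments remove one maximal lcm at a time from a down-closed set. Third, the
  coefficients q / Q_sigma that carry chains of K into the Taylor complex exist only if Q_sigma
  divides q; this is why the maps on K have to respect the filtration. The operator h satisfies h h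
  = 0 and h d h = h, because its values lie in B', where it vanishes and where h d is the identity.
  Hence P = 1 - d h - h d is idempotent. On H' it sends a to a - h d a, so the correction f is - h
  d. The relation d d = 0 on K is itself pulled back from the Taylor complex.\<close>

lemma sum_keys_superset:
  assumes "finite A" "Poly_Mapping.keys p \<subseteq> A" "\<And>t. g t 0 = 0"
  shows "(\<Sum>t\<in>Poly_Mapping.keys p. g t (Poly_Mapping.lookup p t)) = (\<Sum>t\<in>A. g t (Poly_Mapping.lookup p t))"
  by (rule sum.mono_neutral_left) (use assms in \<open>auto simp: in_keys_iff\<close>)

lemma sum_keys_add:
  assumes "\<And>t a b. g t (a + b) = g t a + g t b" "\<And>t. g t 0 = 0"
  shows "(\<Sum>t\<in>Poly_Mapping.keys (p + q). g t (Poly_Mapping.lookup (p + q) t)) =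
    (\<Sum>t\<in>Poly_Mapping.keys p. g t (Poly_Mapping.lookup p t)) +
    (\<Sum>t\<in>Poly_Mapping.keys q. g t (Poly_Mapping.lookup q t))"
proof -
  let ?A = "Poly_Mapping.keys p \<union> Poly_Mapping.keys q"
  have "Poly_Mapping.keys (p + q) \<subseteq> ?A"
    by (rule keys_add)
  then have "(\<Sum>t\<in>Poly_Mapping.keys (p + q). g t (Poly_Mapping.lookup (p + q) t)) =
      (\<Sum>t\<in>?A. g t (Poly_Mapping.lookup p t)) + (\<Sum>t\<in>?A. g t (Poly_Mapping.lookup q t))"
    by (subst sum_keys_superset[where A = ?A and g = g]) (simp_all add: assms lookup_add sum.distrib)
  then show ?thesis
    using sum_keys_superset[where A = ?A and g = g and p = p]
      sum_keys_superset[where A = ?A and g = g and p = q] by (simp add: assms)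
qed

lemma poly_mapping_sum_single:
  "p = (\<Sum>t\<in>Poly_Mapping.keys p. Poly_Mapping.single t (Poly_Mapping.lookup p t))"
proof (rule poly_mapping_eqI)
  fix s
  show "Poly_Mapping.lookup p s = Poly_Mapping.lookup
      (\<Sum>t\<in>Poly_Mapping.keys p. Poly_Mapping.single t (Poly_Mapping.lookup p t)) s"
    by (simp add: lookup_sum lookup_single when_def in_keys_iff if_distrib sum.delta' cong: if_cong)
qed

lemma poly_mapping_single_induct [case_names zero single add]:
  fixes p :: "'a \<Rightarrow>\<^sub>0 'b::comm_monoid_add"
  assumes "P 0" "\<And>t c. P (Poly_Mapping.single t c)" "\<And>p q. P p \<Longrightarrow> P q \<Longrightarrow> P (p + q)"
  shows "P p"
proof -
  have "P (\<Sum>t\<in>A. Poly_Mapping.single t (Poly_Mapping.lookup p t))" if "finite A" for A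
    using that by induction (auto intro: assms)
  then show ?thesis
    by (metis finite_keys poly_mapping_sum_single)
qed

text \<open>For additive \<open>\<rho>\<close> and \<open>w\<close> this is the ring homomorphism \<open>x\<^sup>t \<mapsto> x\<^bsup>\<rho>(t)\<^esup> y\<^bsup>w(t)\<^esup>\<close>.\<close>

definition split_poly :: "('a \<Rightarrow> 'b) \<Rightarrow> ('a \<Rightarrow> nat) \<Rightarrow> ('a \<Rightarrow>\<^sub>0 'k::comm_monoid_add) \<Rightarrow> ('b \<Rightarrow>\<^sub>0 'k) poly" where
  "split_poly \<rho> w p =
     (\<Sum>t\<in>Poly_Mapping.keys p. monom (Poly_Mapping.single (\<rho> t) (Poly_Mapping.lookup p t)) (w t))"

lemma split_poly_0 [simp]: "split_poly \<rho> w 0 = 0"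
  by (simp add: split_poly_def)

lemma split_poly_single [simp]:
  "split_poly \<rho> w (Poly_Mapping.single t c) = monom (Poly_Mapping.single (\<rho> t) c) (w t)"
  by (simp add: split_poly_def keys_single)

lemma split_poly_add: "split_poly \<rho> w (p + q) = split_poly \<rho> w p + split_poly \<rho> w q"
  unfolding split_poly_def
  by (rule sum_keys_add[where g = "\<lambda>t c. monom (Poly_Mapping.single (\<rho> t) c) (w t)"])
    (simp_all add: single_add add_monom)

lemma split_poly_mult:
  fixes p q :: "'a::monoid_add \<Rightarrow>\<^sub>0 'k::comm_semiring_0"
    and \<rho> :: "'a \<Rightarrow> 'b::comm_monoid_add"
  assumes "\<And>s t. \<rho> (s + t) = \<rho> s + \<rho> t" "\<And>s t. w (s + t) = w s + w t"
  shows "split_poly \<rho> w (p * q) = split_poly \<rho> w p * split_poly \<rho> w q"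
proof (induction p rule: poly_mapping_single_induct)
  case (single s a)
  show ?case
    by (induction q rule: poly_mapping_single_induct)
      (simp_all add: distrib_left split_poly_add mult_single mult_monom assms)
qed (simp_all add: distrib_right split_poly_add)

text \<open>With \<open>\<rho> = id\<close> the new variable y only records the weight: the
  coefficient of y^i is the part of weight i. Facts about weights thus become facts about degrees
  and monomials in one variable over an integral domain.\<close>

lemma lookup_coeff_split_poly:
  "Poly_Mapping.lookup (coeff (split_poly id w p) i) t = (if i = w t then Poly_Mapping.lookup p t else 0)"
  by (induction p rule: poly_mapping_single_induct)
    (auto simp: split_poly_add lookup_add lookup_single when_def)

lemma split_poly_eq_0_iff: "split_poly id w p = 0 \<longleftrightarrow> p = 0"
  by (metis lookup_coeff_split_poly poly_mapping_eqI split_poly_0)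

lemma degree_split_poly_le_iff:
  "degree (split_poly id w p) \<le> d \<longleftrightarrow> (\<forall>t\<in>Poly_Mapping.keys p. w t \<le> d)"
proof
  assume d: "degree (split_poly id w p) \<le> d"
  show "\<forall>t\<in>Poly_Mapping.keys p. w t \<le> d"
  proof
    fix t assume "t \<in> Poly_Mapping.keys p"
    then have "coeff (split_poly id w p) (w t) \<noteq> 0"
      by (metis in_keys_iff lookup_coeff_split_poly lookup_zero)
    then show "w t \<le> d"
      using d le_degree le_trans by blast
  qed
next
  assume "\<forall>t\<in>Poly_Mapping.keys p. w t \<le> d"
  then show "degree (split_poly id w p) \<le> d"
    unfolding split_poly_def
    by (intro degree_sum_le) (auto intro: order.trans[OF degree_monom_le])
qed

lemma split_poly_monom_degree:
  assumes "split_poly id w p = monom c d" "t \<in> Poly_Mapping.keys p"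
  shows "w t = d"
proof -
  have "coeff (split_poly id w p) (w t) \<noteq> 0"
    using assms(2) by (metis in_keys_iff lookup_coeff_split_poly lookup_zero)
  then show ?thesis
    using assms(1) by (auto split: if_splits)
qed

lemma split_poly_eq_monomI:
  assumes "\<forall>t\<in>Poly_Mapping.keys p. w t = d"
  shows "split_poly id w p = monom p d"
  by (rule poly_eqI, rule poly_mapping_eqI)
    (use assms in \<open>auto simp: lookup_coeff_split_poly in_keys_iff\<close>)

text \<open>The multiplicity of the root 0 and the degree are both additive, the first never exceeds
  the second, and they agree on a monomial. So they agree on each factor, which leaves a constant
  times a power of the variable.\<close>

lemma dvd_monom_imp_monom:
  fixes f g :: "'a::idom poly"
  assumes "f * g = monom c d" "c \<noteq> 0"
  shows "f = monom (lead_coeff f) (degree f)"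
proof -
  have nz: "f * g \<noteq> 0" "f \<noteq> 0" "g \<noteq> 0"
    using assms by auto
  have "order 0 (f * g) = d"
    using assms by (simp add: order_0_monom)
  moreover have "degree (f * g) = d"
    using assms by (simp add: degree_monom_eq)
  moreover have "order 0 (f * g) = order 0 f + order 0 g" "degree (f * g) = degree f + degree g"
    using nz by (auto simp: order_mult degree_mult_eq)
  moreover have "order 0 f \<le> degree f" "order 0 g \<le> degree g"
    using nz by (auto simp: order_degree)
  ultimately have "order 0 f = degree f"
    by linarith
  then have "monom 1 (degree f) dvd f"
    using order_1[of 0 f] by (simp add: monom_altdef)
  then obtain h where h: "f = monom 1 (degree f) * h"
    by auto
  then have "degree f = degree f + degree h"
    using nz by (metis degree_monom_eq degree_mult_eq mult_eq_0_iff one_neq_zero)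
  then obtain a where "h = [:a:]"
    using degree_eq_zeroE by auto
  then show ?thesis
    using h by (metis add.right_neutral degree_monom_eq lead_coeff_monom monom_0 monom_eq_0 mult.left_neutral mult_monom)
qed

section \<open>Gauss's lemma for subrings\<close>

text \<open>\<open>A\<close> stands for the polynomials in some of the variables. By
  \<open>factor_closed\<close> every divisor of a nonzero element of \<open>A\<close> is again in
  \<open>A\<close>, so units, irreducibles and divisibility can be taken in the ambient ring. The
  measure \<open>\<mu>\<close> makes factorization terminate.\<close>

locale factorial_subring =
  fixes A :: "'a::idom set" and \<mu> :: "'a \<Rightarrow> nat"
  assumes one_closed: "1 \<in> A"
    and diff_closed: "a \<in> A \<Longrightarrow> b \<in> A \<Longrightarrow> a - b \<in> A"
    and mult_closed: "a \<in> A \<Longrightarrow> b \<in> A \<Longrightarrow> a * b \<in> A"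
    and factor_closed: "a * b \<in> A \<Longrightarrow> a * b \<noteq> 0 \<Longrightarrow> a \<in> A"
    and measure_less: "a * b \<noteq> 0 \<Longrightarrow> \<not> a dvd 1 \<Longrightarrow> \<mu> b < \<mu> (a * b)"
    and irreducible_prime: "p \<in> A \<Longrightarrow> irreducible p \<Longrightarrow> a \<in> A \<Longrightarrow> b \<in> A \<Longrightarrow> p dvd a * b \<Longrightarrow>
      p dvd a \<or> p dvd b"
begin

lemma zero_closed: "0 \<in> A"
  using diff_closed[OF one_closed one_closed] by simp

lemma uminus_closed: "a \<in> A \<Longrightarrow> - a \<in> A"
  using diff_closed[OF zero_closed] by simp

lemma add_closed: "a \<in> A \<Longrightarrow> b \<in> A \<Longrightarrow> a + b \<in> A"
  using diff_closed[OF _ uminus_closed] by simp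

lemma sum_closed: "(\<And>i. i \<in> X \<Longrightarrow> f i \<in> A) \<Longrightarrow> sum f X \<in> A"
  by (induction X rule: infinite_finite_induct) (auto intro: zero_closed add_closed)

lemma cofactor_closed: "a * b \<in> A \<Longrightarrow> a \<noteq> 0 \<Longrightarrow> b \<in> A"
  by (metis factor_closed mult.commute mult_eq_0_iff zero_closed)

lemma irreducible_divisor:
  assumes "c \<in> A" "c \<noteq> 0" "\<not> c dvd 1"
  shows "\<exists>p\<in>A. irreducible p \<and> p dvd c"
  using assms
proof (induction "\<mu> c" arbitrary: c rule: less_induct)
  case less
  show ?case
  proof (cases "irreducible c")
    case False
    then obtain a b where ab: "c = a * b" "\<not> a dvd 1" "\<not> b dvd 1"
      using less.prems by (auto simp: irreducible_def)
    have "\<mu> a < \<mu> c"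
      using measure_less[of b a] ab less.prems by (simp add: mult.commute)
    moreover have "a \<in> A"
      using ab less.prems factor_closed by blast
    ultimately obtain p where "p \<in> A" "irreducible p" "p dvd a"
      using less.hyps ab less.prems by auto
    then show ?thesis
      using ab by auto
  qed (use less.prems in auto)
qed

definition polys :: "'a poly set" where
  "polys = {F. \<forall>i. coeff F i \<in> A}"

lemma coeff_closed: "F \<in> polys \<Longrightarrow> coeff F i \<in> A"
  by (simp add: polys_def)

lemma polys_zero: "0 \<in> polys"
  by (simp add: polys_def zero_closed)

lemma polys_add: "F \<in> polys \<Longrightarrow> G \<in> polys \<Longrightarrow> F + G \<in> polys"
  by (simp add: polys_def add_closed)

lemma polys_diff: "F \<in> polys \<Longrightarrow> G \<in> polys \<Longrightarrow> F - G \<in> polys"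
  by (simp add: polys_def diff_closed)

lemma polys_mult: "F \<in> polys \<Longrightarrow> G \<in> polys \<Longrightarrow> F * G \<in> polys"
  by (auto simp: polys_def coeff_mult intro!: sum_closed mult_closed)

lemma polys_monom: "c \<in> A \<Longrightarrow> monom c n \<in> polys"
  by (auto simp: polys_def zero_closed)

lemma polys_smult: "c \<in> A \<Longrightarrow> F \<in> polys \<Longrightarrow> smult c F \<in> polys"
  by (auto simp: polys_def mult_closed)

lemma polys_const: "c \<in> A \<Longrightarrow> [:c:] \<in> polys"
  using polys_monom[of c 0] by (simp add: monom_0)

lemma polys_smult_cancel: "smult c F \<in> polys \<Longrightarrow> c \<noteq> 0 \<Longrightarrow> F \<in> polys"
  using cofactor_closed by (auto simp: polys_def)

text \<open>Take the first coefficients of \<open>G\<close> and \<open>H\<close> that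
  \<open>p\<close> does not divide, at \<open>i'\<close> and \<open>j'\<close>. In the coefficient
  of the product at \<open>i' + j'\<close> every other summand is divisible by
  \<open>p\<close>.\<close>

lemma const_prime:
  assumes p: "p \<in> A" "irreducible p" and GH: "G \<in> polys" "H \<in> polys" "[:p:] dvd G * H"
  shows "[:p:] dvd G \<or> [:p:] dvd H"
proof (rule ccontr)
  assume "\<not> ?thesis"
  then obtain i j where ij: "\<not> p dvd coeff G i" "\<not> p dvd coeff H j"
    by (auto simp: const_poly_dvd_iff)
  define i' where "i' = (LEAST i. \<not> p dvd coeff G i)"
  define j' where "j' = (LEAST j. \<not> p dvd coeff H j)"
  have i': "\<not> p dvd coeff G i'" "\<And>k. k < i' \<Longrightarrow> p dvd coeff G k"
    unfolding i'_def using ij(1) by (metis (mono_tags, lifting) LeastI, blast dest: not_less_Least)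
  have j': "\<not> p dvd coeff H j'" "\<And>k. k < j' \<Longrightarrow> p dvd coeff H k"
    unfolding j'_def using ij(2) by (metis (mono_tags, lifting) LeastI, blast dest: not_less_Least)
  have "coeff (G * H) (i' + j') = (\<Sum>k\<le>i' + j'. coeff G k * coeff H (i' + j' - k))"
    by (rule coeff_mult)
  also have "\<dots> = coeff G i' * coeff H j' + (\<Sum>k\<in>{..i' + j'} - {i'}. coeff G k * coeff H (i' + j' - k))"
    by (subst sum.remove[of _ i']) auto
  finally have eq: "coeff G i' * coeff H j' =
      coeff (G * H) (i' + j') - (\<Sum>k\<in>{..i' + j'} - {i'}. coeff G k * coeff H (i' + j' - k))"
    by simp
  have "p dvd coeff G k * coeff H (i' + j' - k)" if k: "k \<in> {..i' + j'} - {i'}" for k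
  proof (cases "k < i'")
    case False
    then have "i' + j' - k < j'"
      using k by auto
    then show ?thesis
      using j' by simp
  qed (use i' in simp)
  then have "p dvd (\<Sum>k\<in>{..i' + j'} - {i'}. coeff G k * coeff H (i' + j' - k))"
    by (rule dvd_sum)
  moreover have "p dvd coeff (G * H) (i' + j')"
    using GH by (simp add: const_poly_dvd_iff)
  ultimately have "p dvd coeff G i' * coeff H j'"
    unfolding eq by (rule dvd_diff[rotated])
  then show False
    using irreducible_prime p i' j' GH coeff_closed by blast
qed

lemma const_dvdE:
  assumes "[:p:] dvd G" "p \<noteq> 0" "G \<in> polys"
  obtains G' where "G' \<in> polys" "G = smult p G'"
proof -
  obtain G' where "G = smult p G'"
    using assms by (auto simp: dvd_def)
  then show ?thesis
    using that polys_smult_cancel assms by blast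
qed

lemma unit_inverse:
  assumes "u \<in> A" "u dvd 1"
  obtains v where "v \<in> A" "u * v = 1"
  using assms cofactor_closed one_closed by (metis dvd_def mult_zero_left zero_neq_one)

text \<open>This replaces contents and the fraction field: a factorization of a constant multiple of
  \<open>F\<close> comes from one of \<open>F\<close>. Each irreducible factor of \<open>c\<close>
  divides \<open>G\<close> or \<open>H\<close> by \<open>const_prime\<close> and is cancelled there;
  a remaining unit is absorbed by \<open>G\<close>.\<close>

lemma smult_eq_mult_split:
  assumes "c \<in> A" "c \<noteq> 0" "F \<in> polys" "G \<in> polys" "H \<in> polys" "smult c F = G * H"
  shows "\<exists>c1\<in>A. \<exists>c2\<in>A. \<exists>G'\<in>polys. \<exists>H'\<in>polys.
    c = c1 * c2 \<and> G = smult c1 G' \<and> H = smult c2 H' \<and> F = G' * H'"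
  using assms
proof (induction "\<mu> c" arbitrary: c F G H rule: less_induct)
  case less
  show ?case
  proof (cases "c dvd 1")
    case True
    then obtain v where v: "v \<in> A" "c * v = 1"
      using unit_inverse less.prems by blast
    have "smult v (G * H) = smult (c * v) F"
      using less.prems by (metis mult.commute smult_smult)
    then have "F = smult v G * H"
      using v by simp
    moreover have "G = smult c (smult v G)"
      using v by simp
    ultimately show ?thesis
      using less.prems v one_closed polys_smult[of v G] by (metis mult.right_neutral smult_1_left)
  next
    case False
    then obtain p where p: "p \<in> A" "irreducible p" "p dvd c"
      using irreducible_divisor less.prems by blast
    then obtain c' where c': "c = p * c'"
      by auto
    have nz: "p \<noteq> 0" "c' \<noteq> 0"
      using less.prems c' by auto
    have c'A: "c' \<in> A"
      using cofactor_closed less.prems c' nz by blast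
    have \<mu>: "\<mu> c' < \<mu> c"
      using measure_less[of p c'] c' p less.prems by (auto simp: irreducible_def)
    have eq: "smult p (smult c' F) = G * H"
      using less.prems c' by simp
    then have "G * H = [:p:] * smult c' F"
      by (simp add: mult.commute)
    then have "[:p:] dvd G * H"
      by (rule dvdI)
    then consider "[:p:] dvd G" | "[:p:] dvd H"
      using const_prime p less.prems by blast
    then show ?thesis
    proof cases
      case 1
      then obtain G0 where G0: "G0 \<in> polys" "G = smult p G0"
        using const_dvdE nz less.prems by blast
      have "smult p (smult c' F) = smult p (G0 * H)"
        using eq G0 by simp
      then have "smult c' F = G0 * H"
        using nz by (metis smult_cancel)
      then obtain c1 c2 G' H' where *: "c1 \<in> A" "c2 \<in> A" "G' \<in> polys" "H' \<in> polys"
        "c' = c1 * c2" "G0 = smult c1 G'" "H = smult c2 H'" "F = G' * H'"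
        using less.hyps[OF \<mu> c'A nz(2) less.prems(3) G0(1) less.prems(5)] by blast
      have "p * c1 \<in> A" "c = (p * c1) * c2" "G = smult (p * c1) G'"
        using * p c' G0 mult_closed by (auto simp: mult_ac)
      then show ?thesis
        using * by blast
    next
      case 2
      then obtain H0 where H0: "H0 \<in> polys" "H = smult p H0"
        using const_dvdE nz less.prems by blast
      have "smult p (smult c' F) = smult p (G * H0)"
        using eq H0 by simp
      then have "smult c' F = G * H0"
        using nz by (metis smult_cancel)
      then obtain c1 c2 G' H' where *: "c1 \<in> A" "c2 \<in> A" "G' \<in> polys" "H' \<in> polys"
        "c' = c1 * c2" "G = smult c1 G'" "H0 = smult c2 H'" "F = G' * H'"
        using less.hyps[OF \<mu> c'A nz(2) less.prems(3) less.prems(4) H0(1)] by blast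
      have "p * c2 \<in> A" "c = c1 * (p * c2)" "H = smult (p * c2) H'"
        using * p c' H0 mult_closed by (auto simp: mult_ac)
      then show ?thesis
        using * by blast
    qed
  qed
qed

text \<open>Division over the fraction field, with the denominators cleared into \<open>c\<close>,
  as the leading coefficient of \<open>h\<close> need not be a unit.\<close>

lemma pseudo_division:
  assumes "F \<in> polys" "h \<in> polys" "h \<noteq> 0"
  shows "\<exists>c\<in>A. \<exists>q\<in>polys. \<exists>r\<in>polys. c \<noteq> 0 \<and> smult c F = q * h + r \<and> (r = 0 \<or> degree r < degree h)"
  using assms(1)
proof (induction "degree F" arbitrary: F rule: less_induct)
  case less
  show ?case
  proof (cases "F = 0 \<or> degree F < degree h")
    case True
    then show ?thesis
      using less.prems one_closed polys_zero
      by (intro bexI[of _ 1] bexI[of _ 0] bexI[of _ F]) auto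
  next
    case False
    \<comment> \<open>Multiplied by \<open>lead_coeff h\<close>, \<open>F\<close> has the same
      leading term as \<open>s * h\<close>, so \<open>F'\<close> is zero or of smaller
      degree.\<close>
    define s where "s = monom (lead_coeff F) (degree F - degree h)"
    define F' where "F' = smult (lead_coeff h) F - s * h"
    have s: "s \<in> polys"
      unfolding s_def using less.prems by (intro polys_monom coeff_closed)
    have F': "F' \<in> polys"
      unfolding F'_def using less.prems assms s
      by (intro polys_diff polys_smult polys_mult coeff_closed)
    have lh: "lead_coeff h \<in> A" "lead_coeff h \<noteq> 0"
      using assms coeff_closed by auto
    have "\<exists>c\<in>A. \<exists>q\<in>polys. \<exists>r\<in>polys. c \<noteq> 0 \<and> smult c F' = q * h + r \<and> (r = 0 \<or> degree r < degree h)"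
    proof (cases "F' = 0")
      case True
      then show ?thesis
        using one_closed polys_zero by (intro bexI[of _ 1] bexI[of _ 0]) auto
    next
      case F'0: False
      have F0: "F \<noteq> 0" "degree h \<le> degree F"
        using False by auto
      have "degree (s * h) = degree F"
        using F0 assms unfolding s_def by (subst degree_mult_eq) (auto simp: degree_monom_eq)
      moreover have "coeff (s * h) (degree F) = lead_coeff F * lead_coeff h"
        using calculation by (metis lead_coeff_mult lead_coeff_monom s_def)
      ultimately have "degree F' \<le> degree F" "coeff F' (degree F) = 0"
        unfolding F'_def by (auto intro!: degree_diff_le simp: lh)
      then have "degree F' < degree F \<or> F' = 0"
        by (metis le_neq_implies_less leading_coeff_0_iff)
      then show ?thesis
        using less.hyps F' F'0 by blast
    qed
    then obtain c q r where *: "c \<in> A" "q \<in> polys" "r \<in> polys" "c \<noteq> 0" "smult c F' = q * h + r"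
      "r = 0 \<or> degree r < degree h" by blast
    have "smult (c * lead_coeff h) F = (smult c s + q) * h + r"
      using *(5) unfolding F'_def by (simp add: smult_diff_right algebra_simps)
    then show ?thesis
      using * lh s polys_add polys_smult mult_closed
      by (intro bexI[of _ "c * lead_coeff h"] bexI[of _ "smult c s + q"] bexI[of _ r]) auto
  qed
qed

text \<open>
  Gauss's lemma.  An \<open>h\<close> of least degree in the ideal \<open>(F, G)\<close> divides constant multiples
  of \<open>F\<close> and \<open>G\<close>; as \<open>F\<close> is irreducible, either \<open>h\<close> is a constant multiple of \<open>F\<close> and then \<open>F\<close>
  divides \<open>G\<close>, or \<open>h\<close> is a constant and then \<open>F\<close> divides a constant multiple of \<open>H\<close>.
\<close>

lemma gauss_prime:
  assumes F: "F \<in> polys" "degree F > 0"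
    and irr: "\<And>G H. G \<in> polys \<Longrightarrow> H \<in> polys \<Longrightarrow> F = G * H \<Longrightarrow> G dvd 1 \<or> H dvd 1"
    and GH: "G \<in> polys" "H \<in> polys" "T \<in> polys" "F * T = G * H"
  shows "(\<exists>U\<in>polys. G = F * U) \<or> (\<exists>U\<in>polys. H = F * U)"
proof (rule ccontr)
  assume contra: "\<not> ?thesis"
  \<comment> \<open>Constants can be cancelled: \<open>smult_eq_mult_split\<close> distributes
    \<open>e\<close> over \<open>F\<close> and \<open>V\<close>, and the share \<open>e1\<close> of
    \<open>F\<close> is a unit because \<open>F\<close> is irreducible of positive degree.\<close>
  have cancel_const: "\<exists>U\<in>polys. X = F * U"
    if X: "X \<in> polys" "V \<in> polys" "e \<in> A" "e \<noteq> 0" "smult e X = F * V" for X V e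
  proof -
    obtain e1 e2 F' V' where *: "e1 \<in> A" "e2 \<in> A" "F' \<in> polys" "V' \<in> polys"
      "F = smult e1 F'" "X = F' * V'"
      using smult_eq_mult_split[OF X(3,4,1) F(1) X(2,5)] by blast
    have "F = [:e1:] * F'"
      using * by simp
    then have "[:e1:] dvd 1 \<or> F' dvd 1"
      using irr * polys_const by blast
    moreover have "\<not> F' dvd 1"
    proof
      assume "F' dvd 1"
      then have "degree F' = 0"
        by (auto simp: is_unit_poly_iff)
      then show False
        using F * by (metis degree_smult_le less_le_not_le not_gr_zero)
    qed
    ultimately have "e1 dvd 1"
      using is_unit_const_poly_iff by blast
    then obtain v where v: "v \<in> A" "e1 * v = 1"
      using unit_inverse * by blast
    then have "smult v F = F'"
      using * by (simp add: mult.commute)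
    then have "X = smult v F * V'"
      using * by blast
    then have "X = F * smult v V'"
      by simp
    then show ?thesis
      using v * polys_smult by blast
  qed
  define J where "J = {a * F + b * G | a b. a \<in> polys \<and> b \<in> polys}"
  have JI: "a * F + b * G \<in> J" if "a \<in> polys" "b \<in> polys" for a b
    using that unfolding J_def by blast
  have Jpolys: "J \<subseteq> polys"
    unfolding J_def using F GH polys_add polys_mult by blast
  have one: "1 \<in> polys"
    using polys_const[OF one_closed] by (simp add: one_pCons)
  have FJ: "F \<in> J" "G \<in> J"
    using JI[OF one polys_zero] JI[OF polys_zero one] by auto
  have J_step: "smult c X - q * h \<in> J" if "c \<in> A" "X \<in> J" "q \<in> polys" "h \<in> J" for c X q h
  proof -
    from that obtain a b a' b' where ab: "a \<in> polys" "b \<in> polys" "a' \<in> polys" "b' \<in> polys"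
      "X = a * F + b * G" "h = a' * F + b' * G"
      unfolding J_def by blast
    have "smult c X - q * h = (smult c a - q * a') * F + (smult c b - q * b') * G"
      using ab by (simp add: algebra_simps smult_add_right)
    then show ?thesis
      using ab that by (metis JI polys_diff polys_mult polys_smult)
  qed
  obtain h where h: "h \<in> J" "h \<noteq> 0" and min: "\<And>r. r \<in> J \<Longrightarrow> r \<noteq> 0 \<Longrightarrow> degree h \<le> degree r"
  proof -
    have "F \<in> J \<and> F \<noteq> 0"
      using FJ F by auto
    from ex_has_least_nat[of "\<lambda>h. h \<in> J \<and> h \<noteq> 0", OF this, of degree] that show thesis
      by blast
  qed
  have hp: "h \<in> polys"
    using h Jpolys by blast
  have divides: "\<exists>c\<in>A. \<exists>q\<in>polys. c \<noteq> 0 \<and> smult c X = q * h" if X: "X \<in> J" for X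
  proof -
    obtain c q r where *: "c \<in> A" "q \<in> polys" "r \<in> polys" "c \<noteq> 0" "smult c X = q * h + r"
      "r = 0 \<or> degree r < degree h"
      using pseudo_division[OF _ hp h(2), of X] X Jpolys by blast
    have "smult c X - q * h = r"
      using *(5) by simp
    then have "r \<in> J"
      using J_step[OF *(1) X *(2) h(1)] by (simp only:)
    then have "r = 0"
      using min * by (metis not_le)
    then show ?thesis
      using * by auto
  qed
  obtain c q where c: "c \<in> A" "q \<in> polys" "c \<noteq> 0" "smult c F = q * h"
    using divides FJ by blast
  obtain c1 c2 q' h' where split: "c1 \<in> A" "c2 \<in> A" "q' \<in> polys" "h' \<in> polys" "c = c1 * c2"
    "q = smult c1 q'" "h = smult c2 h'" "F = q' * h'"
    using smult_eq_mult_split[OF c(1,3) F(1) c(2) hp c(4)] by blast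
  have "q' dvd 1 \<or> h' dvd 1"
    using irr split by blast
  then show False
  proof
    assume "h' dvd 1"
    then obtain u where u: "h' = [:u:]"
      by (auto simp: is_unit_poly_iff)
    define e where "e = c2 * u"
    have e: "h = [:e:]"
      using split u by (simp add: e_def)
    then have eA: "e \<in> A" "e \<noteq> 0"
      using h coeff_closed[OF hp, of 0] by auto
    obtain a b where ab: "a \<in> polys" "b \<in> polys" "h = a * F + b * G"
      using h unfolding J_def by blast
    \<comment> \<open>Multiplying \<open>h = a * F + b * G\<close> by \<open>H\<close> and replacing
      \<open>G * H\<close> by \<open>F * T\<close> exhibits \<open>F\<close> as a factor of a
      constant multiple of \<open>H\<close>.\<close>
    have "smult e H = h * H"
      using e by simp
    also have "\<dots> = a * F * H + b * (G * H)"
      using ab by (simp add: algebra_simps)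
    also have "\<dots> = F * (a * H + b * T)"
      unfolding GH(4)[symmetric] by (simp add: algebra_simps)
    finally have "\<exists>U\<in>polys. H = F * U"
      using cancel_const[of H "a * H + b * T" e] ab GH eA polys_add polys_mult by blast
    then show False
      using contra by blast
  next
    assume "q' dvd 1"
    then obtain u where u: "q' = [:u:]" "u dvd 1"
      by (auto simp: is_unit_poly_iff)
    then have "u \<in> A"
      using coeff_closed[OF split(3), of 0] by simp
    then obtain v where v: "v \<in> A" "u * v = 1"
      using unit_inverse u by blast
    have "smult v F = smult (u * v) h'"
      using split u by (simp add: mult.commute)
    then have h': "h' = smult v F"
      using v by simp
    obtain c' q2 where c': "c' \<in> A" "q2 \<in> polys" "c' \<noteq> 0" "smult c' G = q2 * h"
      using divides FJ by blast
    have "smult c' G = q2 * smult c2 (smult v F)"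
      using c'(4) split(7) h' by (simp only:)
    then have "smult c' G = F * smult (c2 * v) q2"
      by (simp add: mult.commute)
    moreover have "smult (c2 * v) q2 \<in> polys"
      using c' split v by (intro polys_smult mult_closed)
    ultimately have "\<exists>U\<in>polys. G = F * U"
      using cancel_const[OF GH(1) _ c'(1,3)] by blast
    then show False
      using contra by blast
  qed
qed

end

section \<open>Irreducible polynomials are prime\<close>

lemma is_unit_mpoly_const: "c \<noteq> 0 \<Longrightarrow> mconst (c :: 'k::field) dvd (1 :: ('n, 'k) mpoly)"
  by (rule dvdI[of _ _ "mconst (inverse c)"]) (simp add: mconst_def mult_single)

lemma monom_degree_add: "monom_degree (s + t) = monom_degree s + monom_degree t"
  unfolding monom_degree_def by (rule sum_keys_add) simp_all

lemma monom_degree_eq_0_iff: "monom_degree t = 0 \<longleftrightarrow> t = 0"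
  by (auto simp: monom_degree_def in_keys_iff poly_mapping_eq_iff fun_eq_iff)

definition mpoly_degree :: "('n, 'k::field) mpoly \<Rightarrow> nat" where
  "mpoly_degree p = degree (split_poly id monom_degree p)"

lemma mpoly_degree_mult:
  fixes p q :: "('n::{finite,linorder}, 'k::field) mpoly"
  assumes "p * q \<noteq> 0"
  shows "mpoly_degree (p * q) = mpoly_degree p + mpoly_degree q"
  using assms unfolding mpoly_degree_def
  by (subst split_poly_mult) (auto simp: monom_degree_add split_poly_eq_0_iff intro!: degree_mult_eq)

lemma mpoly_degree_0_iff:
  fixes p :: "('n::{finite,linorder}, 'k::field) mpoly"
  assumes "p \<noteq> 0"
  shows "mpoly_degree p = 0 \<longleftrightarrow> p dvd 1"
proof
  assume "mpoly_degree p = 0"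
  then have "\<forall>t\<in>Poly_Mapping.keys p. t = 0"
    using degree_split_poly_le_iff[of monom_degree p 0]
    by (simp add: mpoly_degree_def monom_degree_eq_0_iff)
  then have "p = mconst (Poly_Mapping.lookup p 0)"
    unfolding mconst_def by (intro poly_mapping_eqI) (auto simp: lookup_single when_def in_keys_iff)
  then show "p dvd 1"
    using assms is_unit_mpoly_const by (metis mconst_def single_zero)
next
  assume "p dvd 1"
  then obtain q where q: "1 = p * q"
    by auto
  have "mpoly_degree (1 :: ('n, 'k) mpoly) = 0"
    using degree_split_poly_le_iff[of monom_degree "1 :: ('n, 'k) mpoly" 0]
    by (simp add: mpoly_degree_def monom_degree_eq_0_iff)
  then show "mpoly_degree p = 0"
    using mpoly_degree_mult[of p q] q by simp
qed

section \<open>Polynomials in a subset of the variables\<close>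

definition polys_in :: "'n set \<Rightarrow> ('n, 'k::field) mpoly set" where
  "polys_in X = {p. \<forall>t\<in>Poly_Mapping.keys p. Poly_Mapping.keys t \<subseteq> X}"

lemma polys_in_zero: "0 \<in> polys_in X"
  by (simp add: polys_in_def)

lemma polys_in_one: "1 \<in> polys_in X"
  by (simp add: polys_in_def)

lemma polys_in_add: "p \<in> polys_in X \<Longrightarrow> q \<in> polys_in X \<Longrightarrow> p + q \<in> polys_in X"
  using keys_add[of p q] unfolding polys_in_def by blast

lemma polys_in_sum: "(\<And>i. i \<in> T \<Longrightarrow> f i \<in> polys_in X) \<Longrightarrow> sum f T \<in> polys_in X"
  by (induction T rule: infinite_finite_induct) (simp_all add: polys_in_zero polys_in_add)

lemma polys_in_uminus: "p \<in> polys_in X \<Longrightarrow> - p \<in> polys_in X"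
  unfolding polys_in_def by (simp add: in_keys_iff)

lemma polys_in_diff: "p \<in> polys_in X \<Longrightarrow> q \<in> polys_in X \<Longrightarrow> p - q \<in> polys_in X"
  using polys_in_add[OF _ polys_in_uminus, of p X q] by simp

lemma polys_in_mult: "p \<in> polys_in X \<Longrightarrow> q \<in> polys_in X \<Longrightarrow> p * q \<in> polys_in X"
proof -
  assume p: "p \<in> polys_in X" and q: "q \<in> polys_in X"
  show "p * q \<in> polys_in X"
    unfolding polys_in_def
  proof (intro CollectI ballI)
    fix t assume "t \<in> Poly_Mapping.keys (p * q)"
    then obtain a b where "t = a + b" "a \<in> Poly_Mapping.keys p" "b \<in> Poly_Mapping.keys q"
      using keys_mult[of p q] by blast
    then show "Poly_Mapping.keys t \<subseteq> X"
      using keys_add[of a b] p q unfolding polys_in_def by blast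
  qed
qed

text \<open>Weight a monomial by its total degree in the variables outside \<open>X\<close>. The
  polynomials in \<open>X\<close> are those of weighted degree 0, and this degree is additive on
  nonzero products.\<close>

lemma polys_in_factor:
  fixes p q :: "('n::{finite,linorder}, 'k::field) mpoly"
  assumes "p * q \<in> polys_in X" "p * q \<noteq> 0"
  shows "p \<in> polys_in X"
proof -
  define w where "w t = (\<Sum>x\<in>- X. Poly_Mapping.lookup t x)" for t :: "'n \<Rightarrow>\<^sub>0 nat"
  have w0: "w t = 0 \<longleftrightarrow> Poly_Mapping.keys t \<subseteq> X" for t
    by (auto simp: w_def in_keys_iff)
  have iff: "r \<in> polys_in X \<longleftrightarrow> degree (split_poly id w r) = 0" for r :: "('n, 'k) mpoly"
    using degree_split_poly_le_iff[of w r 0] by (simp add: polys_in_def w0)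
  have "split_poly id w (p * q) = split_poly id w p * split_poly id w q"
    by (rule split_poly_mult) (simp_all add: w_def lookup_add sum.distrib)
  then have "degree (split_poly id w (p * q)) = degree (split_poly id w p) + degree (split_poly id w q)"
    using assms by (auto simp: split_poly_eq_0_iff degree_mult_eq)
  then show ?thesis
    using assms iff by auto
qed

section \<open>One variable as the indeterminate of a univariate polynomial\<close>

definition remove_var :: "'n \<Rightarrow> ('n \<Rightarrow>\<^sub>0 nat) \<Rightarrow> ('n \<Rightarrow>\<^sub>0 nat)" where
  "remove_var x t = Poly_Mapping.mapp (\<lambda>y c. if y = x then 0 else c) t"

lemma lookup_remove_var:
  "Poly_Mapping.lookup (remove_var x t) y = (if y = x then 0 else Poly_Mapping.lookup t y)"
  by (simp add: remove_var_def lookup_mapp when_def in_keys_iff)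

lemma remove_var_add: "remove_var x (s + t) = remove_var x s + remove_var x t"
  by (rule poly_mapping_eqI) (simp add: lookup_remove_var lookup_add)

lemma remove_var_id: "x \<notin> Poly_Mapping.keys t \<Longrightarrow> remove_var x t = t"
  by (rule poly_mapping_eqI) (simp add: lookup_remove_var in_keys_iff)

lemma remove_var_plus: "remove_var x t + Poly_Mapping.single x (Poly_Mapping.lookup t x) = t"
  by (rule poly_mapping_eqI) (simp add: lookup_remove_var lookup_add lookup_single when_def)

lemma keys_remove_var: "Poly_Mapping.keys (remove_var x t) = Poly_Mapping.keys t - {x}"
  by (auto simp: in_keys_iff lookup_remove_var split: if_splits)

definition as_poly_in :: "'n \<Rightarrow> ('n, 'k::field) mpoly \<Rightarrow> ('n, 'k) mpoly poly" where
  "as_poly_in x = split_poly (remove_var x) (\<lambda>t. Poly_Mapping.lookup t x)"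

lemma as_poly_in_add: "as_poly_in x (p + q) = as_poly_in x p + as_poly_in x q"
  by (simp add: as_poly_in_def split_poly_add)

lemma as_poly_in_mult: "as_poly_in x (p * q) = as_poly_in x p * as_poly_in x q"
  unfolding as_poly_in_def by (rule split_poly_mult) (simp_all add: remove_var_add lookup_add)

lemma mvar_power: "mvar x ^ k = Poly_Mapping.single (Poly_Mapping.single x k) (1 :: 'k::field)"
  by (induction k) (simp_all add: mvar_def mult_single single_add[symmetric] flip: single_one)

lemma poly_as_poly_in: "poly (as_poly_in x p) (mvar x) = p"
proof (induction p rule: poly_mapping_single_induct)
  case (single t c)
  show ?case
    by (simp add: as_poly_in_def poly_monom mvar_power mult_single remove_var_plus)
qed (simp_all add: as_poly_in_add, simp add: as_poly_in_def)

lemma as_poly_in_const: "p \<in> polys_in X \<Longrightarrow> x \<notin> X \<Longrightarrow> as_poly_in x p = [:p:]"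
proof -
  assume p: "p \<in> polys_in X" "x \<notin> X"
  have "as_poly_in x p = (\<Sum>t\<in>Poly_Mapping.keys p. [:Poly_Mapping.single t (Poly_Mapping.lookup p t):])"
    unfolding as_poly_in_def split_poly_def
  proof (rule sum.cong)
    fix t assume "t \<in> Poly_Mapping.keys p"
    then have "x \<notin> Poly_Mapping.keys t"
      using p by (auto simp: polys_in_def)
    then show "monom (Poly_Mapping.single (remove_var x t) (Poly_Mapping.lookup p t)) (Poly_Mapping.lookup t x) =
        [:Poly_Mapping.single t (Poly_Mapping.lookup p t):]"
      by (simp add: remove_var_id in_keys_iff monom_0)
  qed simp
  also have "\<dots> = [:\<Sum>t\<in>Poly_Mapping.keys p. Poly_Mapping.single t (Poly_Mapping.lookup p t):]"
    by (induction rule: infinite_finite_induct) simp_all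
  finally show ?thesis
    using poly_mapping_sum_single by metis
qed

lemma coeff_as_poly_in: "p \<in> polys_in (insert x X) \<Longrightarrow> coeff (as_poly_in x p) i \<in> polys_in X"
proof -
  assume p: "p \<in> polys_in (insert x X)"
  have "coeff (as_poly_in x p) i = (\<Sum>t\<in>Poly_Mapping.keys p. coeff (monom (Poly_Mapping.single (remove_var x t)
      (Poly_Mapping.lookup p t)) (Poly_Mapping.lookup t x)) i)"
    by (simp add: as_poly_in_def split_poly_def coeff_sum)
  also have "\<dots> \<in> polys_in X"
  proof -
    have "coeff (monom (Poly_Mapping.single (remove_var x t) (Poly_Mapping.lookup p t)) (Poly_Mapping.lookup t x)) i
        \<in> polys_in X" if t: "t \<in> Poly_Mapping.keys p" for t
      using p t by (auto simp: polys_in_zero keys_remove_var polys_in_def)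
    then show ?thesis
      by (rule polys_in_sum)
  qed
  finally show ?thesis .
qed

lemma as_poly_in_mvar: "as_poly_in x (mvar x) = [:0, 1:]"
proof -
  have "remove_var x (Poly_Mapping.single x k) = 0" for k
    by (rule poly_mapping_eqI) (simp add: lookup_remove_var lookup_single)
  then show ?thesis
    by (simp add: as_poly_in_def mvar_def monom_altdef)
qed

text \<open>The coefficients have to be free of x, since evaluation at \<open>mvar x\<close> would
  otherwise merge them with powers of the indeterminate. Together with
  \<open>poly_as_poly_in\<close> and \<open>coeff_as_poly_in\<close> this identifies polynomials in
  \<open>insert x X\<close> with univariate polynomials over \<open>polys_in X\<close>.\<close>

lemma as_poly_in_poly:
  assumes "\<And>i. coeff F i \<in> polys_in X" "x \<notin> X"
  shows "as_poly_in x (poly F (mvar x)) = F"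
  using assms(1)
proof (induction F)
  case (pCons a F)
  have "coeff F i \<in> polys_in X" for i
    using pCons.prems[of "Suc i"] by simp
  moreover have "as_poly_in x a = [:a:]"
    using pCons.prems[of 0] assms(2) by (auto intro!: as_poly_in_const)
  ultimately show ?case
    using pCons.IH by (simp add: as_poly_in_add as_poly_in_mult as_poly_in_mvar)
qed (simp add: as_poly_in_def)

text \<open>The conclusion for \<open>X\<close> is exactly the assumption
  \<open>irreducible_prime\<close> that turns \<open>polys_in X\<close> into a coefficient ring to
  which Gauss's lemma applies for one more variable.\<close>

lemma irreducible_prime_polys_in:
  fixes p f g :: "('n::{finite,linorder}, 'k::field) mpoly"
  assumes "finite X" "p \<in> polys_in X" "irreducible p" "f \<in> polys_in X" "g \<in> polys_in X" "p dvd f * g"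
  shows "p dvd f \<or> p dvd g"
  using assms
proof (induction X arbitrary: p f g)
  case empty
  have "Poly_Mapping.keys p \<subseteq> {0}"
    using empty(1) by (auto simp: polys_in_def)
  then have "mpoly_degree p = 0"
    using degree_split_poly_le_iff[of monom_degree p 0] by (auto simp: mpoly_degree_def monom_degree_def)
  then show ?case
    using empty(2) mpoly_degree_0_iff by (auto simp: irreducible_def)
next
  case (insert x X)
  interpret factorial_subring "polys_in X :: ('n, 'k) mpoly set" mpoly_degree
  proof
    fix a b :: "('n, 'k) mpoly"
    assume "a * b \<noteq> 0" "\<not> a dvd 1"
    then show "mpoly_degree b < mpoly_degree (a * b)"
      using mpoly_degree_mult[of a b] mpoly_degree_0_iff[of a] by auto
  next
    fix p a b :: "('n, 'k) mpoly"
    assume "p \<in> polys_in X" "irreducible p" "a \<in> polys_in X" "b \<in> polys_in X" "p dvd a * b"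
    then show "p dvd a \<or> p dvd b"
      by (rule insert.IH)
  qed (auto intro: polys_in_one polys_in_diff polys_in_mult polys_in_factor)
  let ?\<Psi> = "as_poly_in x"
  have in_polys: "?\<Psi> h \<in> polys" if "h \<in> polys_in (insert x X)" for h
    using that by (simp add: polys_def coeff_as_poly_in)
  have recover: "?\<Psi> (poly F (mvar x)) = F" if "F \<in> polys" for F
    using that insert.hyps by (intro as_poly_in_poly) (auto simp: polys_def)
  have as_poly_one: "?\<Psi> 1 = 1"
    using as_poly_in_const[OF polys_in_one[of "{}"], of x] by (simp add: one_pCons)
  show ?case
  proof (cases "degree (?\<Psi> p) = 0")
    \<comment> \<open>Here x does not occur in \<open>p\<close>, so \<open>p\<close> is an
      irreducible constant over \<open>polys_in X\<close>.\<close>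
    case True
    then obtain c where c: "?\<Psi> p = [:c:]"
      by (meson degree_eq_zeroE)
    then have "c = p"
      using poly_as_poly_in[of x p] by simp
    then have cp: "?\<Psi> p = [:p:]" and pX: "p \<in> polys_in X"
      using c coeff_as_poly_in[OF insert.prems(1), of 0] by auto
    have "[:p:] dvd ?\<Psi> f * ?\<Psi> g"
      using insert.prems cp by (metis as_poly_in_mult dvd_def)
    then have "[:p:] dvd ?\<Psi> f \<or> [:p:] dvd ?\<Psi> g"
      using const_prime pX insert.prems in_polys by blast
    then show ?thesis
      by (metis cp dvd_def poly_as_poly_in poly_mult)
  next
    \<comment> \<open>Here x occurs in \<open>p\<close>, so \<open>gauss_prime\<close> applies;
      irreducibility of \<open>p\<close> passes to its image because evaluation at
      \<open>mvar x\<close> and \<open>as_poly_in x\<close> undo each other.\<close>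
    case False
    show ?thesis
    proof (cases "f * g = 0")
      case nz: False
      obtain t where t: "f * g = p * t"
        using insert.prems by auto
      then have tX: "t \<in> polys_in (insert x X)"
        using nz insert.prems polys_in_mult polys_in_factor by (metis mult.commute)
      have "(\<exists>U\<in>polys. ?\<Psi> f = ?\<Psi> p * U) \<or> (\<exists>U\<in>polys. ?\<Psi> g = ?\<Psi> p * U)"
      proof (rule gauss_prime)
        fix G H assume GH: "G \<in> polys" "H \<in> polys" "?\<Psi> p = G * H"
        have "p = poly G (mvar x) * poly H (mvar x)"
          using GH by (metis poly_as_poly_in poly_mult)
        then have "poly G (mvar x) dvd 1 \<or> poly H (mvar x) dvd 1"
          using insert.prems by (auto simp: irreducible_def)
        moreover have "F dvd 1" if "F \<in> polys" "poly F (mvar x) dvd 1" for F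
          using that recover as_poly_one as_poly_in_mult by (metis dvd_def)
        ultimately show "G dvd 1 \<or> H dvd 1"
          using GH by blast
      next
        show "?\<Psi> p * ?\<Psi> t = ?\<Psi> f * ?\<Psi> g"
          by (metis as_poly_in_mult t)
      qed (use False in_polys insert.prems tX in auto)
      then show ?thesis
        by (metis dvd_def poly_as_poly_in poly_mult)
    qed auto
  qed
qed

theorem mpoly_irreducible_imp_prime_elem:
  fixes p :: "('n::{finite,linorder}, 'k::field) mpoly"
  assumes "irreducible p"
  shows "prime_elem p"
proof (rule prime_elemI)
  fix f g assume "p dvd f * g"
  then show "p dvd f \<or> p dvd g"
    using irreducible_prime_polys_in[of UNIV p f g] assms by (auto simp: polys_in_def)
qed (use assms in \<open>auto simp: irreducible_def\<close>)

section \<open>Homogeneous factors and normalized least common multiples\<close>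

interpretation ring_mod: module "(*) :: 'a::comm_ring_1 \<Rightarrow> 'a \<Rightarrow> 'a"
  by (rule module_times)

lemma homogeneous_of_degree_mult:
  fixes p q :: "('n::{finite,linorder}, 'k::field) mpoly"
  assumes "homogeneous_of_degree d p" "homogeneous_of_degree e q"
  shows "homogeneous_of_degree (d + e) (p * q)"
  unfolding homogeneous_of_degree_def
proof
  fix t assume "t \<in> Poly_Mapping.keys (p * q)"
  then obtain a b where "t = a + b" "a \<in> Poly_Mapping.keys p" "b \<in> Poly_Mapping.keys q"
    using keys_mult[of p q] by blast
  then show "monom_degree t = d + e"
    using assms by (simp add: homogeneous_of_degree_def monom_degree_add)
qed

text \<open>Under \<open>split_poly id monom_degree\<close> a homogeneous polynomial becomes a
  monomial in the new variable, and \<open>dvd_monom_imp_monom\<close> applies to its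
  factors.\<close>

lemma homogeneous_factor:
  fixes p q :: "('n::{finite,linorder}, 'k::field) mpoly"
  assumes "homogeneous (p * q)" "p * q \<noteq> 0"
  shows "homogeneous p"
proof -
  let ?S = "split_poly id monom_degree :: ('n, 'k) mpoly \<Rightarrow> _"
  obtain e where "\<forall>t\<in>Poly_Mapping.keys (p * q). monom_degree t = e"
    using assms by (auto simp: homogeneous_def homogeneous_of_degree_def)
  then have "?S p * ?S q = monom (p * q) e"
    by (simp add: split_poly_eq_monomI split_poly_mult monom_degree_add flip: split_poly_mult)
  then have "?S p = monom (lead_coeff (?S p)) (degree (?S p))"
    using assms by (intro dvd_monom_imp_monom)
  then show ?thesis
    unfolding homogeneous_def homogeneous_of_degree_def using split_poly_monom_degree by metis
qed

lemma homogeneous_dvd: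
  fixes p q :: "('n::{finite,linorder}, 'k::field) mpoly"
  assumes "p dvd q" "q \<noteq> 0" "homogeneous q"
  shows "homogeneous p"
  using assms homogeneous_factor by (metis dvd_def)

lemma homogeneous_prod:
  fixes Q :: "'i \<Rightarrow> ('n::{finite,linorder}, 'k::field) mpoly"
  assumes "finite \<sigma>" "\<And>i. i \<in> \<sigma> \<Longrightarrow> homogeneous (Q i)"
  shows "homogeneous (\<Prod>i\<in>\<sigma>. Q i)"
  using assms
proof induction
  case empty
  have "homogeneous_of_degree 0 (1 :: ('n, 'k) mpoly)"
    by (simp add: homogeneous_of_degree_def monom_degree_def)
  then show ?case
    by (auto simp: homogeneous_def)
next
  case (insert i \<sigma>)
  then show ?case
    using homogeneous_of_degree_mult by (fastforce simp: homogeneous_def)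
qed

lemma irrelevant_idealI:
  fixes p :: "('n::{finite,linorder}, 'k::field) mpoly"
  assumes "Poly_Mapping.lookup p 0 = 0"
  shows "p \<in> irrelevant_ideal"
proof -
  have "Poly_Mapping.single t (Poly_Mapping.lookup p t) \<in> irrelevant_ideal"
    if t: "t \<in> Poly_Mapping.keys p" for t
  proof -
    have "t \<noteq> 0"
      using t assms by (auto simp: in_keys_iff)
    then obtain x where x: "Poly_Mapping.lookup t x \<noteq> 0"
      by (metis lookup_zero poly_mapping_eqI)
    have "t = (t - Poly_Mapping.single x 1) + Poly_Mapping.single x 1"
      using x by (intro poly_mapping_eqI) (auto simp: lookup_add lookup_minus lookup_single when_def)
    then have "Poly_Mapping.single t (Poly_Mapping.lookup p t) =
        Poly_Mapping.single (t - Poly_Mapping.single x 1) (Poly_Mapping.lookup p t) * mvar x"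
      by (simp add: mvar_def mult_single)
    then show ?thesis
      unfolding irrelevant_ideal_def ideal_generated_def
      by (metis rangeI ring_mod.span_base ring_mod.span_scale)
  qed
  then have "(\<Sum>t\<in>Poly_Mapping.keys p. Poly_Mapping.single t (Poly_Mapping.lookup p t)) \<in> irrelevant_ideal"
    unfolding irrelevant_ideal_def ideal_generated_def by (intro ring_mod.span_sum)
  then show ?thesis
    using poly_mapping_sum_single by metis
qed

text \<open>A homogeneous polynomial with a constant term has degree 0 and is a unit. Homogeneity is
  essential here: 1 + x is neither a unit nor in the irrelevant ideal.\<close>

lemma homogeneous_nonunit_irrelevant:
  fixes p :: "('n::{finite,linorder}, 'k::field) mpoly"
  assumes "homogeneous p" "p \<noteq> 0" "\<not> p dvd 1"
  shows "p \<in> irrelevant_ideal"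
proof (rule irrelevant_idealI, rule ccontr)
  assume "Poly_Mapping.lookup p 0 \<noteq> 0"
  then have 0: "0 \<in> Poly_Mapping.keys p"
    by (simp add: in_keys_iff)
  obtain e where e: "\<forall>t\<in>Poly_Mapping.keys p. monom_degree t = e"
    using assms by (auto simp: homogeneous_def homogeneous_of_degree_def)
  then have "e = 0"
    using 0 monom_degree_eq_0_iff by metis
  then have "mpoly_degree p = 0"
    using degree_split_poly_le_iff[of monom_degree p 0] e by (simp add: mpoly_degree_def)
  then show False
    using assms mpoly_degree_0_iff by blast
qed

section \<open>Exact quotients and products of prime representatives\<close>

lemma exact_quotient_mult_left: "b \<noteq> 0 \<Longrightarrow> exact_quotient (b * c) b = (c :: 'a::idom)"
  unfolding exact_quotient_def by (rule the_equality) auto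

lemma exact_quotient_mult: "b dvd a \<Longrightarrow> b \<noteq> 0 \<Longrightarrow> b * exact_quotient a b = (a :: 'a::idom)"
  using exact_quotient_mult_left by (metis dvd_def)

lemma prime_elem_dvd_prod_mset:
  fixes r :: "'a::idom"
  assumes "prime_elem r" "r dvd prod_mset N"
  shows "\<exists>s. s \<in># N \<and> r dvd s"
  using assms(2)
proof (induction N)
  case empty
  then show ?case
    using assms(1) by (simp add: prime_elem_def)
next
  case (add s N)
  then have "r dvd s \<or> r dvd prod_mset N"
    using prime_elem_dvd_multD[OF assms(1)] by simp
  then show ?case
    using add.IH by auto
qed

lemma prod_mset_dvd_imp_subset:
  fixes N N' :: "'a::idom multiset"
  assumes "\<And>r. r \<in> R \<Longrightarrow> prime_elem r" "\<And>r s. r \<in> R \<Longrightarrow> s \<in> R \<Longrightarrow> r dvd s \<Longrightarrow> r = s"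
    and "set_mset N \<subseteq> R" "set_mset N' \<subseteq> R" "prod_mset N dvd prod_mset N'"
  shows "N \<subseteq># N'"
  using assms(3-)
proof (induction N arbitrary: N')
  case (add r N)
  have r: "prime_elem r" "r \<in> R"
    using add.prems assms(1) by auto
  have "r dvd prod_mset N'"
    using add.prems dvd_mult_left by auto
  then obtain s where "s \<in># N'" "r dvd s"
    using prime_elem_dvd_prod_mset r by blast
  then have "r \<in># N'"
    using assms(2) r add.prems by auto
  then obtain N'' where N'': "N' = add_mset r N''"
    by (meson multi_member_split)
  have "r \<noteq> 0"
    using r by auto
  then have "prod_mset N dvd prod_mset N''"
    using add.prems N'' by simp
  then have "N \<subseteq># N''"
    using add.IH add.prems N'' by auto
  then show ?case
    using N'' by simp
qed simp

lemma irreducible_representatives_dvd_eq: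
  assumes R: "irreducible_representatives m Q R" and "r \<in> R" "s \<in> R" "r dvd s"
  shows "r = (s :: 'a::idom)"
proof -
  have irr: "irreducible r" "irreducible s" "\<exists>i<m. r dvd Q i"
    using assms by (auto simp: irreducible_representatives_def)
  obtain t where t: "s = r * t"
    using assms by auto
  then have "t dvd 1"
    using irr by (auto simp: irreducible_def)
  then have "s dvd r"
    using t by (metis dvd_refl mult.right_neutral mult_dvd_mono)
  then show ?thesis
    using R irr assms unfolding irreducible_representatives_def by (metis dvd_refl)
qed

text \<open>Both lcms are products of primes from a set without distinct associated members, so
  mutual divisibility forces equal multisets of factors. Strands are indexed by the lcms themselves,
  and this puts associated lcms into one strand.\<close>

lemma normalized_lcm_antisym:
  fixes a b :: "('n::{finite,linorder}, 'k::field) mpoly"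
  assumes R: "irreducible_representatives m Q R"
    and "normalized_lcm R A a" "normalized_lcm R B b" "a dvd b" "b dvd a"
  shows "a = b"
proof -
  obtain M N where MN: "set_mset M \<subseteq> R" "a = prod_mset M" "set_mset N \<subseteq> R" "b = prod_mset N"
    using assms by (auto simp: normalized_lcm_def)
  have prime: "prime_elem r" if "r \<in> R" for r
    using that R mpoly_irreducible_imp_prime_elem by (auto simp: irreducible_representatives_def)
  note sub = prod_mset_dvd_imp_subset[OF prime irreducible_representatives_dvd_eq[OF R]]
  have "M \<subseteq># N" "N \<subseteq># M"
    using sub MN assms by auto
  then show ?thesis
    using MN by (metis subset_mset.antisym)
qed

section \<open>Chains and strands\<close>

abbreviation (input) keys where "keys \<equiv> Poly_Mapping.keys"
abbreviation (input) lookup where "lookup \<equiv> Poly_Mapping.lookup"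

interpretation chain: module "smul :: 'a::comm_ring_1 \<Rightarrow> (nat set \<Rightarrow>\<^sub>0 'a) \<Rightarrow> _"
  by (rule module_smul)

lemma smul_single: "smul c (Poly_Mapping.single \<sigma> d) = Poly_Mapping.single \<sigma> (c * d)"
  by (rule poly_mapping_eqI) (simp add: lookup_smul lookup_single when_def)

lemma bd_single:
  "bd (Poly_Mapping.single \<tau> c) = (\<Sum>i\<in>\<tau>. Poly_Mapping.single (\<tau> - {i}) ((-1) ^ eps \<tau> i * c))"
  by (simp add: bd_def)

lemma bd_add: "bd (x + y) = bd x + bd y"
  unfolding bd_def
  by (rule sum_keys_add[where g = "\<lambda>\<tau> c. \<Sum>i\<in>\<tau>. Poly_Mapping.single (\<tau> - {i}) ((-1) ^ eps \<tau> i * c)"])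
    (simp_all add: distrib_left single_add sum.distrib)

lemma bd_smul: "bd (smul c z) = smul c (bd z)"
proof (induction z rule: poly_mapping_single_induct)
  case (single \<tau> d)
  show ?case
    by (simp only: smul_single bd_single chain.scale_sum_right mult.left_commute)
qed (simp_all add: chain.scale_right_distrib bd_add, simp add: bd_def)

interpretation bd: module_hom smul smul bd
  by unfold_locales (simp_all add: bd_add bd_smul)

lemma keys_bd: "keys (bd z) \<subseteq> {\<tau> - {i} |\<tau> i. \<tau> \<in> keys z \<and> i \<in> \<tau>}"
proof -
  let ?f = "\<lambda>\<tau> i. Poly_Mapping.single (\<tau> - {i}) ((-1) ^ eps \<tau> i * lookup z \<tau>)"
  have "keys (bd z) \<subseteq> (\<Union>\<tau>\<in>keys z. keys (\<Sum>i\<in>\<tau>. ?f \<tau> i))"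
    unfolding bd_def by (rule keys_sum)
  also have "\<dots> \<subseteq> (\<Union>\<tau>\<in>keys z. \<Union>i\<in>\<tau>. keys (?f \<tau> i))"
    by (intro UN_mono subset_refl keys_sum)
  also have "\<dots> \<subseteq> {\<tau> - {i} |\<tau> i. \<tau> \<in> keys z \<and> i \<in> \<tau>}"
    by (auto split: if_splits)
  finally show ?thesis .
qed

definition restrict_chain :: "nat set set \<Rightarrow> (nat set \<Rightarrow>\<^sub>0 'a::comm_ring_1) \<Rightarrow> (nat set \<Rightarrow>\<^sub>0 'a)" where
  "restrict_chain X z = Poly_Mapping.mapp (\<lambda>\<sigma> c. if \<sigma> \<in> X then c else 0) z"

lemma lookup_restrict_chain: "lookup (restrict_chain X z) \<sigma> = (if \<sigma> \<in> X then lookup z \<sigma> else 0)"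
  by (simp add: restrict_chain_def lookup_mapp when_def in_keys_iff)

lemma keys_restrict_chain: "keys (restrict_chain X z) = keys z \<inter> X"
  by (auto simp: in_keys_iff lookup_restrict_chain split: if_splits)

interpretation restrict_chain: module_hom smul smul "restrict_chain X"
  by unfold_locales
    (rule poly_mapping_eqI; simp add: lookup_restrict_chain lookup_add lookup_smul)+

lemma restrict_chain_id: "keys z \<subseteq> X \<Longrightarrow> restrict_chain X z = z"
  by (rule poly_mapping_eqI) (auto simp: lookup_restrict_chain in_keys_iff)

lemma restrict_chain_0: "keys z \<inter> X = {} \<Longrightarrow> restrict_chain X z = 0"
  by (rule poly_mapping_eqI) (auto simp: lookup_restrict_chain in_keys_iff)

lemma strand_proj_eq: "strand_proj L q = restrict_chain {\<sigma>. L \<sigma> = q}"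
  by (rule ext) (simp add: strand_proj_def restrict_chain_def)

lemma keys_smul: "keys (smul c z) \<subseteq> keys z"
  by (auto simp: in_keys_iff lookup_smul)

lemma subspace_supported: "chain.subspace {z. keys z \<subseteq> X}"
proof (rule chain.subspaceI)
  fix x y :: "nat set \<Rightarrow>\<^sub>0 'a"
  assume "x \<in> {z. keys z \<subseteq> X}" "y \<in> {z. keys z \<subseteq> X}"
  then show "x + y \<in> {z. keys z \<subseteq> X}"
    using keys_add[of x y] by blast
next
  fix c and x :: "nat set \<Rightarrow>\<^sub>0 'a"
  assume "x \<in> {z. keys z \<subseteq> X}"
  then show "smul c x \<in> {z. keys z \<subseteq> X}"
    using keys_smul[of c x] by blast
qed simp

lemma index_chains_eq: "index_chains m p = {z. keys z \<subseteq> {\<sigma>. \<sigma> \<subseteq> {..<m} \<and> card \<sigma> = p}}"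
  by (simp add: index_chains_def)

lemma subspace_index_chains: "chain.subspace (index_chains m p)"
  unfolding index_chains_eq by (rule subspace_supported)

lemma bd_index_chains: "z \<in> index_chains m (Suc p) \<Longrightarrow> bd z \<in> index_chains m p"
proof -
  assume z: "z \<in> index_chains m (Suc p)"
  have "\<tau> - {i} \<subseteq> {..<m} \<and> card (\<tau> - {i}) = p" if "\<tau> \<in> keys z" "i \<in> \<tau>" for \<tau> i
  proof -
    have \<tau>: "\<tau> \<subseteq> {..<m}" "card \<tau> = Suc p"
      using z that by (auto simp: index_chains_def)
    then show ?thesis
      using that finite_subset[OF \<tau>(1)] by (auto simp: card_Diff_singleton_if)
  qed
  then show ?thesis
    using keys_bd[of z] by (fastforce simp: index_chains_def)
qed

lemma bd_index_chains_0:
  assumes "z \<in> index_chains m 0"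
  shows "bd z = 0"
proof -
  have "(\<Sum>i\<in>\<tau>. Poly_Mapping.single (\<tau> - {i}) ((-1) ^ eps \<tau> i * lookup z \<tau>)) = 0"
    if "\<tau> \<in> keys z" for \<tau>
  proof -
    have "\<tau> = {}"
      using assms that finite_subset[of \<tau> "{..<m}"] by (auto simp: index_chains_def)
    then show ?thesis
      by simp
  qed
  then show ?thesis
    unfolding bd_def by (rule sum.neutral[OF ballI])
qed

text \<open>The linear algebra over the field sees the lcms as labels compared by divisibility. The
  assumption \<open>bd_bd\<close> is discharged later by \<open>bd_bd_zero\<close>, from the Taylor
  complex.\<close>

locale lcm_strands =
  fixes m :: nat and L :: "nat set \<Rightarrow> 'q::comm_monoid_mult"
    and Hc Bc :: "'q \<Rightarrow> nat \<Rightarrow> (nat set \<Rightarrow>\<^sub>0 'k::field) set"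
  assumes L_mono: "\<sigma> \<subseteq> \<tau> \<Longrightarrow> \<tau> \<subseteq> {..<m} \<Longrightarrow> L \<sigma> dvd L \<tau>"
    and L_antisym: "\<sigma> \<subseteq> {..<m} \<Longrightarrow> \<tau> \<subseteq> {..<m} \<Longrightarrow> L \<sigma> dvd L \<tau> \<Longrightarrow> L \<tau> dvd L \<sigma> \<Longrightarrow> L \<sigma> = L \<tau>"
    and decompositions: "strand_decompositions m L Hc Bc"
    and bd_bd: "keys (z :: nat set \<Rightarrow>\<^sub>0 'k) \<subseteq> Pow {..<m} \<Longrightarrow> bd (bd z) = 0"
begin

abbreviation D :: "'q set" where "D \<equiv> lcm_lattice m L"

lemma finite_D: "finite D"
  by (simp add: lcm_lattice_def)

lemma L_in_D: "\<sigma> \<subseteq> {..<m} \<Longrightarrow> L \<sigma> \<in> D"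
  by (auto simp: lcm_lattice_def)

lemma D_antisym: "q \<in> D \<Longrightarrow> r \<in> D \<Longrightarrow> q dvd r \<Longrightarrow> r dvd q \<Longrightarrow> q = r"
  using L_antisym by (auto simp: lcm_lattice_def)

text \<open>Counting divisors inside \<open>D\<close> turns divisibility, a partial order there,
  into a numerical rank that grows strictly and attains its maximum on
  \<open>\<Delta>\<close>.\<close>

lemma maximal_element:
  assumes "\<Delta> \<subseteq> D" "\<Delta> \<noteq> {}"
  shows "\<exists>q\<in>\<Delta>. \<forall>r\<in>\<Delta>. q dvd r \<longrightarrow> r = q"
proof -
  define rank where "rank q = card {r \<in> D. r dvd q}" for q
  have fin: "finite \<Delta>"
    using assms finite_D finite_subset by blast
  have "Max (rank ` \<Delta>) \<in> rank ` \<Delta>"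
    using fin assms by simp
  then obtain q where q: "q \<in> \<Delta>" "rank q = Max (rank ` \<Delta>)"
    by auto
  have "r = q" if r: "r \<in> \<Delta>" "q dvd r" for r
  proof (rule ccontr)
    assume "r \<noteq> q"
    then have "\<not> r dvd q"
      using r q assms D_antisym by blast
    then have "{s \<in> D. s dvd q} \<subset> {s \<in> D. s dvd r}"
      using r assms dvd_trans[of _ q r] by auto
    then have "rank q < rank r"
      unfolding rank_def using finite_D by (intro psubset_card_mono) auto
    then show False
      using q r fin by (simp add: not_le[symmetric])
  qed
  then show ?thesis
    using q by blast
qed

section \<open>The filtration of K by divisibility\<close>

definition over :: "'q set \<Rightarrow> (nat set \<Rightarrow>\<^sub>0 'k) set" where
  "over \<Delta> = {z. keys z \<subseteq> {\<sigma>. \<sigma> \<subseteq> {..<m} \<and> L \<sigma> \<in> \<Delta>}}"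

text \<open>For such \<open>\<Delta>\<close> the space \<open>over \<Delta>\<close> is a subcomplex,
  by \<open>bd_over\<close>. The cases that matter are all labels, the divisors of some
  \<open>q\<close>, the proper divisors of \<open>q\<close>, and what remains of a down-closed set
  after removing a maximal label.\<close>

definition lower :: "'q set \<Rightarrow> bool" where
  "lower \<Delta> \<longleftrightarrow> (\<forall>\<sigma> \<tau>. \<sigma> \<subseteq> {..<m} \<longrightarrow> \<tau> \<subseteq> {..<m} \<longrightarrow> L \<sigma> dvd L \<tau> \<longrightarrow> L \<tau> \<in> \<Delta> \<longrightarrow> L \<sigma> \<in> \<Delta>)"

lemma subspace_over: "chain.subspace (over \<Delta>)"
  unfolding over_def by (rule subspace_supported)

lemma over_mono: "\<Delta> \<subseteq> \<Delta>' \<Longrightarrow> over \<Delta> \<subseteq> over \<Delta>'"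
  by (auto simp: over_def)

lemma over_UNIV: "z \<in> over \<Delta> \<Longrightarrow> z \<in> over UNIV"
  using over_mono by blast

lemma over_Int_D: "over (\<Delta> \<inter> D) = over \<Delta>"
  using L_in_D by (auto simp: over_def)

lemma index_chains_over: "z \<in> index_chains m p \<Longrightarrow> z \<in> over UNIV"
  by (auto simp: over_def index_chains_def)

lemma over_iff: "z \<in> over \<Delta> \<longleftrightarrow> z \<in> over UNIV \<and> (\<forall>\<sigma>\<in>keys z. L \<sigma> \<in> \<Delta>)"
  by (auto simp: over_def)

lemma bd_over:
  assumes "lower \<Delta>" "z \<in> over \<Delta>"
  shows "bd z \<in> over \<Delta>"
proof -
  have "\<tau> - {i} \<subseteq> {..<m} \<and> L (\<tau> - {i}) \<in> \<Delta>" if "\<tau> \<in> keys z" for \<tau> i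
  proof -
    have \<tau>: "\<tau> \<subseteq> {..<m}" "L \<tau> \<in> \<Delta>"
      using assms that by (auto simp: over_def)
    moreover have "\<tau> - {i} \<subseteq> {..<m}" "L (\<tau> - {i}) dvd L \<tau>"
      using \<tau> L_mono by auto
    ultimately show ?thesis
      using assms unfolding lower_def by blast
  qed
  then show ?thesis
    using keys_bd[of z] by (fastforce simp: over_def)
qed

lemma lower_UNIV: "lower UNIV"
  by (simp add: lower_def)

lemma lower_dvd: "lower {r. r dvd q}"
  using dvd_trans by (auto simp: lower_def)

lemma lower_strict: "q \<in> D \<Longrightarrow> lower {r. r dvd q \<and> r \<noteq> q}"
  using L_antisym dvd_trans by (fastforce simp: lower_def lcm_lattice_def)

lemma bd_bd_over: "z \<in> over \<Delta> \<Longrightarrow> bd (bd z) = 0"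
  by (rule bd_bd) (auto simp: over_def)

section \<open>Bigraded components and the chosen decompositions\<close>

abbreviation component :: "'q \<Rightarrow> nat \<Rightarrow> (nat set \<Rightarrow>\<^sub>0 'k) \<Rightarrow> (nat set \<Rightarrow>\<^sub>0 'k)" where
  "component q p \<equiv> restrict_chain {\<sigma>. L \<sigma> = q \<and> card \<sigma> = p}"

lemma strand_iff: "z \<in> strand m L q p \<longleftrightarrow> keys z \<subseteq> {\<sigma>. \<sigma> \<subseteq> {..<m} \<and> L \<sigma> = q \<and> card \<sigma> = p}"
  by (auto simp: strand_def index_chains_def)

lemma subspace_strand: "chain.subspace (strand m L q p :: (nat set \<Rightarrow>\<^sub>0 'k) set)"
proof -
  have "(strand m L q p :: (nat set \<Rightarrow>\<^sub>0 'k) set) = {z. keys z \<subseteq> {\<sigma>. \<sigma> \<subseteq> {..<m} \<and> L \<sigma> = q \<and> card \<sigma> = p}}"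
    using strand_iff by blast
  then show ?thesis
    by (simp only: subspace_supported)
qed

lemma component_strand: "z \<in> over UNIV \<Longrightarrow> component q p z \<in> strand m L q p"
  by (auto simp: strand_iff keys_restrict_chain over_def)

lemma component_of_strand:
  assumes "z \<in> strand m L q p"
  shows "component q' p' z = (if q' = q \<and> p' = p then z else 0)"
  using assms by (auto simp: strand_iff intro!: restrict_chain_id restrict_chain_0)

lemma component_of_index_chains:
  "z \<in> index_chains m p \<Longrightarrow> p' \<noteq> p \<Longrightarrow> component q p' z = 0"
  by (auto simp: index_chains_def intro!: restrict_chain_0)

lemma component_of_over: "z \<in> over \<Delta> \<Longrightarrow> q \<notin> \<Delta> \<Longrightarrow> component q p z = 0"
  by (auto simp: over_def intro!: restrict_chain_0)

lemma strand_over: "z \<in> strand m L q p \<Longrightarrow> z \<in> over {q}"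
  by (auto simp: over_def strand_iff)

lemma strand_index_chains: "z \<in> strand m L q p \<Longrightarrow> z \<in> index_chains m p"
  by (auto simp: strand_def)

lemma sum_components:
  assumes "z \<in> index_chains m p"
  shows "(\<Sum>q\<in>D. component q p z) = z"
proof (rule poly_mapping_eqI)
  fix \<sigma>
  have "lookup (\<Sum>q\<in>D. component q p z) \<sigma> = (\<Sum>q\<in>D. if L \<sigma> = q \<and> card \<sigma> = p then lookup z \<sigma> else 0)"
    by (simp add: lookup_sum lookup_restrict_chain)
  also have "\<dots> = lookup z \<sigma>"
  proof (cases "\<sigma> \<in> keys z")
    case True
    then have "L \<sigma> \<in> D" "card \<sigma> = p"
      using assms L_in_D by (auto simp: index_chains_def)
    then show ?thesis
      using finite_D by simp
  qed (simp add: in_keys_iff cong: if_cong)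
  finally show "lookup (\<Sum>q\<in>D. component q p z) \<sigma> = lookup z \<sigma>" .
qed

lemma strand_bd_0: "strand_bd L q 0 = (0 :: nat set \<Rightarrow>\<^sub>0 'k)"
  by (simp add: strand_bd_def strand_proj_eq restrict_chain.zero bd.zero)

lemma zero_boundaries: "0 \<in> (strand_boundaries m L q p :: (nat set \<Rightarrow>\<^sub>0 'k) set)"
  unfolding strand_boundaries_def
  using chain.subspace_0[OF subspace_strand] strand_bd_0 by (metis image_eqI)

lemma zero_cycles: "0 \<in> (strand_cycles m L q p :: (nat set \<Rightarrow>\<^sub>0 'k) set)"
  using chain.subspace_0[OF subspace_strand] strand_bd_0 by (simp add: strand_cycles_def)

lemma subspace_cycles: "chain.subspace (strand_cycles m L q p :: (nat set \<Rightarrow>\<^sub>0 'k) set)"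
  unfolding strand_cycles_def
  using subspace_strand[of q p]
  by (auto simp: chain.subspace_def strand_bd_def strand_proj_eq restrict_chain.zero bd.zero
      restrict_chain.add bd.add restrict_chain.scale bd.scale)

lemma decomposition:
  assumes "q \<in> D"
  shows "chain.subspace (Hc q p)" "chain.subspace (Bc q p)"
    "strand_cycles m L q p = {v + w |v w. v \<in> strand_boundaries m L q p \<and> w \<in> Hc q p}"
    "strand_boundaries m L q p \<inter> Hc q p = {0}"
    "strand m L q p = {v + w |v w. v \<in> strand_cycles m L q p \<and> w \<in> Bc q p}"
    "strand_cycles m L q p \<inter> Bc q p = {0}"
proof -
  have "chain.subspace (Hc q p) \<and> chain.subspace (Bc q p) \<and>
      internal_direct_sum (strand_cycles m L q p) (strand_boundaries m L q p) (Hc q p) \<and>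
      internal_direct_sum (strand m L q p) (strand_cycles m L q p) (Bc q p)"
    using decompositions assms unfolding strand_decompositions_def by blast
  then show "chain.subspace (Hc q p)" "chain.subspace (Bc q p)"
    "strand_cycles m L q p = {v + w |v w. v \<in> strand_boundaries m L q p \<and> w \<in> Hc q p}"
    "strand_boundaries m L q p \<inter> Hc q p = {0}"
    "strand m L q p = {v + w |v w. v \<in> strand_cycles m L q p \<and> w \<in> Bc q p}"
    "strand_cycles m L q p \<inter> Bc q p = {0}"
    unfolding internal_direct_sum_def by - (elim conjE, assumption)+
qed

lemma Hc_cycles:
  assumes "q \<in> D" "a \<in> Hc q p"
  shows "a \<in> strand_cycles m L q p"
proof -
  have "0 + a \<in> strand_cycles m L q p"
    unfolding decomposition(3)[OF assms(1)] using zero_boundaries assms by blast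
  then show ?thesis by simp
qed

lemma Hc_strand: "q \<in> D \<Longrightarrow> a \<in> Hc q p \<Longrightarrow> a \<in> strand m L q p"
  using Hc_cycles by (auto simp: strand_cycles_def)

lemma Bc_strand:
  assumes "q \<in> D" "b \<in> Bc q p"
  shows "b \<in> strand m L q p"
proof -
  have "0 + b \<in> strand m L q p"
    unfolding decomposition(5)[OF assms(1)] using zero_cycles assms by blast
  then show ?thesis by simp
qed

text \<open>A strand boundary already comes from B': in a preimage \<open>y\<close> the cycle part
  contributes nothing.\<close>

lemma strand_split:
  assumes "q \<in> D" "z \<in> strand m L q p"
  obtains b' a b where "b' \<in> Bc q (Suc p)" "a \<in> Hc q p" "b \<in> Bc q p"
    "z = strand_bd L q b' + a + b"
proof -
  obtain c b where cb: "c \<in> strand_cycles m L q p" "b \<in> Bc q p" "z = c + b"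
    using decomposition(5)[OF assms(1), of p] assms(2) by auto
  then obtain v a where va: "v \<in> strand_boundaries m L q p" "a \<in> Hc q p" "c = v + a"
    using decomposition(3)[OF assms(1), of p] by auto
  then obtain y where y: "y \<in> strand m L q (Suc p)" "v = strand_bd L q y"
    by (auto simp: strand_boundaries_def)
  then obtain c' b' where c': "c' \<in> strand_cycles m L q (Suc p)" "b' \<in> Bc q (Suc p)" "y = c' + b'"
    using decomposition(5)[OF assms(1), of "Suc p"] by auto
  then have "v = strand_bd L q b'"
    using y by (simp add: strand_bd_def strand_proj_eq strand_cycles_def restrict_chain.add bd.add)
  then show thesis
    using that cb va c' by blast
qed

text \<open>As \<open>a + b\<close> is a cycle, so is \<open>b\<close>, and B' meets the cycles in
  0; then \<open>a\<close> lies both in H' and in the boundaries.\<close>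

lemma boundaries_Int:
  assumes "q \<in> D" "a \<in> Hc q p" "b \<in> Bc q p" "a + b \<in> strand_boundaries m L q p"
  shows "a + b = 0"
proof -
  have "a + b + 0 \<in> strand_cycles m L q p"
    unfolding decomposition(3)[OF assms(1)]
    using assms chain.subspace_0[OF decomposition(1)[OF assms(1)]] by blast
  then have "(a + b) - a \<in> strand_cycles m L q p"
    using Hc_cycles assms chain.subspace_diff[OF subspace_cycles] by fastforce
  then have "b = 0"
    using decomposition(6)[OF assms(1), of p] assms by auto
  then show ?thesis
    using decomposition(4)[OF assms(1), of p] assms by auto
qed

text \<open>\<open>Bt\<close> is \<open>B'\<close>, and \<open>Wt\<close> is \<open>H' \<oplus> B'\<close>, both summed over all degrees.\<close>

definition Bt :: "(nat set \<Rightarrow>\<^sub>0 'k) set" where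
  "Bt = {z \<in> over UNIV. \<forall>q\<in>D. \<forall>p. component q p z \<in> Bc q p}"

definition Wt :: "(nat set \<Rightarrow>\<^sub>0 'k) set" where
  "Wt = {z \<in> over UNIV. \<forall>q\<in>D. \<forall>p. \<exists>a\<in>Hc q p. \<exists>b\<in>Bc q p. component q p z = a + b}"

lemma subspace_Bt: "chain.subspace Bt"
  using subspace_over[of UNIV] decomposition(2)
  by (auto simp: Bt_def chain.subspace_def restrict_chain.zero restrict_chain.add restrict_chain.scale)

lemma subspace_Wt: "chain.subspace Wt"
proof (rule chain.subspaceI)
  show "0 \<in> Wt"
    using chain.subspace_0[OF subspace_over[of UNIV]] chain.subspace_0[OF decomposition(1)]
      chain.subspace_0[OF decomposition(2)]
    by (force simp: Wt_def restrict_chain.zero)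
next
  fix x y assume xy: "x \<in> Wt" "y \<in> Wt"
  have "\<exists>a\<in>Hc q p. \<exists>b\<in>Bc q p. component q p (x + y) = a + b" if q: "q \<in> D" for q p
  proof -
    obtain a b a' b' where *: "a \<in> Hc q p" "b \<in> Bc q p" "a' \<in> Hc q p" "b' \<in> Bc q p"
      "component q p x = a + b" "component q p y = a' + b'"
      using xy q unfolding Wt_def by blast
    have "component q p (x + y) = (a + a') + (b + b')"
      using * by (simp add: restrict_chain.add)
    then show ?thesis
      using * chain.subspace_add decomposition(1,2)[OF q] by blast
  qed
  then show "x + y \<in> Wt"
    using xy chain.subspace_add[OF subspace_over] unfolding Wt_def by blast
next
  fix c x assume x: "x \<in> Wt"
  have "\<exists>a\<in>Hc q p. \<exists>b\<in>Bc q p. component q p (smul c x) = a + b" if q: "q \<in> D" for q p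
  proof -
    obtain a b where *: "a \<in> Hc q p" "b \<in> Bc q p" "component q p x = a + b"
      using x q unfolding Wt_def by blast
    have "component q p (smul c x) = smul c a + smul c b"
      using * by (simp add: restrict_chain.scale chain.scale_right_distrib)
    then show ?thesis
      using * chain.subspace_scale decomposition(1,2)[OF q] by blast
  qed
  then show "smul c x \<in> Wt"
    using x chain.subspace_scale[OF subspace_over] unfolding Wt_def by blast
qed

lemma Bt_Wt: "b \<in> Bt \<Longrightarrow> b \<in> Wt"
  using chain.subspace_0[OF decomposition(1)] by (force simp: Bt_def Wt_def)

lemma Wt_over: "b \<in> Wt \<Longrightarrow> b \<in> over UNIV"
  by (simp add: Wt_def)

lemma strand_over_UNIV: "z \<in> strand m L q p \<Longrightarrow> z \<in> over UNIV"
  using strand_over over_UNIV by blast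

lemma Bc_Bt:
  assumes "q \<in> D" "b \<in> Bc q p"
  shows "b \<in> Bt"
  using assms Bc_strand[OF assms] chain.subspace_0[OF decomposition(2)]
  by (simp add: Bt_def component_of_strand strand_over_UNIV)

lemma Hc_Wt:
  assumes "q \<in> D" "a \<in> Hc q p"
  shows "a \<in> Wt"
proof -
  have "\<exists>a'\<in>Hc q' p'. \<exists>b'\<in>Bc q' p'. component q' p' a = a' + b'" if "q' \<in> D" for q' p'
    using assms Hc_strand[OF assms] chain.subspace_0[OF decomposition(1)[OF that]]
      chain.subspace_0[OF decomposition(2)[OF that]]
    by (intro bexI[of _ "component q' p' a"] bexI[of _ 0]) (auto simp: component_of_strand)
  then show ?thesis
    using Hc_strand[OF assms] strand_over_UNIV by (simp add: Wt_def)
qed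

end

section \<open>The contraction and the projection onto M\<close>

context lcm_strands
begin

text \<open>Existence half of K = d(B') + W, by elimination from the top. At a maximal
  \<open>q\<close> the element \<open>b'\<close> matches the boundary part of the component of
  \<open>z\<close>. Everything else in \<open>bd b'\<close> has a label properly dividing
  \<open>q\<close>, so the remainder lives over \<open>\<Delta> - {q}\<close> and the argument can
  be repeated.\<close>

lemma eliminate_boundaries:
  assumes "finite \<Delta>" "\<Delta> \<subseteq> D" "lower \<Delta>" "z \<in> index_chains m p" "z \<in> over \<Delta>"
  shows "\<exists>b. b \<in> Bt \<and> b \<in> over \<Delta> \<and> b \<in> index_chains m (Suc p) \<and> z - bd b \<in> Wt"
  using assms
proof (induction \<Delta> arbitrary: z rule: finite_psubset_induct)
  case (psubset \<Delta>)
  show ?case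
  proof (cases "\<Delta> = {}")
    case True
    then have "z = 0"
      using psubset.prems by (auto simp: over_def)
    then show ?thesis
      using chain.subspace_0[OF subspace_Bt] chain.subspace_0[OF subspace_over]
        chain.subspace_0[OF subspace_index_chains] chain.subspace_0[OF subspace_Wt]
      by (intro exI[of _ 0]) (simp add: bd.zero)
  next
    case False
    then obtain q where q: "q \<in> \<Delta>" and max: "\<And>r. r \<in> \<Delta> \<Longrightarrow> q dvd r \<Longrightarrow> r = q"
      using maximal_element[OF psubset.prems(1) False] by metis
    have qD: "q \<in> D"
      using q psubset.prems by blast
    \<comment> \<open>Removing a maximal label keeps the set down-closed.\<close>
    have lower': "lower (\<Delta> - {q})"
      using psubset.prems max unfolding lower_def by blast
    obtain b' a b where split: "b' \<in> Bc q (Suc p)" "a \<in> Hc q p" "b \<in> Bc q p"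
      "component q p z = strand_bd L q b' + a + b"
      by (rule strand_split[OF qD component_strand[OF index_chains_over[OF psubset.prems(3)]], of p])
    have b': "b' \<in> strand m L q (Suc p)"
      using Bc_strand[OF qD split(1)] .
    have b'\<Delta>: "b' \<in> over \<Delta>"
      using strand_over[OF b'] over_mono[of "{q}" \<Delta>] q by blast
    define x where "x = z - bd b' - (a + b)"
    have ab: "a + b \<in> strand m L q p"
      by (intro chain.subspace_add[OF subspace_strand] Hc_strand Bc_strand qD split)
    have x\<Delta>: "x \<in> over \<Delta>"
      unfolding x_def using psubset.prems b'\<Delta> bd_over strand_over[OF ab] over_mono[of "{q}" \<Delta>] q
      by (intro chain.subspace_diff[OF subspace_over]) auto
    have bdb': "bd b' \<in> index_chains m p"
      using b' strand_index_chains bd_index_chains by blast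
    have xp: "x \<in> index_chains m p"
      unfolding x_def using psubset.prems bdb' strand_index_chains[OF ab]
      by (intro chain.subspace_diff[OF subspace_index_chains]) auto
    have "component q p (bd b') = strand_bd L q b'"
      unfolding strand_bd_def strand_proj_eq
      by (rule poly_mapping_eqI) (use bdb' in \<open>auto simp: lookup_restrict_chain index_chains_def in_keys_iff\<close>)
    then have cx: "component q p x = 0"
      using split ab by (simp add: x_def restrict_chain.diff component_of_strand)
    have "L \<sigma> \<noteq> q" if "\<sigma> \<in> keys x" for \<sigma>
    proof
      assume "L \<sigma> = q"
      moreover have "card \<sigma> = p"
        using that xp by (auto simp: index_chains_def)
      ultimately have "lookup (component q p x) \<sigma> = lookup x \<sigma>"
        by (simp add: lookup_restrict_chain)
      then show False
        using cx that by (simp add: in_keys_iff)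
    qed
    then have x': "x \<in> over (\<Delta> - {q})"
      using x\<Delta> by (auto simp: over_def)
    have "\<Delta> - {q} \<subset> \<Delta>" "\<Delta> - {q} \<subseteq> D"
      using q psubset.prems by auto
    then obtain b'' where b'': "b'' \<in> Bt" "b'' \<in> over (\<Delta> - {q})" "b'' \<in> index_chains m (Suc p)" "x - bd b'' \<in> Wt"
      using psubset.IH[of "\<Delta> - {q}" x] lower' xp x' by blast
    have "z - bd (b' + b'') = (x - bd b'') + (a + b)"
      by (simp add: x_def bd.add)
    moreover have "a + b \<in> Wt"
      by (rule chain.subspace_add[OF subspace_Wt Hc_Wt[OF qD split(2)] Bt_Wt[OF Bc_Bt[OF qD split(3)]]])
    ultimately have "z - bd (b' + b'') \<in> Wt"
      using chain.subspace_add[OF subspace_Wt b''(4)] by simp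
    moreover have "b' + b'' \<in> Bt"
      by (rule chain.subspace_add[OF subspace_Bt Bc_Bt[OF qD split(1)] b''(1)])
    moreover have "b' + b'' \<in> over \<Delta>"
      using b'' b'\<Delta> over_mono[of "\<Delta> - {q}" \<Delta>] by (intro chain.subspace_add[OF subspace_over]) auto
    moreover have "b' + b'' \<in> index_chains m (Suc p)"
      using b'' strand_index_chains[OF b'] by (intro chain.subspace_add[OF subspace_index_chains]) auto
    ultimately show ?thesis
      by blast
  qed
qed

text \<open>The restriction to one degree is lifted by treating basis elements separately;
  intersecting with \<open>D\<close> makes the set of labels finite without changing
  \<open>over\<close>.\<close>

lemma eliminate_boundaries_over:
  assumes "lower \<Delta>" "z \<in> over \<Delta>"
  shows "\<exists>b. b \<in> Bt \<and> b \<in> over \<Delta> \<and> z - bd b \<in> Wt"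
proof -
  have "\<exists>b. b \<in> Bt \<and> b \<in> over \<Delta> \<and> Poly_Mapping.single \<sigma> (lookup z \<sigma>) - bd b \<in> Wt" if \<sigma>: "\<sigma> \<in> keys z" for \<sigma>
  proof -
    have *: "\<sigma> \<subseteq> {..<m}" "L \<sigma> \<in> \<Delta>"
      using assms \<sigma> by (auto simp: over_def)
    have "lower (\<Delta> \<inter> D)"
      using assms L_in_D by (auto simp: lower_def)
    moreover have "Poly_Mapping.single \<sigma> (lookup z \<sigma>) \<in> index_chains m (card \<sigma>)"
      "Poly_Mapping.single \<sigma> (lookup z \<sigma>) \<in> over (\<Delta> \<inter> D)"
      using * unfolding over_Int_D by (auto simp: over_def index_chains_def)
    ultimately show ?thesis
      using eliminate_boundaries[of "\<Delta> \<inter> D"] finite_D unfolding over_Int_D by blast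
  qed
  then obtain b where b: "\<And>\<sigma>. \<sigma> \<in> keys z \<Longrightarrow> b \<sigma> \<in> Bt"
    "\<And>\<sigma>. \<sigma> \<in> keys z \<Longrightarrow> b \<sigma> \<in> over \<Delta>"
    "\<And>\<sigma>. \<sigma> \<in> keys z \<Longrightarrow> Poly_Mapping.single \<sigma> (lookup z \<sigma>) - bd (b \<sigma>) \<in> Wt"
    by metis
  let ?b = "\<Sum>\<sigma>\<in>keys z. b \<sigma>"
  have "?b \<in> Bt" "?b \<in> over \<Delta>"
    using b by (auto intro!: chain.subspace_sum[OF subspace_Bt] chain.subspace_sum[OF subspace_over])
  moreover have "z - bd ?b = (\<Sum>\<sigma>\<in>keys z. Poly_Mapping.single \<sigma> (lookup z \<sigma>) - bd (b \<sigma>))"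
    by (simp add: bd.sum sum_subtractf flip: poly_mapping_sum_single)
  then have "z - bd ?b \<in> Wt"
    using b by (simp add: chain.subspace_sum[OF subspace_Wt])
  ultimately show ?thesis
    by blast
qed

text \<open>Uniqueness half: d is injective on B' and d(B') meets W in 0. At a maximal label
  \<open>q\<close> of \<open>b\<close> the part of \<open>bd b\<close> with this label is a strand
  boundary that lies in H' + B', so it vanishes; then the component of \<open>b\<close> is a cycle
  in B', hence 0.\<close>

lemma bd_Bt_in_Wt_imp_0:
  assumes "b \<in> Bt" "bd b \<in> Wt"
  shows "b = 0"
proof (rule ccontr)
  assume "b \<noteq> 0"
  then have "L ` keys b \<noteq> {}" "L ` keys b \<subseteq> D"
    using assms L_in_D by (auto simp: Bt_def over_def)
  then obtain q where q: "q \<in> L ` keys b" and max: "\<And>r. r \<in> L ` keys b \<Longrightarrow> q dvd r \<Longrightarrow> r = q"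
    using maximal_element by meson
  then obtain \<sigma> where \<sigma>: "\<sigma> \<in> keys b" "L \<sigma> = q"
    by auto
  have sub: "\<tau> \<subseteq> {..<m}" if "\<tau> \<in> keys b" for \<tau>
    using that assms by (auto simp: Bt_def over_def)
  have qD: "q \<in> D"
    using \<sigma> sub L_in_D by blast
  define p where "p = card \<sigma>"
  define c where "c = component q p b"
  have c: "c \<in> Bc q p" "c \<in> strand m L q p"
    using assms qD Bc_strand by (auto simp: c_def Bt_def)
  have "strand_bd L q c = 0"
  proof (cases p)
    \<comment> \<open>Nothing lies below degree 0, so there every chain is a cycle.\<close>
    case 0
    then have "bd c = 0"
      using c strand_index_chains bd_index_chains_0 by metis
    then show ?thesis
      by (simp add: strand_bd_def strand_proj_eq restrict_chain.zero)
  next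
    case (Suc p')
    have c_chain: "bd c \<in> index_chains m p'"
      using c strand_index_chains bd_index_chains Suc by metis
    \<comment> \<open>A face with label \<open>q\<close> and size \<open>p'\<close> comes from a set
      of size \<open>p\<close> whose label is a multiple of \<open>q\<close>, hence equal to
      \<open>q\<close> by maximality. All such terms of \<open>b\<close> are already in
      \<open>c\<close>.\<close>
    have rest: "component q p' (bd (b - c)) = 0"
    proof (rule restrict_chain_0, rule ccontr)
      assume "keys (bd (b - c)) \<inter> {\<sigma>. L \<sigma> = q \<and> card \<sigma> = p'} \<noteq> {}"
      then obtain \<tau> i where \<tau>: "\<tau> \<in> keys (b - c)" "i \<in> \<tau>" "L (\<tau> - {i}) = q" "card (\<tau> - {i}) = p'"
        using keys_bd[of "b - c"] by blast
      have "lookup (b - c) \<tau> = (if L \<tau> = q \<and> card \<tau> = p then 0 else lookup b \<tau>)"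
        by (simp add: c_def lookup_minus lookup_restrict_chain)
      then have \<tau>b: "\<tau> \<in> keys b" "\<not> (L \<tau> = q \<and> card \<tau> = p)"
        using \<tau> by (auto simp: in_keys_iff split: if_splits)
      have "finite \<tau>"
        using sub[OF \<tau>b(1)] finite_subset by blast
      then have "card \<tau> = p"
        using \<tau> Suc by (metis card_Suc_Diff1)
      moreover have "q dvd L \<tau>"
        using L_mono[of "\<tau> - {i}" \<tau>] \<tau> sub[OF \<tau>b(1)] by auto
      then have "L \<tau> = q"
        using max \<tau>b by blast
      ultimately show False
        using \<tau>b by blast
    qed
    have "component q p' (bd b) = component q p' (bd c) + component q p' (bd (b - c))"
      by (simp add: bd.diff restrict_chain.diff)
    moreover have "component q p' (bd c) = strand_bd L q c"
      unfolding strand_bd_def strand_proj_eq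
      by (rule poly_mapping_eqI) (use c_chain in \<open>auto simp: lookup_restrict_chain index_chains_def in_keys_iff\<close>)
    ultimately have eq: "component q p' (bd b) = strand_bd L q c"
      using rest by simp
    obtain a b' where ab: "a \<in> Hc q p'" "b' \<in> Bc q p'" "component q p' (bd b) = a + b'"
      using assms qD unfolding Wt_def by blast
    have "a + b' \<in> strand_boundaries m L q p'"
      using c(2) Suc unfolding strand_boundaries_def ab(3)[symmetric] eq by blast
    then show ?thesis
      using boundaries_Int[OF qD ab(1,2)] eq ab by simp
  qed
  then have "c \<in> strand_cycles m L q p"
    using c by (simp add: strand_cycles_def)
  then have "c = 0"
    using decomposition(6)[OF qD, of p] c by blast
  moreover have "lookup c \<sigma> = lookup b \<sigma>"
    using \<sigma> by (simp add: c_def p_def lookup_restrict_chain)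
  ultimately show False
    using \<sigma> by (simp add: in_keys_iff)
qed

text \<open>As \<open>K = bd Bt \<oplus> Wt\<close>, this is the inverse of \<open>bd\<close> on the first summand and zero on the second.\<close>

definition contraction :: "(nat set \<Rightarrow>\<^sub>0 'k) \<Rightarrow> (nat set \<Rightarrow>\<^sub>0 'k)" where
  "contraction z = (THE b. b \<in> Bt \<and> z - bd b \<in> Wt)"

lemma contraction_eqI:
  assumes "b \<in> Bt" "z - bd b \<in> Wt"
  shows "contraction z = b"
  unfolding contraction_def
proof (rule the_equality)
  fix c assume c: "c \<in> Bt \<and> z - bd c \<in> Wt"
  have "bd (c - b) = (z - bd b) - (z - bd c)"
    by (simp add: bd.diff)
  then have "bd (c - b) \<in> Wt"
    using assms c chain.subspace_diff[OF subspace_Wt] by metis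
  moreover have "c - b \<in> Bt"
    using assms c chain.subspace_diff[OF subspace_Bt] by blast
  ultimately show "c = b"
    using bd_Bt_in_Wt_imp_0 by fastforce
qed (use assms in blast)

lemma contraction:
  assumes "z \<in> over UNIV"
  shows "contraction z \<in> Bt" "z - bd (contraction z) \<in> Wt"
  using eliminate_boundaries_over[OF lower_UNIV assms] contraction_eqI by blast+

lemma contraction_over:
  assumes "lower \<Delta>" "z \<in> over \<Delta>"
  shows "contraction z \<in> over \<Delta>"
  using eliminate_boundaries_over[OF assms] contraction_eqI by blast

lemma contraction_index_chains:
  assumes "z \<in> index_chains m p"
  shows "contraction z \<in> index_chains m (Suc p)"
proof -
  have "z \<in> over D" "lower D"
    using index_chains_over[OF assms] over_Int_D[of UNIV] L_in_D by (auto simp: lower_def)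
  then show ?thesis
    using eliminate_boundaries[OF finite_D subset_refl _ assms] contraction_eqI by blast
qed

lemma contraction_add:
  assumes "x \<in> over UNIV" "y \<in> over UNIV"
  shows "contraction (x + y) = contraction x + contraction y"
proof (rule contraction_eqI)
  show "contraction x + contraction y \<in> Bt"
    using assms contraction chain.subspace_add[OF subspace_Bt] by blast
  have "(x - bd (contraction x)) + (y - bd (contraction y)) \<in> Wt"
    using assms contraction chain.subspace_add[OF subspace_Wt] by blast
  then show "x + y - bd (contraction x + contraction y) \<in> Wt"
    by (simp add: bd.add algebra_simps)
qed

lemma contraction_smul:
  assumes "x \<in> over UNIV"
  shows "contraction (smul c x) = smul c (contraction x)"
proof (rule contraction_eqI)
  show "smul c (contraction x) \<in> Bt"
    using assms contraction chain.subspace_scale[OF subspace_Bt] by blast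
  have "smul c (x - bd (contraction x)) \<in> Wt"
    using assms contraction chain.subspace_scale[OF subspace_Wt] by blast
  then show "smul c x - bd (smul c (contraction x)) \<in> Wt"
    by (simp add: bd.scale chain.scale_right_diff_distrib)
qed

lemma contraction_Wt: "z \<in> Wt \<Longrightarrow> contraction z = 0"
  using chain.subspace_0[OF subspace_Bt] by (intro contraction_eqI) (simp_all add: bd.zero)

lemma contraction_bd: "b \<in> Bt \<Longrightarrow> contraction (bd b) = b"
  using chain.subspace_0[OF subspace_Wt] by (intro contraction_eqI) simp_all

section \<open>The chain projection on K\<close>

definition proj :: "(nat set \<Rightarrow>\<^sub>0 'k) \<Rightarrow> (nat set \<Rightarrow>\<^sub>0 'k)" where
  "proj z = z - bd (contraction z) - contraction (bd z)"

lemma bd_over_UNIV: "z \<in> over UNIV \<Longrightarrow> bd z \<in> over UNIV"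
  by (rule bd_over[OF lower_UNIV])

lemma contraction_over_UNIV: "z \<in> over UNIV \<Longrightarrow> contraction z \<in> over UNIV"
  by (rule contraction_over[OF lower_UNIV])

lemma proj_add: "x \<in> over UNIV \<Longrightarrow> y \<in> over UNIV \<Longrightarrow> proj (x + y) = proj x + proj y"
  by (simp add: proj_def contraction_add bd_over_UNIV bd.add)

lemma proj_smul: "x \<in> over UNIV \<Longrightarrow> proj (smul c x) = smul c (proj x)"
  by (simp add: proj_def contraction_smul bd_over_UNIV bd.scale chain.scale_right_diff_distrib)

lemma proj_sum:
  assumes "\<And>i. i \<in> X \<Longrightarrow> f i \<in> over UNIV"
  shows "proj (\<Sum>i\<in>X. f i) = (\<Sum>i\<in>X. proj (f i))"
  using assms
proof (induction X rule: infinite_finite_induct)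
  case (insert i X)
  have "(\<Sum>i\<in>X. f i) \<in> over UNIV"
    using insert.prems by (intro chain.subspace_sum[OF subspace_over]) auto
  then show ?case
    using insert by (simp add: proj_add)
qed (simp_all add: proj_def contraction_Wt[OF chain.subspace_0[OF subspace_Wt]] bd.zero)

lemma proj_over:
  assumes "lower \<Delta>" "z \<in> over \<Delta>"
  shows "proj z \<in> over \<Delta>"
  unfolding proj_def using assms contraction_over bd_over
  by (intro chain.subspace_diff[OF subspace_over]) auto

lemma contraction_bd_index_chains:
  assumes "z \<in> index_chains m p"
  shows "contraction (bd z) \<in> index_chains m p"
proof (cases p)
  case 0
  then have "bd z = 0"
    using assms bd_index_chains_0 by blast
  then show ?thesis
    using contraction_Wt[OF chain.subspace_0[OF subspace_Wt]]
      chain.subspace_0[OF subspace_index_chains] by simp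
next
  case (Suc p')
  then show ?thesis
    using assms bd_index_chains contraction_index_chains by blast
qed

lemma proj_index_chains:
  assumes "z \<in> index_chains m p"
  shows "proj z \<in> index_chains m p"
  unfolding proj_def
  by (intro chain.subspace_diff[OF subspace_index_chains] assms bd_index_chains
      contraction_index_chains contraction_bd_index_chains)

text \<open>Since \<open>bd\<close> squares to zero, both sides reduce to
  \<open>bd z - bd (contraction (bd z))\<close>.\<close>

lemma bd_proj: "z \<in> over UNIV \<Longrightarrow> bd (proj z) = proj (bd z)"
  using contraction_Wt[OF chain.subspace_0[OF subspace_Wt]]
  by (simp add: proj_def bd.diff bd_bd_over[of _ UNIV] contraction_over_UNIV)

lemma proj_Wt:
  assumes "z \<in> over UNIV"
  shows "proj z \<in> Wt"
proof -
  have "contraction (bd z) \<in> Wt"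
    using assms contraction bd_over_UNIV Bt_Wt by blast
  then show ?thesis
    unfolding proj_def using assms contraction chain.subspace_diff[OF subspace_Wt] by blast
qed

lemma proj_id: "z \<in> Wt \<Longrightarrow> bd z \<in> Wt \<Longrightarrow> proj z = z"
  by (simp add: proj_def contraction_Wt bd.zero)

text \<open>On B' the map \<open>contraction\<close> vanishes, and it inverts \<open>bd\<close>, so
  what is left is \<open>b - b\<close>. Hence on W the projection depends on the H' part
  alone.\<close>

lemma proj_Bt: "b \<in> Bt \<Longrightarrow> proj b = 0"
  by (simp add: proj_def contraction_Wt Bt_Wt contraction_bd bd.zero)

section \<open>The complex M as the image of the projection\<close>

lemma total_part_eq:
  assumes sub: "\<And>q. q \<in> D \<Longrightarrow> chain.subspace (V q p)"
    and strand: "\<And>q z. q \<in> D \<Longrightarrow> z \<in> V q p \<Longrightarrow> z \<in> strand m L q p"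
  shows "total_part m L V p = {z \<in> index_chains m p. \<forall>q\<in>D. component q p z \<in> V q p}"
proof
  have "chain.subspace {z \<in> index_chains m p. \<forall>q\<in>D. component q p z \<in> V q p}"
    using subspace_index_chains[of m p] sub
    by (auto simp: chain.subspace_def restrict_chain.zero restrict_chain.add restrict_chain.scale)
  moreover have "z \<in> {z \<in> index_chains m p. \<forall>q\<in>D. component q p z \<in> V q p}" if "q \<in> D" "z \<in> V q p" for q z
    using that strand[OF that] strand_index_chains chain.subspace_0[OF sub]
    by (simp add: component_of_strand)
  ultimately show "total_part m L V p \<subseteq> {z \<in> index_chains m p. \<forall>q\<in>D. component q p z \<in> V q p}"
    unfolding total_part_def by (intro chain.span_minimal) blast
next
  show "{z \<in> index_chains m p. \<forall>q\<in>D. component q p z \<in> V q p} \<subseteq> total_part m L V p"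
  proof
    fix z assume z: "z \<in> {z \<in> index_chains m p. \<forall>q\<in>D. component q p z \<in> V q p}"
    have "(\<Sum>q\<in>D. component q p z) \<in> total_part m L V p"
      unfolding total_part_def using z by (intro chain.span_sum chain.span_base) blast
    then show "z \<in> total_part m L V p"
      using z sum_components by simp
  qed
qed

lemma total_Hc:
  "total_part m L Hc p = {z \<in> index_chains m p. \<forall>q\<in>D. component q p z \<in> Hc q p}"
  by (rule total_part_eq[OF decomposition(1) Hc_strand])

lemma total_Bc:
  "total_part m L Bc p = {z \<in> index_chains m p. \<forall>q\<in>D. component q p z \<in> Bc q p}"
  by (rule total_part_eq[OF decomposition(2) Bc_strand])

lemma total_Hc_Wt: "a \<in> total_part m L Hc p \<Longrightarrow> a \<in> Wt"
proof -
  assume a: "a \<in> total_part m L Hc p"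
  have "total_part m L Hc p \<subseteq> Wt"
    unfolding total_part_def by (intro chain.span_minimal subspace_Wt) (use Hc_Wt in blast)
  then show ?thesis
    using a by blast
qed

lemma total_Bc_iff: "b \<in> total_part m L Bc p \<longleftrightarrow> b \<in> Bt \<and> b \<in> index_chains m p"
proof
  assume b: "b \<in> total_part m L Bc p"
  have "component q p' b \<in> Bc q p'" if "q \<in> D" for q p'
  proof (cases "p' = p")
    case True
    then show ?thesis
      using b that by (simp add: total_Bc)
  next
    case False
    then have "component q p' b = 0"
      using b by (intro component_of_index_chains) (simp_all add: total_Bc)
    then show ?thesis
      using chain.subspace_0[OF decomposition(2)[OF that]] by simp
  qed
  then show "b \<in> Bt \<and> b \<in> index_chains m p"
    using b index_chains_over[of b p] by (simp add: total_Bc Bt_def)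
qed (auto simp: total_Bc Bt_def)

lemma sum_all_components:
  assumes "z \<in> over UNIV"
  shows "(\<Sum>p\<le>m. \<Sum>q\<in>D. component q p z) = z"
proof (rule poly_mapping_eqI)
  fix \<sigma>
  have "lookup (\<Sum>p\<le>m. \<Sum>q\<in>D. component q p z) \<sigma> =
      (\<Sum>p\<le>m. if p = card \<sigma> then (\<Sum>q\<in>D. if q = L \<sigma> then lookup z \<sigma> else 0) else 0)"
    unfolding lookup_sum lookup_restrict_chain by (intro sum.cong) (auto intro!: sum.cong)
  also have "\<dots> = lookup z \<sigma>"
  proof (cases "\<sigma> \<in> keys z")
    case True
    then have "\<sigma> \<subseteq> {..<m}"
      using assms by (auto simp: over_def)
    then have "L \<sigma> \<in> D" "card \<sigma> \<le> m"
      using L_in_D card_mono[of "{..<m}" \<sigma>] by auto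
    then show ?thesis
      using finite_D by simp
  qed (simp add: in_keys_iff cong: if_cong)
  finally show "lookup (\<Sum>p\<le>m. \<Sum>q\<in>D. component q p z) \<sigma> = lookup z \<sigma>" .
qed

lemma span_total_parts: "chain.span (\<Union>p. total_part m L Hc p \<union> total_part m L Bc p) = Wt"
proof
  show "chain.span (\<Union>p. total_part m L Hc p \<union> total_part m L Bc p) \<subseteq> Wt"
    by (intro chain.span_minimal subspace_Wt) (auto simp: total_Hc_Wt total_Bc_iff Bt_Wt)
  show "Wt \<subseteq> chain.span (\<Union>p. total_part m L Hc p \<union> total_part m L Bc p)"
  proof
    fix z assume z: "z \<in> Wt"
    have "component q p z \<in> chain.span (\<Union>p. total_part m L Hc p \<union> total_part m L Bc p)" if q: "q \<in> D" for q p
    proof -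
      obtain a b where ab: "a \<in> Hc q p" "b \<in> Bc q p" "component q p z = a + b"
        using z q unfolding Wt_def by blast
      have "a \<in> total_part m L Hc p" "b \<in> total_part m L Bc p"
        unfolding total_part_def using ab q by (auto intro: chain.span_base)
      then have "a \<in> chain.span (\<Union>p. total_part m L Hc p \<union> total_part m L Bc p)"
        "b \<in> chain.span (\<Union>p. total_part m L Hc p \<union> total_part m L Bc p)"
        by (auto intro: chain.span_base)
      then show ?thesis
        unfolding ab(3) by (rule chain.span_add)
    qed
    then have "(\<Sum>p\<le>m. \<Sum>q\<in>D. component q p z) \<in> chain.span (\<Union>p. total_part m L Hc p \<union> total_part m L Bc p)"
      by (intro chain.span_sum)
    then show "z \<in> chain.span (\<Union>p. total_part m L Hc p \<union> total_part m L Bc p)"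
      using sum_all_components[OF Wt_over[OF z]] by simp
  qed
qed

text \<open>For \<open>b\<close> in B' the condition \<open>bd (a + b) \<in> Wt\<close> says that
  \<open>- b\<close> has the defining property of \<open>contraction (bd a)\<close>. As
  \<open>contraction\<close> vanishes at \<open>a\<close>, the sum of \<open>a\<close> and its
  correction is \<open>proj a\<close>.\<close>

lemma correction_eq:
  assumes a: "a \<in> total_part m L Hc p"
  shows "correction m L Hc Bc p a = - contraction (bd a)"
  unfolding correction_def span_total_parts
proof (rule the_equality)
  have a': "a \<in> index_chains m p" "bd a \<in> over UNIV"
    using a index_chains_over bd_over_UNIV by (auto simp: total_Hc)
  have "- contraction (bd a) \<in> Bt" "- contraction (bd a) \<in> index_chains m p"
    using a' contraction contraction_bd_index_chains chain.subspace_neg[OF subspace_Bt]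
      chain.subspace_neg[OF subspace_index_chains] by blast+
  then show "- contraction (bd a) \<in> total_part m L Bc p \<and> bd (a + - contraction (bd a)) \<in> Wt"
    using contraction(2)[OF a'(2)] by (simp add: total_Bc_iff bd.diff)
next
  fix b assume b: "b \<in> total_part m L Bc p \<and> bd (a + b) \<in> Wt"
  have "contraction (bd a) = - b"
  proof (rule contraction_eqI)
    show "- b \<in> Bt"
      using b chain.subspace_neg[OF subspace_Bt] by (simp add: total_Bc_iff)
    show "bd a - bd (- b) \<in> Wt"
      using b by (simp add: bd.add bd.neg)
  qed
  then show "b = - contraction (bd a)"
    by simp
qed

lemma M_complex_eq: "M_complex m L Hc Bc p = proj ` total_part m L Hc p"
proof -
  have "a + correction m L Hc Bc p a = proj a" if "a \<in> total_part m L Hc p" for a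
    using that by (simp add: correction_eq proj_def contraction_Wt total_Hc_Wt bd.zero)
  then show ?thesis
    unfolding M_complex_def Setcompr_eq_image Collect_mem_eq by (rule image_cong[OF refl])
qed

text \<open>Such a \<open>z\<close> is fixed by \<open>proj\<close>, which is additive and kills B',
  so of its strand components only the H' parts survive. Keeping track of \<open>\<Delta>\<close>
  later decides which quotients occur as coefficients.\<close>

lemma split_proj:
  assumes z: "z \<in> index_chains m p" "z \<in> Wt" "bd z \<in> Wt" and \<Delta>: "z \<in> over \<Delta>"
  shows "\<exists>a. (\<forall>q\<in>D \<inter> \<Delta>. a q \<in> Hc q p) \<and> z = (\<Sum>q\<in>D \<inter> \<Delta>. proj (a q))"
proof -
  have "\<forall>q\<in>D. \<exists>x. fst x \<in> Hc q p \<and> snd x \<in> Bc q p \<and> component q p z = fst x + snd x"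
    using z unfolding Wt_def by force
  then obtain f where f: "\<forall>q\<in>D. fst (f q) \<in> Hc q p \<and> snd (f q) \<in> Bc q p \<and>
      component q p z = fst (f q) + snd (f q)"
    by (rule bchoice[THEN exE])
  define a where "a q = fst (f q)" for q
  define b where "b q = snd (f q)" for q
  have ab: "a q \<in> Hc q p" "b q \<in> Bc q p" "component q p z = a q + b q" if "q \<in> D" for q
    using f that by (auto simp: a_def b_def)
  have over: "a q \<in> over UNIV" "b q \<in> over UNIV" if "q \<in> D" for q
    using strand_over_UNIV[OF Hc_strand[OF that ab(1)[OF that]]]
      strand_over_UNIV[OF Bc_strand[OF that ab(2)[OF that]]] by simp_all
  have ab_over: "a q + b q \<in> over UNIV" if "q \<in> D" for q
    by (rule chain.subspace_add[OF subspace_over over[OF that]])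
  have "z = (\<Sum>q\<in>D. component q p z)"
    using sum_components z by simp
  also have "\<dots> = (\<Sum>q\<in>D \<inter> \<Delta>. component q p z)"
    using finite_D component_of_over[OF \<Delta>] by (intro sum.mono_neutral_right) auto
  also have "\<dots> = (\<Sum>q\<in>D \<inter> \<Delta>. a q + b q)"
    using ab by (intro sum.cong) auto
  finally have "proj z = (\<Sum>q\<in>D \<inter> \<Delta>. proj (a q + b q))"
    using proj_sum[of "D \<inter> \<Delta>" "\<lambda>q. a q + b q"] ab_over by simp
  also have "\<dots> = (\<Sum>q\<in>D \<inter> \<Delta>. proj (a q))"
  proof (rule sum.cong)
    fix q assume "q \<in> D \<inter> \<Delta>"
    then have "q \<in> D" by blast
    then show "proj (a q + b q) = proj (a q)"
      using over proj_Bt[OF Bc_Bt[OF _ ab(2)]] by (simp add: proj_add)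
  qed simp
  finally have "z = (\<Sum>q\<in>D \<inter> \<Delta>. proj (a q))"
    using z by (simp add: proj_id)
  then show ?thesis
    using ab(1) by (intro exI[of _ a] conjI ballI) simp_all
qed

text \<open>Thus M is the largest subcomplex inside W, a description that makes stability under
  \<open>bd\<close> and invariance under \<open>proj\<close> immediate.\<close>

lemma M_complex_iff:
  "z \<in> M_complex m L Hc Bc p \<longleftrightarrow> z \<in> index_chains m p \<and> z \<in> Wt \<and> bd z \<in> Wt"
proof
  assume "z \<in> M_complex m L Hc Bc p"
  then obtain a where a: "a \<in> index_chains m p" "z = proj a"
    unfolding M_complex_eq total_Hc by blast
  then show "z \<in> index_chains m p \<and> z \<in> Wt \<and> bd z \<in> Wt"
    using proj_index_chains[of a] proj_Wt bd_proj[of a] index_chains_over[of a] bd_over_UNIV[of a] by simp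
next
  assume z: "z \<in> index_chains m p \<and> z \<in> Wt \<and> bd z \<in> Wt"
  then obtain a where a: "\<forall>q\<in>D \<inter> UNIV. a q \<in> Hc q p" "z = (\<Sum>q\<in>D \<inter> UNIV. proj (a q))"
    using split_proj index_chains_over by blast
  have "(\<Sum>q\<in>D. a q) \<in> total_part m L Hc p"
    unfolding total_part_def using a by (intro chain.span_sum chain.span_base) auto
  moreover have "a q \<in> over UNIV" if "q \<in> D" for q
    by (rule strand_over_UNIV[OF Hc_strand[OF that, of _ p]]) (use a(1) that in simp)
  then have "z = proj (\<Sum>q\<in>D. a q)"
    using a(2) by (subst proj_sum) auto
  ultimately show "z \<in> M_complex m L Hc Bc p"
    unfolding M_complex_eq by blast
qed

lemma proj_M_complex:
  assumes "z \<in> index_chains m p"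
  shows "proj z \<in> M_complex m L Hc Bc p"
  using assms proj_index_chains[OF assms] proj_Wt bd_proj[of z] index_chains_over[OF assms]
    bd_over_UNIV[of z] by (simp add: M_complex_iff)

lemma M_complex_proj: "z \<in> M_complex m L Hc Bc p \<Longrightarrow> proj z = z"
  by (simp add: M_complex_iff proj_id)

lemma bd_M_complex: "z \<in> M_complex m L Hc Bc (Suc p) \<Longrightarrow> bd z \<in> M_complex m L Hc Bc p"
  using bd_index_chains[of z m p] index_chains_over[of z "Suc p"] chain.subspace_0[OF subspace_Wt]
  by (simp add: M_complex_iff bd_bd_over)

text \<open>As \<open>a\<close> is a cycle of its strand, the part of \<open>bd a\<close> with label
  \<open>q\<close> vanishes. This is the source of minimality.\<close>

lemma bd_Hc:
  assumes "q \<in> D" "a \<in> Hc q p"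
  shows "bd a \<in> over {r. r dvd q \<and> r \<noteq> q}"
proof -
  have "a \<in> over {r. r dvd q}"
    using strand_over[OF Hc_strand[OF assms]] over_mono[of "{q}" "{r. r dvd q}"] by auto
  then have "bd a \<in> over {r. r dvd q}"
    by (rule bd_over[OF lower_dvd])
  moreover have "L \<sigma> \<noteq> q" if "\<sigma> \<in> keys (bd a)" for \<sigma>
  proof
    assume "L \<sigma> = q"
    then have "lookup (strand_bd L q a) \<sigma> = lookup (bd a) \<sigma>"
      by (simp add: strand_bd_def strand_proj_eq lookup_restrict_chain)
    then show False
      using Hc_cycles[OF assms] that by (simp add: strand_cycles_def in_keys_iff)
  qed
  ultimately show ?thesis
    by (auto simp: over_def)
qed

text \<open>This makes \<open>a\<close> the leading term of \<open>proj a\<close>: the difference is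
  \<open>- contraction (bd a)\<close>, and \<open>contraction\<close> keeps it over the proper
  divisors of \<open>q\<close>.\<close>

lemma proj_Hc:
  assumes "q \<in> D" "a \<in> Hc q p"
  shows "proj a - a \<in> over {r. r dvd q \<and> r \<noteq> q}" "proj a \<in> over {r. r dvd q}"
proof -
  have "proj a - a = - contraction (bd a)"
    using Hc_Wt[OF assms] by (simp add: proj_def contraction_Wt bd.zero)
  moreover have "contraction (bd a) \<in> over {r. r dvd q \<and> r \<noteq> q}"
    using contraction_over[OF lower_strict bd_Hc] assms by blast
  ultimately show "proj a - a \<in> over {r. r dvd q \<and> r \<noteq> q}"
    using chain.subspace_neg[OF subspace_over] by simp
  have "a \<in> over {r. r dvd q}"
    using strand_over[OF Hc_strand[OF assms]] over_mono[of "{q}" "{r. r dvd q}"] by auto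
  then show "proj a \<in> over {r. r dvd q}"
    by (rule proj_over[OF lower_dvd])
qed

end

section \<open>Homogenization\<close>

interpretation chain_space: vector_space "smul :: 'a::field \<Rightarrow> (nat set \<Rightarrow>\<^sub>0 'a) \<Rightarrow> _"
  by unfold_locales (simp_all add: chain.scale_right_distrib chain.scale_left_distrib)

lemma lookup_mconst_mult: "lookup (mconst c * p) t = c * lookup p t"
  unfolding mconst_def mult_map_scale_conv_mult[symmetric]
  by (simp add: Poly_Mapping.map.rep_eq when_def)

lemma mconst_0 [simp]: "mconst 0 = 0"
  by (simp add: mconst_def)

lemma mconst_1 [simp]: "mconst 1 = 1"
  by (simp add: mconst_def)

lemma mconst_add: "mconst (a + b) = mconst a + mconst b"
  by (simp add: mconst_def single_add)

lemma mconst_mult: "mconst (a * b) = mconst a * mconst b"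
  by (simp add: mconst_def mult_single)

lemma mconst_sign: "mconst ((-1) ^ k * c) = (-1) ^ k * mconst c"
  by (induction k) (simp_all add: mconst_def single_uminus)

lemma exact_quotient_self: "a \<noteq> 0 \<Longrightarrow> exact_quotient a a = (1 :: 'a::idom)"
  using exact_quotient_mult_left[of a 1] by simp

lemma exact_quotient_trans:
  fixes a b c :: "'a::idom"
  assumes "a dvd b" "b dvd c" "c \<noteq> 0"
  shows "exact_quotient b a * exact_quotient c b = exact_quotient c a"
proof -
  obtain x y where xy: "b = a * x" "c = b * y"
    using assms(1,2) unfolding dvd_def by blast
  have nz: "a \<noteq> 0" "b \<noteq> 0"
    using xy assms(3) by auto
  have "exact_quotient b a = x" "exact_quotient c b = y"
    using exact_quotient_mult_left[OF nz(1), of x] exact_quotient_mult_left[OF nz(2), of y]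
    by (simp_all only: xy)
  moreover have "exact_quotient c a = x * y"
    using exact_quotient_mult_left[OF nz(1), of "x * y"] by (simp only: xy mult.assoc)
  ultimately show ?thesis by simp
qed

lemma lookup_homogenize:
  "lookup (homogenize L q z) \<sigma> = mconst (lookup z \<sigma>) * exact_quotient q (L \<sigma>)"
  by (simp add: homogenize_def lookup_mapp when_def in_keys_iff)

lemma homogenize_add: "homogenize L q (x + y) = homogenize L q x + homogenize L q y"
  by (rule poly_mapping_eqI) (simp add: lookup_homogenize lookup_add mconst_add distrib_right)

lemma homogenize_0 [simp]: "homogenize L q 0 = 0"
  by (rule poly_mapping_eqI) (simp add: lookup_homogenize)

lemma homogenize_sum: "homogenize L q (\<Sum>i\<in>X. f i) = (\<Sum>i\<in>X. homogenize L q (f i))"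
  by (induction X rule: infinite_finite_induct) (simp_all add: homogenize_add)

lemma homogenize_smul: "homogenize L q (smul c z) = smul (mconst c) (homogenize L q z)"
  by (rule poly_mapping_eqI) (simp only: lookup_homogenize lookup_smul mconst_mult mult.assoc)

lemma homogenize_single:
  "homogenize L q (Poly_Mapping.single \<sigma> c) = Poly_Mapping.single \<sigma> (mconst c * exact_quotient q (L \<sigma>))"
  by (rule poly_mapping_eqI) (simp add: lookup_homogenize lookup_single when_def)

lemma keys_homogenize: "keys (homogenize L q z) \<subseteq> keys z"
  by (auto simp: in_keys_iff lookup_homogenize)

lemma homogenize_index_chains: "z \<in> index_chains m p \<Longrightarrow> homogenize L q z \<in> index_chains m p"
  using keys_homogenize[of L q z] by (auto simp: index_chains_def)

text \<open>For a chain that already lives below \<open>r\<close>, homogenizing at a multiple of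
  \<open>r\<close> gives nothing new over S. The factor q / r is the coefficient on which minimality
  depends.\<close>

lemma homogenize_rescale:
  fixes L :: "nat set \<Rightarrow> ('n::{finite,linorder}, 'k::field) mpoly"
  assumes "\<And>\<sigma>. \<sigma> \<in> keys z \<Longrightarrow> L \<sigma> dvd r" "r dvd q" "q \<noteq> 0"
  shows "homogenize L q z = smul (exact_quotient q r) (homogenize L r z)"
proof (rule poly_mapping_eqI)
  fix \<sigma>
  show "lookup (homogenize L q z) \<sigma> = lookup (smul (exact_quotient q r) (homogenize L r z)) \<sigma>"
  proof (cases "\<sigma> \<in> keys z")
    case True
    then have "exact_quotient q (L \<sigma>) = exact_quotient r (L \<sigma>) * exact_quotient q r"
      using exact_quotient_trans[of "L \<sigma>" r q] assms by simp
    then show ?thesis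
      by (simp only: lookup_homogenize lookup_smul) (simp only: mult.assoc mult.commute mult.left_commute)
  qed (simp add: lookup_homogenize lookup_smul in_keys_iff)
qed

lemma homogenize_eq_0_imp:
  fixes L :: "nat set \<Rightarrow> ('n::{finite,linorder}, 'k::field) mpoly"
  assumes "homogenize L q z = 0" "q \<noteq> 0" "\<And>\<sigma>. \<sigma> \<in> keys z \<Longrightarrow> L \<sigma> dvd q"
  shows "z = 0"
proof (rule ccontr)
  assume "z \<noteq> 0"
  then obtain \<sigma> where \<sigma>: "\<sigma> \<in> keys z"
    by (metis lookup_zero not_in_keys_iff_lookup_eq_zero poly_mapping_eqI)
  have "mconst (lookup z \<sigma>) * exact_quotient q (L \<sigma>) = 0"
    using assms(1) lookup_homogenize by (metis lookup_zero)
  moreover have "exact_quotient q (L \<sigma>) \<noteq> 0"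
    using exact_quotient_mult[of "L \<sigma>" q] assms(2,3) \<sigma> by fastforce
  moreover have "mconst (lookup z \<sigma>) \<noteq> (0 :: ('n, 'k) mpoly)"
    using \<sigma> by (metis in_keys_iff lookup_single_eq lookup_zero mconst_def)
  ultimately show False
    by simp
qed

section \<open>Comparison of the two differentials\<close>

lemma taylor_bd_single:
  "taylor_bd L (Poly_Mapping.single \<tau> c) = (\<Sum>i\<in>\<tau>. Poly_Mapping.single (\<tau> - {i})
     ((-1) ^ eps \<tau> i * exact_quotient (L \<tau>) (L (\<tau> - {i})) * c))"
  by (simp add: taylor_bd_def)

lemma taylor_homogeneous_homogenize:
  fixes L :: "nat set \<Rightarrow> ('n::{finite,linorder}, 'k::field) mpoly"
  assumes "homogeneous_of_degree e q" "q \<noteq> 0" "\<And>\<sigma>. \<sigma> \<in> keys z \<Longrightarrow> L \<sigma> dvd q"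
  shows "taylor_homogeneous L e (homogenize L q z)"
  unfolding taylor_homogeneous_def
proof
  fix \<sigma> assume "\<sigma> \<in> keys (homogenize L q z)"
  then have "L \<sigma> dvd q"
    using keys_homogenize assms by blast
  then have "L \<sigma> * exact_quotient q (L \<sigma>) = q"
    using assms by (intro exact_quotient_mult) auto
  then have "L \<sigma> * lookup (homogenize L q z) \<sigma> = mconst (lookup z \<sigma>) * q"
    by (metis lookup_homogenize mult.left_commute)
  then show "homogeneous_of_degree e (L \<sigma> * lookup (homogenize L q z) \<sigma>)"
    using assms(1) by (auto simp: homogeneous_of_degree_def in_keys_iff lookup_mconst_mult)
qed

locale taylor_resolution =
  fixes m :: nat and L :: "nat set \<Rightarrow> ('n::{finite,linorder}, 'k::field) mpoly"
    and I :: "('n, 'k) mpoly set"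
  assumes L_mono: "\<sigma> \<subseteq> \<tau> \<Longrightarrow> \<tau> \<subseteq> {..<m} \<Longrightarrow> L \<sigma> dvd L \<tau>"
    and L_nonzero: "\<sigma> \<subseteq> {..<m} \<Longrightarrow> L \<sigma> \<noteq> 0"
    and resolution:
      "graded_free_resolution (taylor_homogeneous L) (index_chains m) (taylor_bd L) augmentation I"
begin

lemma taylor_hom: "module_hom smul smul (taylor_bd L)" "module_hom smul (*) (augmentation :: _ \<Rightarrow> ('n, 'k) mpoly)"
  using resolution by (simp_all add: graded_free_resolution_def)

sublocale taylor: module_hom smul smul "taylor_bd L"
  by (rule taylor_hom)

text \<open>The quotients telescope: the one from \<open>L \<tau>\<close> to the lcm of a face,
  times the one from \<open>q\<close> to \<open>L \<tau>\<close>, is the one from \<open>q\<close>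
  to the lcm of the face. The factor attached to a face is thus independent of
  \<open>\<tau>\<close>.\<close>

lemma taylor_bd_homogenize:
  assumes "\<And>\<sigma>. \<sigma> \<in> keys z \<Longrightarrow> \<sigma> \<subseteq> {..<m} \<and> L \<sigma> dvd q" "q \<noteq> 0"
  shows "taylor_bd L (homogenize L q z) = homogenize L q (bd z)"
proof -
  have "taylor_bd L (homogenize L q (Poly_Mapping.single \<tau> c)) = homogenize L q (bd (Poly_Mapping.single \<tau> c))"
    if \<tau>: "\<tau> \<in> keys z" for \<tau> c
  proof -
    have "Poly_Mapping.single (\<tau> - {i}) ((-1) ^ eps \<tau> i * exact_quotient (L \<tau>) (L (\<tau> - {i})) *
          (mconst c * exact_quotient q (L \<tau>))) =
        homogenize L q (Poly_Mapping.single (\<tau> - {i}) ((-1) ^ eps \<tau> i * c))" for i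
    proof -
      have "exact_quotient (L \<tau>) (L (\<tau> - {i})) * exact_quotient q (L \<tau>) = exact_quotient q (L (\<tau> - {i}))"
        using assms \<tau> L_mono[of "\<tau> - {i}" \<tau>] by (intro exact_quotient_trans) auto
      then show ?thesis
        unfolding homogenize_single mconst_sign by (simp only: mult.assoc mult.left_commute[of _ "mconst c"])
    qed
    then show ?thesis
      unfolding homogenize_single[of _ _ \<tau>] taylor_bd_single bd_single homogenize_sum by (intro sum.cong) auto
  qed
  then have "(\<Sum>\<tau>\<in>keys z. taylor_bd L (homogenize L q (Poly_Mapping.single \<tau> (lookup z \<tau>)))) =
      (\<Sum>\<tau>\<in>keys z. homogenize L q (bd (Poly_Mapping.single \<tau> (lookup z \<tau>))))"
    by (intro sum.cong) auto
  then show ?thesis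
    by (simp only: flip: taylor.sum homogenize_sum bd.sum poly_mapping_sum_single)
qed

text \<open>Instead of cancelling signs, chains are homogenized at the lcm of all generators. This
  map is injective and turns \<open>bd\<close> into \<open>taylor_bd\<close>, whose square vanishes
  by exactness of the Taylor complex.\<close>

lemma bd_bd_zero:
  assumes "keys z \<subseteq> Pow {..<m}"
  shows "bd (bd z) = (0 :: nat set \<Rightarrow>\<^sub>0 'k)"
proof -
  have "bd (bd (Poly_Mapping.single \<sigma> c)) = (0 :: nat set \<Rightarrow>\<^sub>0 'k)" if \<sigma>: "\<sigma> \<subseteq> {..<m}" for \<sigma> c
  proof -
    let ?z = "Poly_Mapping.single \<sigma> c :: nat set \<Rightarrow>\<^sub>0 'k"
    have z: "?z \<in> index_chains m (card \<sigma>)"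
      using \<sigma> by (simp add: index_chains_def)
    \<comment> \<open>The resolution hypothesis gives a vanishing square from degree 2 on; below
      that, \<open>bd\<close> ends on the empty set, which has no boundary.\<close>
    consider "card \<sigma> = 0" | "card \<sigma> = 1" | p where "card \<sigma> = Suc (Suc p)"
      by (metis One_nat_def not0_implies_Suc)
    then show ?thesis
    proof cases
      case 1
      then show ?thesis
        using z bd_index_chains_0[of ?z m] by (simp add: bd.zero)
    next
      case 2
      then have "bd ?z \<in> index_chains m 0"
        using z by (intro bd_index_chains) simp
      then show ?thesis
        by (rule bd_index_chains_0)
    next
      case 3
      let ?q = "L {..<m}"
      have q: "?q \<noteq> 0"
        using L_nonzero by simp
      have dvd: "\<tau> \<subseteq> {..<m} \<and> L \<tau> dvd ?q" if "w \<in> index_chains m k" "\<tau> \<in> keys w" for w :: "nat set \<Rightarrow>\<^sub>0 'k" and k \<tau>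
        using that L_mono[of \<tau> "{..<m}"] by (auto simp: index_chains_def)
      have b1: "bd ?z \<in> index_chains m (Suc p)"
        using z 3 by (intro bd_index_chains) simp
      then have b2: "bd (bd ?z) \<in> index_chains m p"
        by (rule bd_index_chains)
      have "homogenize L ?q (bd (bd ?z)) = taylor_bd L (taylor_bd L (homogenize L ?q ?z))"
        using taylor_bd_homogenize[of ?z ?q] taylor_bd_homogenize[of "bd ?z" ?q] dvd[OF z] dvd[OF b1] q
        by simp
      also have "taylor_bd L (homogenize L ?q ?z) \<in> taylor_bd L ` index_chains m (Suc (Suc p))"
        using homogenize_index_chains[OF z, of L ?q] 3 by simp
      then have "taylor_bd L (taylor_bd L (homogenize L ?q ?z)) = 0"
        using resolution unfolding graded_free_resolution_def by blast
      finally show ?thesis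
        using dvd[OF b2] q by (intro homogenize_eq_0_imp[of L ?q]) auto
    qed
  qed
  then have "(\<Sum>\<sigma>\<in>keys z. bd (bd (Poly_Mapping.single \<sigma> (lookup z \<sigma>)))) = (0 :: nat set \<Rightarrow>\<^sub>0 'k)"
    using assms by (intro sum.neutral) auto
  then show ?thesis
    by (simp only: flip: bd.sum poly_mapping_sum_single)
qed

end

section \<open>The projection onto the Taylor subcomplex\<close>

locale minimal_taylor = taylor_resolution m L I + lcm_strands m L Hc Bc
  for m :: nat and L :: "nat set \<Rightarrow> ('n::{finite,linorder}, 'k::field) mpoly"
    and I :: "('n, 'k) mpoly set"
    and Hc Bc :: "('n, 'k) mpoly \<Rightarrow> nat \<Rightarrow> (nat set \<Rightarrow>\<^sub>0 'k) set" +
  assumes L_homogeneous: "\<sigma> \<subseteq> {..<m} \<Longrightarrow> homogeneous (L \<sigma>)"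
    and quotient_irrelevant: "q \<in> lcm_lattice m L \<Longrightarrow> r \<in> lcm_lattice m L \<Longrightarrow> r dvd q \<Longrightarrow> r \<noteq> q \<Longrightarrow>
      exact_quotient q r \<in> irrelevant_ideal"
begin

abbreviation below :: "('n, 'k) mpoly \<Rightarrow> (nat set \<Rightarrow>\<^sub>0 'k) set" where
  "below q \<equiv> over {r. r dvd q}"

abbreviation N :: "nat \<Rightarrow> (nat set \<Rightarrow>\<^sub>0 ('n, 'k) mpoly) set" where
  "N \<equiv> M_tilde m L Hc Bc"

lemma D_nonzero: "q \<in> D \<Longrightarrow> q \<noteq> 0"
  using L_nonzero by (auto simp: lcm_lattice_def)

lemma below_dvd: "z \<in> below q \<Longrightarrow> \<sigma> \<in> keys z \<Longrightarrow> L \<sigma> dvd q"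
  by (auto simp: over_def)

lemma below_subset: "z \<in> below q \<Longrightarrow> \<sigma> \<in> keys z \<Longrightarrow> \<sigma> \<subseteq> {..<m}"
  by (auto simp: over_def)

lemma taylor_bd_below: "z \<in> below q \<Longrightarrow> q \<noteq> 0 \<Longrightarrow> taylor_bd L (homogenize L q z) = homogenize L q (bd z)"
  by (rule taylor_bd_homogenize) (auto simp: over_def)

lemma N_base: "q \<in> D \<Longrightarrow> z \<in> M_complex m L Hc Bc p \<Longrightarrow> z \<in> below q \<Longrightarrow> homogenize L q z \<in> N p"
  unfolding M_tilde_def by (rule chain.span_base) (auto simp: over_def)

lemma N_induct [consumes 1, case_names base subspace]:
  assumes "w \<in> N p"
    and "\<And>q z. q \<in> D \<Longrightarrow> z \<in> M_complex m L Hc Bc p \<Longrightarrow> z \<in> below q \<Longrightarrow> homogenize L q z \<in> S"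
    and "chain.subspace S"
  shows "w \<in> S"
proof -
  have "z \<in> over UNIV" if "z \<in> M_complex m L Hc Bc p" for z
    using that M_complex_iff index_chains_over by blast
  then have "z \<in> below q" if "z \<in> M_complex m L Hc Bc p" "\<forall>\<sigma>\<in>keys z. L \<sigma> dvd q" for z q
    using that over_iff[of z "{r. r dvd q}"] by simp
  then have "{homogenize L q z |q z. q \<in> D \<and> z \<in> M_complex m L Hc Bc p \<and> (\<forall>\<sigma>\<in>keys z. L \<sigma> dvd q)} \<subseteq> S"
    using assms(2) by auto
  then have "N p \<subseteq> S"
    unfolding M_tilde_def using assms(3) by (rule chain.span_minimal)
  then show ?thesis
    using assms(1) by blast
qed

lemma subspace_N: "chain.subspace (N p)"
  unfolding M_tilde_def by (rule chain.subspace_span)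

lemma N_index_chains: "w \<in> N p \<Longrightarrow> w \<in> index_chains m p"
  by (induction rule: N_induct) (auto simp: M_complex_iff subspace_index_chains intro: homogenize_index_chains)

text \<open>The S-linear extension of \<open>proj\<close>: the basis element \<open>\<sigma>\<close>
  has multidegree \<open>L \<sigma>\<close>, and its image is homogenized there. The quotients exist
  because \<open>proj\<close> keeps \<open>\<sigma>\<close> over the divisors of
  \<open>L \<sigma>\<close>.\<close>

definition taylor_proj :: "(nat set \<Rightarrow>\<^sub>0 ('n, 'k) mpoly) \<Rightarrow> (nat set \<Rightarrow>\<^sub>0 ('n, 'k) mpoly)" where
  "taylor_proj z =
     (\<Sum>\<sigma>\<in>Pow {..<m}. smul (lookup z \<sigma>) (homogenize L (L \<sigma>) (proj (Poly_Mapping.single \<sigma> 1))))"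

sublocale taylor_proj: module_hom smul smul taylor_proj
  by unfold_locales
    (simp_all add: taylor_proj_def lookup_add lookup_smul chain.scale_left_distrib sum.distrib
      chain.scale_sum_right)

lemma taylor_proj_single:
  assumes "\<sigma> \<subseteq> {..<m}"
  shows "taylor_proj (Poly_Mapping.single \<sigma> s) =
    smul s (homogenize L (L \<sigma>) (proj (Poly_Mapping.single \<sigma> 1)))"
proof -
  have "taylor_proj (Poly_Mapping.single \<sigma> s) =
      (\<Sum>\<tau>\<in>Pow {..<m}. if \<tau> = \<sigma> then smul s (homogenize L (L \<sigma>) (proj (Poly_Mapping.single \<sigma> 1))) else 0)"
    unfolding taylor_proj_def by (intro sum.cong) (auto simp: lookup_single_not_eq)
  then show ?thesis
    using assms by simp
qed

lemma single_below: "\<sigma> \<subseteq> {..<m} \<Longrightarrow> L \<sigma> dvd q \<Longrightarrow> Poly_Mapping.single \<sigma> c \<in> below q"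
  by (simp add: over_def)

text \<open>By linearity a single \<open>\<sigma>\<close> suffices. Its coefficient in
  \<open>homogenize L q\<close>, the quotient of \<open>q\<close> by \<open>L \<sigma>\<close>, is
  also the factor between homogenizing its projection at \<open>L \<sigma>\<close> and at
  \<open>q\<close>.\<close>

lemma taylor_proj_homogenize:
  assumes "z \<in> below q" "q \<noteq> 0"
  shows "taylor_proj (homogenize L q z) = homogenize L q (proj z)"
proof -
  have single: "taylor_proj (homogenize L q (Poly_Mapping.single \<sigma> c)) = homogenize L q (proj (Poly_Mapping.single \<sigma> c))"
    if \<sigma>: "\<sigma> \<in> keys z" for \<sigma> c
  proof -
    have sub: "\<sigma> \<subseteq> {..<m}" "L \<sigma> dvd q"
      using assms \<sigma> by (auto simp: over_def)
    let ?u = "Poly_Mapping.single \<sigma> 1 :: nat set \<Rightarrow>\<^sub>0 'k"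
    have u: "?u \<in> over UNIV"
      using sub by (simp add: over_def)
    have "proj ?u \<in> below (L \<sigma>)"
      using proj_over[OF lower_dvd single_below[OF sub(1) dvd_refl]] .
    then have "homogenize L q (proj ?u) = smul (exact_quotient q (L \<sigma>)) (homogenize L (L \<sigma>) (proj ?u))"
      using sub assms(2) below_dvd by (intro homogenize_rescale) auto
    then have "taylor_proj (homogenize L q (Poly_Mapping.single \<sigma> c)) = smul (mconst c) (homogenize L q (proj ?u))"
      using sub by (simp add: homogenize_single taylor_proj_single)
    also have "\<dots> = homogenize L q (proj (smul c ?u))"
      using u by (simp add: proj_smul homogenize_smul)
    finally show ?thesis
      by (simp add: smul_single)
  qed
  have over: "Poly_Mapping.single \<sigma> c \<in> over UNIV" if "\<sigma> \<in> keys z" for \<sigma> c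
    using that below_subset[OF assms(1)] by (simp add: over_def)
  have "taylor_proj (homogenize L q (\<Sum>\<sigma>\<in>keys z. Poly_Mapping.single \<sigma> (lookup z \<sigma>))) =
      homogenize L q (proj (\<Sum>\<sigma>\<in>keys z. Poly_Mapping.single \<sigma> (lookup z \<sigma>)))"
    using single over by (simp add: homogenize_sum taylor_proj.sum proj_sum)
  then show ?thesis
    by (simp only: flip: poly_mapping_sum_single)
qed

lemma taylor_proj_N: "w \<in> N p \<Longrightarrow> taylor_proj w = w"
proof -
  have "chain.subspace {w. taylor_proj w = w}"
    by (auto simp: chain.subspace_def taylor_proj.add taylor_proj.scale taylor_proj.zero)
  moreover assume "w \<in> N p"
  ultimately have "w \<in> {w. taylor_proj w = w}"
    by (elim N_induct) (auto simp: taylor_proj_homogenize D_nonzero M_complex_proj)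
  then show ?thesis by simp
qed

lemma index_chains_induct:
  fixes S :: "(nat set \<Rightarrow>\<^sub>0 'r::comm_ring_1) set"
  assumes "w \<in> index_chains m p" "chain.subspace S"
    and "\<And>\<sigma>. \<sigma> \<subseteq> {..<m} \<Longrightarrow> card \<sigma> = p \<Longrightarrow> Poly_Mapping.single \<sigma> 1 \<in> S"
  shows "w \<in> S"
proof -
  have "smul (lookup w \<sigma>) (Poly_Mapping.single \<sigma> 1) \<in> S" if "\<sigma> \<in> keys w" for \<sigma>
    using assms that by (intro chain.subspace_scale[OF assms(2)] assms(3)) (auto simp: index_chains_def)
  then have "(\<Sum>\<sigma>\<in>keys w. Poly_Mapping.single \<sigma> (lookup w \<sigma>)) \<in> S"
    by (intro chain.subspace_sum[OF assms(2)]) (simp add: smul_single)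
  then show ?thesis
    by (simp only: flip: poly_mapping_sum_single)
qed

lemma single_eq_homogenize:
  "\<sigma> \<subseteq> {..<m} \<Longrightarrow> homogenize L (L \<sigma>) (Poly_Mapping.single \<sigma> 1) = Poly_Mapping.single \<sigma> 1"
  by (simp add: homogenize_single exact_quotient_self L_nonzero)

lemma taylor_proj_in_N: "w \<in> index_chains m p \<Longrightarrow> taylor_proj w \<in> N p"
proof -
  have "chain.subspace {w. taylor_proj w \<in> N p}"
    using subspace_N[of p]
    by (auto simp: chain.subspace_def taylor_proj.add taylor_proj.scale taylor_proj.zero)
  moreover have "taylor_proj (Poly_Mapping.single \<sigma> 1) \<in> N p" if \<sigma>: "\<sigma> \<subseteq> {..<m}" "card \<sigma> = p" for \<sigma>
  proof -
    have "proj (Poly_Mapping.single \<sigma> 1) \<in> M_complex m L Hc Bc p"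
      using \<sigma> by (intro proj_M_complex) (simp add: index_chains_def)
    then show ?thesis
      using \<sigma> proj_over[OF lower_dvd single_below[OF \<sigma>(1) dvd_refl]] L_in_D[OF \<sigma>(1)]
      by (simp add: taylor_proj_single N_base)
  qed
  moreover assume "w \<in> index_chains m p"
  ultimately have "w \<in> {w. taylor_proj w \<in> N p}"
    using index_chains_induct by blast
  then show ?thesis by simp
qed

text \<open>A basis element is its own homogenization at \<open>L \<sigma>\<close>, so this is
  \<open>bd_proj\<close> seen through \<open>homogenize\<close>.\<close>

lemma taylor_proj_taylor_bd:
  assumes "w \<in> index_chains m p"
  shows "taylor_proj (taylor_bd L w) = taylor_bd L (taylor_proj w)"
proof -
  have "chain.subspace {w. taylor_proj (taylor_bd L w) = taylor_bd L (taylor_proj w)}"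
    by (auto simp: chain.subspace_def taylor_proj.add taylor_proj.scale taylor_proj.zero
        taylor.add taylor.scale taylor.zero)
  moreover have "taylor_proj (taylor_bd L (Poly_Mapping.single \<sigma> 1)) = taylor_bd L (taylor_proj (Poly_Mapping.single \<sigma> 1))"
    if \<sigma>: "\<sigma> \<subseteq> {..<m}" for \<sigma>
  proof -
    let ?u = "Poly_Mapping.single \<sigma> 1 :: nat set \<Rightarrow>\<^sub>0 'k"
    have u: "?u \<in> below (L \<sigma>)" "L \<sigma> \<noteq> 0"
      using single_below[OF \<sigma> dvd_refl] L_nonzero[OF \<sigma>] by auto
    have "taylor_proj (taylor_bd L (homogenize L (L \<sigma>) ?u)) = taylor_bd L (taylor_proj (homogenize L (L \<sigma>) ?u))"
      using u bd_over[OF lower_dvd u(1)] proj_over[OF lower_dvd u(1)] over_UNIV[OF u(1)]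
      by (simp add: taylor_bd_below taylor_proj_homogenize bd_proj)
    then show ?thesis
      using single_eq_homogenize[OF \<sigma>] by simp
  qed
  ultimately have "w \<in> {w. taylor_proj (taylor_bd L w) = taylor_bd L (taylor_proj w)}"
    using assms index_chains_induct by blast
  then show ?thesis by simp
qed

lemma taylor_bd_N: "w \<in> N (Suc p) \<Longrightarrow> taylor_bd L w \<in> N p"
proof -
  have "chain.subspace {w. taylor_bd L w \<in> N p}"
    using subspace_N[of p]
    by (auto simp: chain.subspace_def taylor.add taylor.scale taylor.zero)
  moreover assume "w \<in> N (Suc p)"
  ultimately have "w \<in> {w. taylor_bd L w \<in> N p}"
    by (elim N_induct) (auto simp: taylor_bd_below D_nonzero intro!: N_base bd_M_complex bd_over[OF lower_dvd])
  then show ?thesis by simp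
qed

text \<open>Combines \<open>split_proj\<close> with \<open>homogenize_rescale\<close>. Taken with
  all divisors of \<open>q\<close> it gives generation; taken with the proper divisors it gives
  minimality.\<close>

lemma homogenize_proj_split:
  assumes "q \<in> D" "z \<in> M_complex m L Hc Bc p" "z \<in> over \<Delta>" "\<Delta> \<subseteq> {r. r dvd q}"
  shows "\<exists>a. (\<forall>r\<in>D \<inter> \<Delta>. a r \<in> Hc r p) \<and>
    homogenize L q z = (\<Sum>r\<in>D \<inter> \<Delta>. smul (exact_quotient q r) (homogenize L r (proj (a r))))"
proof -
  obtain a where a: "\<forall>r\<in>D \<inter> \<Delta>. a r \<in> Hc r p" "z = (\<Sum>r\<in>D \<inter> \<Delta>. proj (a r))"
    using split_proj[of z p \<Delta>] assms M_complex_iff[of z p] by metis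
  have "homogenize L q (proj (a r)) = smul (exact_quotient q r) (homogenize L r (proj (a r)))"
    if r: "r \<in> D \<inter> \<Delta>" for r
  proof (rule homogenize_rescale)
    have "proj (a r) \<in> below r"
      using r a by (intro proj_Hc(2)) auto
    then show "L \<sigma> dvd r" if "\<sigma> \<in> keys (proj (a r))" for \<sigma>
      using that below_dvd by blast
  qed (use r assms D_nonzero in auto)
  then have "homogenize L q z = (\<Sum>r\<in>D \<inter> \<Delta>. smul (exact_quotient q r) (homogenize L r (proj (a r))))"
    unfolding a(2) homogenize_sum by (intro sum.cong) auto
  then show ?thesis
    using a(1) by blast
qed

lemma proj_Hc_N: "q \<in> D \<Longrightarrow> a \<in> Hc q p \<Longrightarrow> homogenize L q (proj a) \<in> N p"
  using N_base proj_M_complex[OF strand_index_chains[OF Hc_strand]] proj_Hc(2) by blast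

lemma taylor_bd_N_irrelevant:
  assumes "w \<in> N (Suc p)"
  shows "taylor_bd L w \<in> chain.span {smul s z |s z. s \<in> irrelevant_ideal \<and> z \<in> N p}" (is "_ \<in> ?T")
proof -
  have irr: "taylor_bd L (homogenize L q (proj a)) \<in> ?T" if qa: "q \<in> D" "a \<in> Hc q (Suc p)" for q a
  proof -
    let ?\<Delta> = "{r. r dvd q \<and> r \<noteq> q}"
    have a: "a \<in> over UNIV" "bd a \<in> index_chains m p"
      using Hc_strand[OF qa] strand_over_UNIV bd_index_chains strand_index_chains by blast+
    \<comment> \<open>The boundary of \<open>proj a\<close> is \<open>proj (bd a)\<close>, which by
      \<open>bd_Hc\<close> and the filtration involves only labels properly dividing
      \<open>q\<close>.\<close>
    have "proj (bd a) \<in> over ?\<Delta>"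
      using proj_over[OF lower_strict bd_Hc] qa by blast
    moreover have "proj (bd a) \<in> M_complex m L Hc Bc p"
      using a by (intro proj_M_complex)
    ultimately obtain b where b: "\<forall>r\<in>D \<inter> ?\<Delta>. b r \<in> Hc r p"
      "homogenize L q (proj (bd a)) = (\<Sum>r\<in>D \<inter> ?\<Delta>. smul (exact_quotient q r) (homogenize L r (proj (b r))))"
      using homogenize_proj_split[OF qa(1), of "proj (bd a)" p ?\<Delta>] by blast
    have "smul (exact_quotient q r) (homogenize L r (proj (b r))) \<in> ?T" if "r \<in> D \<inter> ?\<Delta>" for r
      using that b quotient_irrelevant qa proj_Hc_N by (intro chain.span_base) blast
    then have "homogenize L q (proj (bd a)) \<in> ?T"
      unfolding b(2) by (rule chain.span_sum)
    then show ?thesis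
      using proj_Hc(2)[OF qa] bd_proj a D_nonzero qa by (simp add: taylor_bd_below)
  qed
  have subspace: "chain.subspace {w. taylor_bd L w \<in> ?T}"
    using chain.subspace_span[of "{smul s z |s z. s \<in> irrelevant_ideal \<and> z \<in> N p}"]
    by (auto simp: chain.subspace_def taylor.add taylor.scale taylor.zero)
  from assms have "w \<in> {w. taylor_bd L w \<in> ?T}"
  proof (induction rule: N_induct)
    case (base q z)
    \<comment> \<open>An arbitrary generator of \<open>N (Suc p)\<close> is an S-combination of the
      elements covered by \<open>irr\<close>.\<close>
    then obtain a where a: "\<forall>r\<in>D \<inter> {r. r dvd q}. a r \<in> Hc r (Suc p)"
      "homogenize L q z = (\<Sum>r\<in>D \<inter> {r. r dvd q}. smul (exact_quotient q r) (homogenize L r (proj (a r))))"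
      using homogenize_proj_split[of q z "Suc p" "{r. r dvd q}"] by blast
    show ?case
      unfolding a(2)
      by (intro chain.subspace_sum[OF subspace] chain.subspace_scale[OF subspace] CollectI irr)
        (use a in auto)
  qed (rule subspace)
  then show ?thesis by simp
qed

end

section \<open>A homogeneous basis and minimality\<close>

context minimal_taylor
begin

lemma finite_independent_chains:
  fixes A :: "(nat set \<Rightarrow>\<^sub>0 'k) set"
  assumes "\<not> chain.dependent A" "A \<subseteq> index_chains m p"
  shows "finite A"
proof -
  let ?T = "(\<lambda>\<sigma>. Poly_Mapping.single \<sigma> (1 :: 'k)) ` Pow {..<m}"
  have "A \<subseteq> chain.span ?T"
  proof
    fix z assume "z \<in> A"
    then have "z \<in> index_chains m p"
      using assms by blast
    then show "z \<in> chain.span ?T"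
      by (rule index_chains_induct) (auto intro: chain.subspace_span chain.span_base)
  qed
  then show ?thesis
    using chain_space.independent_span_bound[of ?T A] assms by simp
qed

lemma Hc_basis:
  assumes "q \<in> D"
  shows "\<exists>A. A \<subseteq> Hc q p \<and> finite A \<and> \<not> chain.dependent A \<and> chain.span A = Hc q p"
proof -
  obtain A where A: "A \<subseteq> Hc q p" "\<not> chain.dependent A" "Hc q p \<subseteq> chain.span A"
    using chain_space.maximal_independent_subset by metis
  moreover have "A \<subseteq> index_chains m p"
    using A Hc_strand[OF assms] strand_index_chains by blast
  then have "finite A"
    using finite_independent_chains A by blast
  moreover have "chain.span A \<subseteq> Hc q p"
    using A decomposition(1)[OF assms] by (intro chain.span_minimal)
  ultimately show ?thesis
    by blast
qed

text \<open>Comparing the coefficients of each monomial t turns a relation over S into a relation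
  over the field.\<close>

lemma independent_over_mpoly:
  fixes A :: "(nat set \<Rightarrow>\<^sub>0 'k) set" and s :: "(nat set \<Rightarrow>\<^sub>0 'k) \<Rightarrow> ('n, 'k) mpoly"
  assumes "finite A" "\<not> chain.dependent A"
    and sum: "\<And>\<sigma>. (\<Sum>a\<in>A. mconst (lookup a \<sigma>) * s a) = 0" and "a \<in> A"
  shows "s a = 0"
proof (rule poly_mapping_eqI)
  fix t
  have "(\<Sum>a\<in>A. smul (lookup (s a) t) a) = 0"
  proof (rule poly_mapping_eqI)
    fix \<sigma>
    have "lookup (\<Sum>a\<in>A. smul (lookup (s a) t) a) \<sigma> = lookup (\<Sum>a\<in>A. mconst (lookup a \<sigma>) * s a) t"
      unfolding lookup_sum lookup_smul lookup_mconst_mult by (intro sum.cong refl mult.commute)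
    then show "lookup (\<Sum>a\<in>A. smul (lookup (s a) t) a) \<sigma> = lookup 0 \<sigma>"
      using sum by simp
  qed
  then show "lookup (s a) t = lookup 0 t"
    using assms chain.independentD[of A A "\<lambda>a. lookup (s a) t" a] by auto
qed

context
  fixes p :: nat and A :: "('n, 'k) mpoly \<Rightarrow> (nat set \<Rightarrow>\<^sub>0 'k) set"
  assumes A: "\<And>q. q \<in> D \<Longrightarrow> A q \<subseteq> Hc q p" "\<And>q. q \<in> D \<Longrightarrow> finite (A q)"
    "\<And>q. q \<in> D \<Longrightarrow> \<not> chain.dependent (A q)" "\<And>q. q \<in> D \<Longrightarrow> chain.span (A q) = Hc q p"
begin

abbreviation generator :: "('n, 'k) mpoly \<times> (nat set \<Rightarrow>\<^sub>0 'k) \<Rightarrow> (nat set \<Rightarrow>\<^sub>0 ('n, 'k) mpoly)" where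
  "generator j \<equiv> homogenize L (fst j) (proj (snd j))"

abbreviation J :: "(('n, 'k) mpoly \<times> (nat set \<Rightarrow>\<^sub>0 'k)) set" where
  "J \<equiv> SIGMA q:D. A q"

lemma finite_J: "finite J"
  using finite_D A(2) by (rule finite_SigmaI)

text \<open>
  If \<open>q\<close> is maximal with a nonzero coefficient at some generator \<open>(q, a)\<close>, then the part of the
  relation supported on \<open>{\<sigma>. L \<sigma> = q}\<close> only involves the leading terms \<open>a\<close>, which are independent.
\<close>

lemma generators_independent:
  assumes sum: "(\<Sum>j\<in>J. smul (s j) (generator j)) = 0" and j: "j \<in> J"
  shows "s j = 0"
proof (rule ccontr)
  assume "s j \<noteq> 0"
  define \<Delta> where "\<Delta> = {q \<in> D. \<exists>a\<in>A q. s (q, a) \<noteq> 0}"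
  have "\<Delta> \<noteq> {}" "\<Delta> \<subseteq> D"
    using \<open>s j \<noteq> 0\<close> j by (auto simp: \<Delta>_def)
  then obtain q where q: "q \<in> \<Delta>" and max: "\<And>r. r \<in> \<Delta> \<Longrightarrow> q dvd r \<Longrightarrow> r = q"
    using maximal_element by meson
  have qD: "q \<in> D"
    using q by (simp add: \<Delta>_def)
  have "(\<Sum>a\<in>A q. mconst (lookup a \<sigma>) * s (q, a)) = 0" for \<sigma>
  proof (cases "\<sigma> \<subseteq> {..<m} \<and> L \<sigma> = q")
    case False
    have "lookup a \<sigma> = 0" if "a \<in> A q" for a
      using Hc_strand[OF qD, of a p] A(1)[OF qD] that False strand_iff[of a q p]
      by (auto simp: in_keys_iff)
    then show ?thesis
      by simp
  next
    case True
    \<comment> \<open>If \<open>r\<close> is in \<open>\<Delta>\<close>, maximality of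
      \<open>q\<close> shows that \<open>q\<close> does not divide \<open>r\<close>, so
      \<open>proj a\<close> misses \<open>\<sigma>\<close>; otherwise the coefficient itself is
      zero.\<close>
    have other: "s (r, a) * lookup (generator (r, a)) \<sigma> = 0" if ra: "r \<in> D" "a \<in> A r" "r \<noteq> q" for r a
    proof (cases "r \<in> \<Delta>")
      case True
      then have "\<not> q dvd r"
        using max ra by blast
      moreover have "proj a \<in> below r"
        using ra A(1) by (intro proj_Hc(2)) auto
      ultimately have "\<sigma> \<notin> keys (proj a)"
        using below_dvd \<open>\<sigma> \<subseteq> {..<m} \<and> L \<sigma> = q\<close> by blast
      then show ?thesis
        by (simp add: lookup_homogenize in_keys_iff)
    next
      case False
      then show ?thesis
        using ra by (simp add: \<Delta>_def)
    qed
    \<comment> \<open>The rest of \<open>proj a\<close> has labels other than \<open>q\<close>, and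
      the quotient of \<open>q\<close> by \<open>L \<sigma>\<close> is 1.\<close>
    have leading: "lookup (generator (q, a)) \<sigma> = mconst (lookup a \<sigma>)" if a: "a \<in> A q" for a
    proof -
      have "proj a - a \<in> over {r. r dvd q \<and> r \<noteq> q}"
        using a A(1)[OF qD] qD by (intro proj_Hc(1)) auto
      then have "\<sigma> \<notin> keys (proj a - a)"
        using True by (auto simp: over_def)
      then have "lookup (proj a) \<sigma> = lookup a \<sigma>"
        by (simp add: in_keys_iff lookup_minus)
      then show ?thesis
        using True D_nonzero[OF qD] by (simp add: lookup_homogenize exact_quotient_self)
    qed
    have "0 = lookup (\<Sum>j\<in>J. smul (s j) (generator j)) \<sigma>"
      using sum by simp
    also have "\<dots> = (\<Sum>r\<in>D. \<Sum>a\<in>A r. s (r, a) * lookup (generator (r, a)) \<sigma>)"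
      unfolding lookup_sum lookup_smul using finite_D A(2) by (subst sum.Sigma) (auto simp: case_prod_unfold)
    also have "\<dots> = (\<Sum>r\<in>D. if r = q then (\<Sum>a\<in>A q. s (q, a) * lookup (generator (q, a)) \<sigma>) else 0)"
      using other by (intro sum.cong) (auto intro!: sum.neutral simp del: mult_eq_0_iff)
    also have "\<dots> = (\<Sum>a\<in>A q. s (q, a) * lookup (generator (q, a)) \<sigma>)"
      using qD finite_D by simp
    also have "\<dots> = (\<Sum>a\<in>A q. mconst (lookup a \<sigma>) * s (q, a))"
      using leading by (intro sum.cong) (auto simp: mult.commute)
    finally show ?thesis
      by simp
  qed
  then have "s (q, a) = 0" if "a \<in> A q" for a
    using independent_over_mpoly[of "A q" "\<lambda>a. s (q, a)" a] A qD that by blast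
  then show False
    using q by (auto simp: \<Delta>_def)
qed

text \<open>The basis in \<open>graded_free\<close> is a set, so repetitions in the family must be
  excluded. Two equal generators would give a relation with coefficients 1 and -1.\<close>

lemma inj_on_generator: "inj_on generator J"
proof (rule inj_onI, rule ccontr)
  fix i j assume ij: "i \<in> J" "j \<in> J" "generator i = generator j" "i \<noteq> j"
  define s :: "_ \<Rightarrow> ('n, 'k) mpoly" where "s k = (if k = i then 1 else 0) - (if k = j then 1 else 0)" for k
  have one: "smul (if k = l then 1 else 0) (generator k) = (if k = l then generator l else 0)"
    for k l :: "('n, 'k) mpoly \<times> (nat set \<Rightarrow>\<^sub>0 'k)"
    by simp
  have "(\<Sum>k\<in>J. smul (s k) (generator k)) =
      (\<Sum>k\<in>J. if k = i then generator i else 0) - (\<Sum>k\<in>J. if k = j then generator j else 0)"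
    unfolding s_def chain.scale_left_diff_distrib one sum_subtractf ..
  also have "\<dots> = 0"
    using ij finite_J by simp
  finally have "s i = 0"
    using ij generators_independent by blast
  then show False
    using ij by (simp add: s_def)
qed

lemma generators_not_dependent: "\<not> chain.dependent (generator ` J)"
proof -
  have "f x = 0" if f: "(\<Sum>x\<in>generator ` J. smul (f x) x) = 0" and x: "x \<in> generator ` J" for f x
  proof -
    have "(\<Sum>j\<in>J. smul (f (generator j)) (generator j)) = 0"
      using f by (simp add: sum.reindex[OF inj_on_generator])
    then show ?thesis
      using x generators_independent[of "\<lambda>j. f (generator j)"] by blast
  qed
  moreover have "finite (generator ` J)"
    using finite_J by simp
  ultimately show ?thesis
    by (subst chain.dependent_finite) blast+
qed

lemma homogenize_proj_span:
  assumes q: "q \<in> D" and a: "a \<in> Hc q p"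
  shows "homogenize L q (proj a) \<in> chain.span (generator ` J)"
proof -
  let ?S = "{a \<in> over UNIV. homogenize L q (proj a) \<in> chain.span (generator ` J)}"
  have "proj 0 = 0"
    using proj_sum[of "{}"] by simp
  then have "chain.subspace ?S"
    using chain.subspace_span[of "generator ` J"] subspace_over[of UNIV]
    by (auto simp: chain.subspace_def proj_add homogenize_add proj_smul homogenize_smul)
  moreover have "A q \<subseteq> ?S"
  proof
    fix a assume a: "a \<in> A q"
    then have "a \<in> over UNIV"
      using A(1)[OF q] Hc_strand[OF q, of a p] strand_over_UNIV by blast
    moreover have "generator (q, a) \<in> chain.span (generator ` J)"
      using a q by (intro chain.span_base imageI) auto
    ultimately show "a \<in> ?S"
      by simp
  qed
  ultimately have "chain.span (A q) \<subseteq> ?S"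
    by (rule chain.span_minimal[rotated])
  then show ?thesis
    using a A(4)[OF q] by blast
qed

lemma span_generators: "chain.span (generator ` J) = N p"
proof
  have "generator ` J \<subseteq> N p"
    using proj_Hc_N A(1) by fastforce
  then show "chain.span (generator ` J) \<subseteq> N p"
    by (rule chain.span_minimal) (rule subspace_N)
  show "N p \<subseteq> chain.span (generator ` J)"
  proof
    fix w assume "w \<in> N p"
    then show "w \<in> chain.span (generator ` J)"
    proof (induction rule: N_induct)
      case (base q z)
      then obtain a where a: "\<forall>r\<in>D \<inter> {r. r dvd q}. a r \<in> Hc r p"
        "homogenize L q z = (\<Sum>r\<in>D \<inter> {r. r dvd q}. smul (exact_quotient q r) (homogenize L r (proj (a r))))"
        using homogenize_proj_split[of q z p "{r. r dvd q}"] by blast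
      show ?case
        unfolding a(2) by (intro chain.span_sum chain.span_scale homogenize_proj_span) (use a in auto)
    qed (rule chain.subspace_span)
  qed
qed

lemma generator_homogeneous:
  assumes "j \<in> J"
  shows "\<exists>e. taylor_homogeneous L e (generator j)"
proof -
  obtain q a where j: "j = (q, a)" "q \<in> D" "a \<in> Hc q p"
    using assms A(1) by auto
  then obtain e where "homogeneous_of_degree e q"
    using L_homogeneous by (auto simp: lcm_lattice_def homogeneous_def)
  then have "taylor_homogeneous L e (homogenize L q (proj a))"
    using j proj_Hc(2) D_nonzero below_dvd by (intro taylor_homogeneous_homogenize) blast+
  then show ?thesis
    using j by auto
qed

end

lemma graded_free_N: "graded_free (taylor_homogeneous L) (N p)"
proof -
  have "\<forall>q\<in>D. \<exists>A. A \<subseteq> Hc q p \<and> finite A \<and> \<not> chain.dependent A \<and> chain.span A = Hc q p"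
    using Hc_basis by blast
  then obtain A where A: "\<forall>q\<in>D. A q \<subseteq> Hc q p \<and> finite (A q) \<and> \<not> chain.dependent (A q) \<and> chain.span (A q) = Hc q p"
    by (rule bchoice[THEN exE])
  let ?E = "(\<lambda>j. homogenize L (fst j) (proj (snd j))) ` (SIGMA q:D. A q)"
  have "finite ?E" "\<not> chain.dependent ?E" "chain.span ?E = N p"
    using A finite_D generators_not_dependent[of A p] span_generators[of A p] by simp_all
  moreover have "\<forall>b\<in>?E. \<exists>e. taylor_homogeneous L e b"
    using A generator_homogeneous[of A p] by blast
  ultimately show ?thesis
    unfolding graded_free_def by blast
qed

section \<open>Exactness, augmentation and minimality\<close>

lemma M_tilde_exact:
  assumes "w \<in> N (Suc p)" "taylor_bd L w = 0"
  shows "w \<in> taylor_bd L ` N (Suc (Suc p))"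
proof -
  have "w \<in> {z \<in> index_chains m (Suc p). taylor_bd L z = 0}"
    using assms N_index_chains by blast
  then have "w \<in> taylor_bd L ` index_chains m (Suc (Suc p))"
    using resolution unfolding graded_free_resolution_def by blast
  then obtain v where v: "v \<in> index_chains m (Suc (Suc p))" "w = taylor_bd L v"
    by blast
  \<comment> \<open>A preimage in the Taylor complex projects to one in \<open>N\<close>, since
    \<open>taylor_proj\<close> commutes with the differential and fixes \<open>w\<close>.\<close>
  then have "w = taylor_bd L (taylor_proj v)"
    using taylor_proj_taylor_bd taylor_proj_N assms by metis
  then show ?thesis
    using taylor_proj_in_N v by blast
qed

lemma augmentation_kernel: "{z \<in> N 0. augmentation z \<in> I} = taylor_bd L ` N 1"
proof -
  have eq: "{z \<in> index_chains m 0. augmentation z \<in> I} = taylor_bd L ` index_chains m 1"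
    using resolution unfolding graded_free_resolution_def by blast
  show ?thesis
  proof
    show "taylor_bd L ` N 1 \<subseteq> {z \<in> N 0. augmentation z \<in> I}"
      using eq taylor_bd_N[of _ 0] N_index_chains[of _ 1] by auto
    show "{z \<in> N 0. augmentation z \<in> I} \<subseteq> taylor_bd L ` N 1"
    proof
      fix w assume w: "w \<in> {z \<in> N 0. augmentation z \<in> I}"
      then obtain v where v: "v \<in> index_chains m 1" "w = taylor_bd L v"
        using eq N_index_chains by blast
      then have "w = taylor_bd L (taylor_proj v)"
        using taylor_proj_taylor_bd taylor_proj_N w by (metis (lifting) mem_Collect_eq)
      then show "w \<in> taylor_bd L ` N 1"
        using taylor_proj_in_N v by blast
    qed
  qed
qed

text \<open>The basis element on the empty set need not lie in \<open>N 0\<close>. Its boundary is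
  0, so it differs from its projection by the boundary of its contraction, and boundaries have
  augmentation in \<open>I\<close>.\<close>

lemma augmentation_surjective: "\<exists>z\<in>N 0. s - augmentation z \<in> I"
proof -
  interpret aug: module_hom smul "(*)" "augmentation :: _ \<Rightarrow> ('n, 'k) mpoly"
    by (rule taylor_hom)
  let ?u = "Poly_Mapping.single {} 1 :: nat set \<Rightarrow>\<^sub>0 'k"
  let ?U = "Poly_Mapping.single {} 1 :: nat set \<Rightarrow>\<^sub>0 ('n, 'k) mpoly"
  have u: "?u \<in> index_chains m 0" "?u \<in> below (L {})"
    by (simp_all add: index_chains_def over_def)
  have L: "L {} \<noteq> 0"
    using L_nonzero by simp
  have "?u = proj ?u + bd (contraction ?u)"
    using bd_index_chains_0[OF u(1)] contraction_Wt[OF chain.subspace_0[OF subspace_Wt]]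
    by (simp add: proj_def)
  moreover have c: "contraction ?u \<in> index_chains m 1" "contraction ?u \<in> below (L {})"
    using contraction_index_chains[OF u(1)] contraction_over[OF lower_dvd u(2)] by simp_all
  ultimately have "homogenize L (L {}) ?u =
      homogenize L (L {}) (proj ?u) + taylor_bd L (homogenize L (L {}) (contraction ?u))"
    using L by (metis homogenize_add taylor_bd_below)
  then have U: "?U = taylor_proj ?U + taylor_bd L (homogenize L (L {}) (contraction ?u))"
    using taylor_proj_homogenize[OF u(2) L] single_eq_homogenize[of "{}"] by simp
  define b where "b = taylor_bd L (smul s (homogenize L (L {}) (contraction ?u)))"
  have "?U - taylor_proj ?U = taylor_bd L (homogenize L (L {}) (contraction ?u))"
    using U by (metis add_diff_cancel_left')
  then have "smul s ?U - smul s (taylor_proj ?U) = b"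
    by (simp only: b_def taylor.scale flip: chain.scale_right_diff_distrib)
  then have "augmentation (smul s ?U) - augmentation (smul s (taylor_proj ?U)) = augmentation b"
    by (simp only: flip: aug.diff)
  moreover have "b \<in> taylor_bd L ` index_chains m 1"
    unfolding b_def
    by (intro imageI chain.subspace_scale[OF subspace_index_chains] homogenize_index_chains c)
  then have "augmentation b \<in> I"
    using resolution unfolding graded_free_resolution_def by blast
  moreover have "augmentation (smul s ?U) = s"
    by (simp add: augmentation_def lookup_smul)
  moreover have "smul s (taylor_proj ?U) \<in> N 0"
    by (intro chain.subspace_scale[OF subspace_N] taylor_proj_in_N) (simp add: index_chains_def)
  ultimately show ?thesis
    by metis
qed

theorem minimal_resolution:
  "minimal_graded_free_resolution (taylor_homogeneous L) N (taylor_bd L) augmentation I"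
proof -
  have grading: "\<forall>p e z. z \<in> index_chains m (Suc p) \<and> taylor_homogeneous L e z \<longrightarrow> taylor_homogeneous L e (taylor_bd L z)"
    "\<forall>e z. z \<in> index_chains m 0 \<and> taylor_homogeneous L e z \<longrightarrow> homogeneous_of_degree e (augmentation z)"
    and exact: "\<forall>p. {z \<in> index_chains m (Suc p). taylor_bd L z = 0} = taylor_bd L ` index_chains m (Suc (Suc p))"
    using resolution unfolding graded_free_resolution_def by - (elim conjE, assumption)+
  have zero: "taylor_bd L (taylor_bd L w) = 0" if "w \<in> N (Suc (Suc p))" for w p
    using exact N_index_chains[OF that] by blast
  have "graded_free_resolution (taylor_homogeneous L) N (taylor_bd L) augmentation I"
    unfolding graded_free_resolution_def
  proof (intro conjI allI)
    fix p
    show "{z \<in> N (Suc p). taylor_bd L z = 0} = taylor_bd L ` N (Suc (Suc p))"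
      using M_tilde_exact taylor_bd_N zero by blast
  next
    fix p e z
    show "z \<in> N (Suc p) \<and> taylor_homogeneous L e z \<longrightarrow> taylor_homogeneous L e (taylor_bd L z)"
      using grading(1) N_index_chains by blast
  next
    fix e z
    show "z \<in> N 0 \<and> taylor_homogeneous L e z \<longrightarrow> homogeneous_of_degree e (augmentation z)"
      using grading(2) N_index_chains by blast
  qed (use taylor_bd_N in \<open>auto simp: graded_free_N taylor_hom
      augmentation_surjective augmentation_kernel\<close>)
  then show ?thesis
    unfolding minimal_graded_free_resolution_def using taylor_bd_N_irrelevant by blast
qed

end

theorem theorem4p3:
  fixes Q :: "nat \<Rightarrow> ('n::{finite,linorder}, 'k::field) mpoly"
    and m :: nat
    and I R :: "('n, 'k) mpoly set"
    and L :: "nat set \<Rightarrow> ('n, 'k) mpoly"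
    and Hc Bc :: "('n, 'k) mpoly \<Rightarrow> nat \<Rightarrow> (nat set \<Rightarrow>\<^sub>0 'k) set"
  assumes "\<forall>i<m. homogeneous (Q i)"
    and "minimally_generates m Q I"
    and "irreducible_representatives m Q R"
    and "\<forall>\<sigma>. \<sigma> \<subseteq> {..<m} \<longrightarrow> normalized_lcm R (Q ` \<sigma>) (L \<sigma>)"
    and "strand_decompositions m L Hc Bc"
    and "graded_free_resolution (taylor_homogeneous L) (index_chains m) (taylor_bd L) augmentation I"
  shows "minimal_graded_free_resolution (taylor_homogeneous L) (M_tilde m L Hc Bc)
           (taylor_bd L) augmentation I"
proof -
  \<comment> \<open>Zero lies in every ideal, so a zero generator would contradict minimal
    generation.\<close>
  have Q_nonzero: "Q i \<noteq> 0" if "i < m" for i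
  proof
    assume "Q i = 0"
    then have "Q i \<in> ideal_generated (Q ` ({..<m} - {i}))"
      unfolding ideal_generated_def using ring_mod.span_zero by metis
    then show False
      using assms(2) that unfolding minimally_generates_def by blast
  qed
  have norm: "normalized_lcm R (Q ` \<sigma>) (L \<sigma>)" if "\<sigma> \<subseteq> {..<m}" for \<sigma>
    using assms(4) that by blast
  have lcm: "is_lcm (Q ` \<sigma>) (L \<sigma>)" if "\<sigma> \<subseteq> {..<m}" for \<sigma>
    using norm[OF that] by (simp add: normalized_lcm_def)
  \<comment> \<open>The product is a nonzero homogeneous common multiple, and both properties pass
    to the divisor \<open>L \<sigma>\<close>.\<close>
  have divides_prod: "L \<sigma> dvd (\<Prod>i\<in>\<sigma>. Q i) \<and> (\<Prod>i\<in>\<sigma>. Q i) \<noteq> 0 \<and> homogeneous (\<Prod>i\<in>\<sigma>. Q i)"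
    if \<sigma>: "\<sigma> \<subseteq> {..<m}" for \<sigma>
  proof -
    have fin: "finite \<sigma>"
      using \<sigma> finite_subset by blast
    have "Q i dvd (\<Prod>i\<in>\<sigma>. Q i)" if "i \<in> \<sigma>" for i
      using fin that by (rule dvd_prodI)
    then have "L \<sigma> dvd (\<Prod>i\<in>\<sigma>. Q i)"
      using lcm[OF \<sigma>] unfolding is_lcm_def by blast
    moreover have "(\<Prod>i\<in>\<sigma>. Q i) \<noteq> 0"
      using fin \<sigma> Q_nonzero by (auto simp: prod_zero_iff)
    moreover have "homogeneous (\<Prod>i\<in>\<sigma>. Q i)"
      using fin \<sigma> assms(1) by (intro homogeneous_prod) auto
    ultimately show ?thesis
      by blast
  qed
  have nonzero: "L \<sigma> \<noteq> 0" if "\<sigma> \<subseteq> {..<m}" for \<sigma>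
    using divides_prod[OF that] by auto
  have hom: "homogeneous (L \<sigma>)" if "\<sigma> \<subseteq> {..<m}" for \<sigma>
    using divides_prod[OF that] homogeneous_dvd by blast
  have mono: "L \<sigma> dvd L \<tau>" if "\<sigma> \<subseteq> \<tau>" "\<tau> \<subseteq> {..<m}" for \<sigma> \<tau>
  proof -
    have "\<forall>a\<in>Q ` \<sigma>. a dvd L \<tau>"
      using lcm[OF that(2)] that(1) unfolding is_lcm_def by blast
    then show ?thesis
      using lcm[of \<sigma>] that unfolding is_lcm_def by blast
  qed
  have antisym: "L \<sigma> = L \<tau>" if "\<sigma> \<subseteq> {..<m}" "\<tau> \<subseteq> {..<m}" "L \<sigma> dvd L \<tau>" "L \<tau> dvd L \<sigma>" for \<sigma> \<tau>
    using normalized_lcm_antisym[OF assms(3) norm[OF that(1)] norm[OF that(2)] that(3,4)] .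
  \<comment> \<open>A unit quotient would make the two lcms associated, hence equal by
    \<open>antisym\<close>.\<close>
  have irrelevant: "exact_quotient (L \<tau>) (L \<sigma>) \<in> irrelevant_ideal"
    if "\<sigma> \<subseteq> {..<m}" "\<tau> \<subseteq> {..<m}" "L \<sigma> dvd L \<tau>" "L \<sigma> \<noteq> L \<tau>" for \<sigma> \<tau>
  proof (rule homogeneous_nonunit_irrelevant)
    let ?c = "exact_quotient (L \<tau>) (L \<sigma>)"
    have c: "L \<sigma> * ?c = L \<tau>"
      using that nonzero by (intro exact_quotient_mult)
    then have "?c dvd L \<tau>"
      by (metis dvd_triv_right)
    then show "homogeneous ?c"
      using homogeneous_dvd hom nonzero that by blast
    show "?c \<noteq> 0"
      using c nonzero[OF that(2)] by auto
    show "\<not> ?c dvd 1"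
    proof
      assume "?c dvd 1"
      then have "L \<tau> dvd L \<sigma>"
        using c by (metis dvd_refl mult.right_neutral mult_dvd_mono)
      then show False
        using antisym that by blast
    qed
  qed
  interpret taylor_resolution m L I
    by unfold_locales (use mono nonzero assms(6) in auto)
  interpret minimal_taylor m L I Hc Bc
  proof unfold_locales
    fix q r assume "q \<in> lcm_lattice m L" "r \<in> lcm_lattice m L" "r dvd q" "r \<noteq> q"
    then show "exact_quotient q r \<in> irrelevant_ideal"
      using irrelevant by (auto simp: lcm_lattice_def)
  qed (rule mono antisym hom bd_bd_zero assms(5); assumption)+
  show ?thesis
    by (rule minimal_resolution)
qed

end
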